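(* Fix $d\ge1$, and let $\mathbf{M}^n_t$ be the empirical measure process for the earthworm process on the graph $G=C_n^d$ with vertex set $V$. Assume that $M^v_0=1/n^d$ for $v\in V$ (hence $\sum_{v\in V}M^v_0=1$). (i) For every $n$, the random measures $\mathbf{M}^n_t$ converge weakly (in distribution) to a random measure $\mathbf{M}^n_\infty$, when $t\to\infty$. (ii) For $R\subset\mathbb{R}^d$ and $a\in\mathbb{R}$, let $aR=\{x\in\mathbb{R}^d: x=ay\text{ for some }y\in R\}$, and let $\widehat{\mathbf{M}}^n_\infty(R)=\mathbf{M}^n_\infty(nR)$. When $n\to\infty$, the random measures $\widehat{\mathbf{M}}^n_\infty$ converge weakly (in distribution) to the random measure equal to, a.s., the uniform probability measure on $[0,1]^d$.
   Context: $C_n$, $n\ge2$, is the circular graph with vertices $1,\dots,n$ and edges between cyclically consecutive vertices (no multiple edges), and $C_n^d$ is the discrete torus: its vertex set $V=\{1,\dots,n\}^d$ is regarded as a subset of $\mathbb{R}^d$, and two vertices are adjacent if and only if they differ in exactly one coordinate and those coordinates are adjacent in $C_n$. $d_v$ denotes the degree of $v$. Earthworm process: let $B_t$ (the "earthworm") be a continuous time simple random walk on $G$, i.e. a Markov process on $V$ that stays constant for an exponential (mean 1) amount of time and jumps to a uniformly chosen nearest neighbor at the end of the holding time (the initial position of $B$ is irrelevant by symmetry). At the time $t$ of a jump of $B$, the mass at the new position $v=B_t$ is distributed equally to its neighbors: $M^v_t=0$, $M^x_t=M^x_{t-}+M^v_{t-}/d_v$ for every neighbor $x$ of $v$, and all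 other masses are unchanged. The masses are constant between the jumps of $B$. The empirical measure is $\mathbf{M}_t=\sum_{v\in V}M^v_t\,\delta_v$, where $\delta_v$ is the unit atom at $v$; it is denoted $\mathbf{M}^n_t$ when $G=C_n^d$. *)

theory Defs
  imports "HOL-Probability.Probability"
begin

section \<open>Discrete torus\<close>

text \<open>A simple graph is given by its adjacency relation.\<close>

definition vertex_degree :: "('v \<Rightarrow> 'v \<Rightarrow> bool) \<Rightarrow> 'v \<Rightarrow> nat" where
  "vertex_degree E v = card {x. E v x}"

definition cycle_adj :: "nat \<Rightarrow> nat \<Rightarrow> nat \<Rightarrow> bool" where
  "cycle_adj n a b \<longleftrightarrow> a \<in> {1..n} \<and> b \<in> {1..n} \<and> a \<noteq> b \<and>
     (b mod n = (a + 1) mod n \<or> a mod n = (b + 1) mod n)"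

definition torus_verts :: "nat \<Rightarrow> (nat ^ 'd) set" where
  "torus_verts n = {v. \<forall>i. v $ i \<in> {1..n}}"

definition torus_adj :: "nat \<Rightarrow> nat ^ 'd \<Rightarrow> nat ^ 'd \<Rightarrow> bool" where
  "torus_adj n u v \<longleftrightarrow> u \<in> torus_verts n \<and> v \<in> torus_verts n \<and>
     (\<exists>i. cycle_adj n (u $ i) (v $ i) \<and> (\<forall>j. j \<noteq> i \<longrightarrow> u $ j = v $ j))"

definition torus_point :: "nat ^ 'd \<Rightarrow> real ^ 'd" where
  "torus_point v = (\<chi> i. real (v $ i))"

section \<open>Continuous time simple random walk\<close>

text \<open>
  The walk \<open>B\<close> is given by its successive positions \<open>X 0, X 1, \<dots>\<close> and its holding times
  \<open>\<tau> 0, \<tau> 1, \<dots>\<close>: it sits at \<open>X k\<close> during the time interval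
  \<open>[\<tau> 0 + \<dots> + \<tau> (k - 1), \<tau> 0 + \<dots> + \<tau> k)\<close>.
  The law of the initial position \<open>X 0\<close> is arbitrary.
\<close>

locale random_walk = prob_space P
  for P :: "'w measure"
    and V :: "'v set" and E :: "'v \<Rightarrow> 'v \<Rightarrow> bool"
    and X :: "nat \<Rightarrow> 'w \<Rightarrow> 'v" and \<tau> :: "nat \<Rightarrow> 'w \<Rightarrow> real" +
  assumes position: "\<And>k. X k \<in> P \<rightarrow>\<^sub>M count_space V"
    and uniform_step: "\<And>k x.
      prob {\<omega> \<in> space P. \<forall>i\<le>Suc k. X i \<omega> = x i} =
      prob {\<omega> \<in> space P. \<forall>i\<le>k. X i \<omega> = x i} *
        (if E (x k) (x (Suc k)) then 1 / real (vertex_degree E (x k)) else 0)"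
    and holding_indep: "indep_vars (\<lambda>_. borel) \<tau> UNIV"
    and holding_exponential: "\<And>k. distributed P lborel (\<tau> k) (exponential_density 1)"
    and positions_indep_holding: "indep_set
      (sets (vimage_algebra (space P) (\<lambda>\<omega> k. X k \<omega>) (Pi\<^sub>M UNIV (\<lambda>_. count_space V))))
      (sets (vimage_algebra (space P) (\<lambda>\<omega> k. \<tau> k \<omega>) (Pi\<^sub>M UNIV (\<lambda>_. borel))))"

text \<open>
  The number of jumps up to and including time \<open>t\<close>, so that \<open>B\<^sub>t = X (jump_count \<tau> t)\<close>;
  almost surely the set below is finite for all \<open>t\<close>.
\<close>

definition jump_count :: "(nat \<Rightarrow> 'w \<Rightarrow> real) \<Rightarrow> real \<Rightarrow> 'w \<Rightarrow> nat" where
  "jump_count \<tau> t \<omega> = card {k. 1 \<le> k \<and> (\<Sum>i<k. \<tau> i \<omega>) \<le> t}"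

section \<open>Earthworm process\<close>

definition spread :: "('v \<Rightarrow> 'v \<Rightarrow> bool) \<Rightarrow> 'v \<Rightarrow> ('v \<Rightarrow> real) \<Rightarrow> 'v \<Rightarrow> real" where
  "spread E v m = (\<lambda>x. if x = v then 0
                       else if E v x then m x + m v / real (vertex_degree E v)
                       else m x)"

text \<open>The masses after \<open>k\<close> jumps; the initial position \<open>x 0\<close> does not trigger a redistribution.\<close>

primrec mass_after :: "('v \<Rightarrow> 'v \<Rightarrow> bool) \<Rightarrow> ('v \<Rightarrow> real) \<Rightarrow> (nat \<Rightarrow> 'v) \<Rightarrow> nat \<Rightarrow> 'v \<Rightarrow> real" where
  "mass_after E m0 x 0 = m0"
| "mass_after E m0 x (Suc k) = spread E (x (Suc k)) (mass_after E m0 x k)"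

definition earthworm_mass ::
    "('v \<Rightarrow> 'v \<Rightarrow> bool) \<Rightarrow> ('v \<Rightarrow> real) \<Rightarrow> (nat \<Rightarrow> 'w \<Rightarrow> 'v) \<Rightarrow> (nat \<Rightarrow> 'w \<Rightarrow> real) \<Rightarrow>
     real \<Rightarrow> 'w \<Rightarrow> 'v \<Rightarrow> real" where
  "earthworm_mass E m0 X \<tau> t \<omega> = mass_after E m0 (\<lambda>k. X k \<omega>) (jump_count \<tau> t \<omega>)"

section \<open>Empirical measure\<close>

definition empirical_measure :: "(nat ^ 'd) set \<Rightarrow> (nat ^ 'd \<Rightarrow> real) \<Rightarrow> (real ^ 'd) measure" where
  "empirical_measure V m = distr (point_measure V (\<lambda>v. ennreal (m v))) borel torus_point"

lemma emeasure_empirical_measure: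
  assumes "finite V" "A \<in> sets borel"
  shows "emeasure (empirical_measure V m) A =
    (\<Sum>v\<in>V. ennreal (m v) * emeasure (return borel (torus_point v)) A)"
proof -
  have "emeasure (empirical_measure V m) A =
      emeasure (point_measure V (\<lambda>v. ennreal (m v))) (torus_point -` A \<inter> V)"
    unfolding empirical_measure_def using assms
    by (subst emeasure_distr) (auto simp: space_point_measure measurable_def sets_point_measure)
  also have "\<dots> = (\<Sum>v\<in>torus_point -` A \<inter> V. ennreal (m v))"
    using assms by (subst emeasure_point_measure_finite) auto
  also have "\<dots> = (\<Sum>v\<in>V. if v \<in> torus_point -` A then ennreal (m v) else 0)"
    using assms by (simp add: Int_commute[of _ V] sum.inter_restrict)
  also have "\<dots> = (\<Sum>v\<in>V. ennreal (m v) * emeasure (return borel (torus_point v)) A)"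
    using assms by (intro sum.cong) (auto simp: indicator_def)
  finally show ?thesis .
qed

definition rescaled :: "real \<Rightarrow> 'a::real_normed_vector measure \<Rightarrow> 'a measure" where
  "rescaled a \<mu> = distr \<mu> borel (\<lambda>x. x /\<^sub>R a)"

lemma emeasure_rescaled:
  fixes \<mu> :: "'a::real_normed_vector measure"
  assumes "a \<noteq> 0" "sets \<mu> = sets borel" "R \<in> sets borel"
  shows "emeasure (rescaled a \<mu>) R = emeasure \<mu> ((\<lambda>y. a *\<^sub>R y) ` R)"
proof -
  have meas: "(\<lambda>x::'a. x /\<^sub>R a) \<in> borel_measurable \<mu>"
    unfolding measurable_cong_sets[OF assms(2) refl]
    by (intro borel_measurable_continuous_onI continuous_intros)
  have "space \<mu> = UNIV"
    using sets_eq_imp_space_eq[OF assms(2)] by simp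
  moreover have "(\<lambda>x. x /\<^sub>R a) -` R = (\<lambda>y. a *\<^sub>R y) ` R"
    using assms(1) by (force simp: image_iff intro: bexI[rotated])
  ultimately show ?thesis
    unfolding rescaled_def by (simp add: emeasure_distr[OF meas assms(3)])
qed

section \<open>Convergence of random measures in distribution\<close>

definition finite_borel_measures :: "'a::topological_space measure set" where
  "finite_borel_measures = {\<mu>. sets \<mu> = sets borel \<and> finite_measure \<mu>}"

text \<open>
  The coarsest topology on the finite Borel measures that makes \<open>\<mu> \<mapsto> \<integral> f \<partial>\<mu>\<close> continuous
  for every bounded continuous \<open>f\<close>.
\<close>

definition weak_topology :: "'a::topological_space measure topology" where
  "weak_topology = topology_generated_by
     {{\<mu> \<in> finite_borel_measures. (\<integral>x. f x \<partial>\<mu>) \<in> U} | (f :: 'a \<Rightarrow> real) U.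
        continuous_on UNIV f \<and> bounded (range f) \<and> open U}"

lemma topspace_weak_topology: "topspace weak_topology = finite_borel_measures"
proof -
  have "finite_borel_measures \<in> {{\<mu> \<in> finite_borel_measures. (\<integral>x. f x \<partial>\<mu>) \<in> U} | (f :: 'a \<Rightarrow> real) U.
        continuous_on UNIV f \<and> bounded (range f) \<and> open U}"
    by (auto intro!: exI[of _ "\<lambda>_. 0"] exI[of _ UNIV])
  then show ?thesis
    unfolding weak_topology_def topology_generated_by_topspace by blast
qed

definition borel_of :: "'a topology \<Rightarrow> 'a measure" where
  "borel_of T = sigma (topspace T) {U. openin T U}"

definition random_element :: "'a topology \<Rightarrow> 'w measure \<Rightarrow> ('w \<Rightarrow> 'a) \<Rightarrow> bool" where
  "random_element T P \<xi> \<longleftrightarrow> prob_space P \<and> \<xi> \<in> P \<rightarrow>\<^sub>M borel_of T"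

text \<open>
  On a separable metric space the Borel sets of the weak topology are generated by the evaluations
  \<open>\<mu> \<mapsto> \<mu> A\<close>, so this is the usual notion of a (finite) random measure on, e.g., \<open>\<real>\<^sup>d\<close>.
\<close>

abbreviation random_measure ::
    "'w measure \<Rightarrow> ('w \<Rightarrow> 'a::topological_space measure) \<Rightarrow> bool" where
  "random_measure \<equiv> random_element weak_topology"

definition converges_in_distribution ::
    "'a topology \<Rightarrow> ('i \<Rightarrow> 'w measure) \<Rightarrow> ('i \<Rightarrow> 'w \<Rightarrow> 'a) \<Rightarrow>
     'u measure \<Rightarrow> ('u \<Rightarrow> 'a) \<Rightarrow> 'i filter \<Rightarrow> bool" where
  "converges_in_distribution T P \<xi> Q \<eta> F \<longleftrightarrow>
     (\<forall>\<^sub>F i in F. random_element T (P i) (\<xi> i)) \<and> random_element T Q \<eta> \<and>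
     (\<forall>g. continuous_map T euclideanreal g \<and> bounded (g ` topspace T) \<longrightarrow>
        ((\<lambda>i. \<integral>\<omega>. g (\<xi> i \<omega>) \<partial>P i) \<longlongrightarrow> (\<integral>\<omega>. g (\<eta> \<omega>) \<partial>Q)) F)"

end

theory Submission
  imports Defs "HOL-Real_Asymp.Real_Asymp"
begin

text \<open>
  The number of jumps up to time \<open>t\<close> is Poisson distributed and independent of the positions, so the
  mean of a functional of the masses at time \<open>t\<close> is a Poisson average, over \<open>k\<close>, of its mean after
  \<open>k\<close> jumps (\<open>expectation_earthworm\<close>). At large times such averages do not see a shift of the index
  (\<open>poisson_null_shift\<close>). This one fact takes the place of stationarity in everything below; in
  particular it absorbs the period two of the walk on a torus of even side. Most of the proof works on
  a finite connected \<open>D\<close>-regular graph with \<open>N\<close> vertices. Its averaging operator is written \<open>avg\<close>, and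
  \<open>green\<close> is the inverse of \<open>1 - avg\<close> on functions of mean zero.

  Convergence in time. Redistributions are linear, and the dual of a redistribution at \<open>v\<close> replaces
  the value of a function at \<open>v\<close> by the average over the neighbours of \<open>v\<close>. A walk that visits all
  vertices shrinks the oscillation of such a function by a fixed factor (\<open>osc_fold_update\<close>). Hence, if
  a walk is read backwards and extended further into the past, the resulting masses form almost surely
  a Cauchy sequence (\<open>back_mass_cauchy\<close>, \<open>AE_back_mass_tendsto\<close>). Path weights are invariant under
  reversal, so the law of the masses after \<open>n\<close> jumps from \<open>x\<close> is that of the backward masses of a
  stationary walk \<open>Y\<close> given \<open>Y n = x\<close> (\<open>masses_reversal\<close>), and in the Poisson average over \<open>n\<close> this
  condition becomes independent of the beginning of \<open>Y\<close> (\<open>visits_mean\<close>). The limit of the backward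
  masses is therefore the limit in law of the masses (\<open>masses_converge\<close>).

  Scaling limit. Let \<open>m\<close> be the masses, \<open>b\<close> the position of the earthworm and \<open>F f\<close> the integral of
  \<open>f\<close> against \<open>m\<close>. The one-step drift of every bounded function of \<open>(m, b)\<close> averages to zero
  (\<open>time_mean_drift\<close>). For the integral of \<open>g \<cdot> green b\<close> against \<open>m\<close> this shows that the mean of \<open>F g\<close>
  tends to the mean of \<open>g\<close> over the vertices (\<open>time_mean_integral\<close>). For an eigenfunction,
  \<open>avg f = (1 - \<lambda>) f\<close>, the drifts of \<open>(F f)\<^sup>2\<close> and of \<open>F f\<close> times the integral of \<open>f \<cdot> green b\<close> contain the
  same mixed term; eliminating it bounds the mean of \<open>(F f)\<^sup>2\<close> by a multiple of
  \<open>\<eta> + A \<lambda>\<close> plus terms of smaller order, where \<open>\<eta>\<close> bounds the increments of \<open>f\<close> along edges and \<open>A\<close>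
  bounds \<open>green\<close> (\<open>time_mean_square_eigenfunction\<close>). For a non-constant character of the torus of side
  \<open>n\<close> one has \<open>\<lambda> = O(1/n\<^sup>2)\<close> and \<open>\<eta> = O(1/n)\<close>, and the Green function of a graph is bounded by twice
  its diameter times its degree (\<open>abs_green_le\<close>), whence \<open>A = O(n)\<close> in every dimension. So the integral
  of a character tends to zero in mean square.

  Trigonometric polynomials approximate every bounded continuous function on the cube in mean
  (\<open>trig_poly_mean_approx\<close>). Since the mean masses are uniform, the approximation error is controlled as
  well, so integrals of bounded continuous functions converge in probability to their integrals over
  the unit cube (\<open>deviation_from_integral\<close>). As the limit is deterministic, this is enough for convergence
  in distribution in the weak topology (\<open>weak_convergence_to_constant\<close>).
\<close>

section \<open>Poisson averages\<close>

definition poisson_mean :: "real \<Rightarrow> (nat \<Rightarrow> real) \<Rightarrow> real" where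
  "poisson_mean t a = measure_pmf.expectation (poisson_pmf t) a"

lemma integrable_pmf_bounded:
  fixes a :: "nat \<Rightarrow> real"
  assumes "\<And>k. \<bar>a k\<bar> \<le> C"
  shows "integrable (measure_pmf p) a"
  using assms by (intro measure_pmf.integrable_const_bound[where B=C]) auto

lemma poisson_mean_diff:
  assumes "\<And>k. \<bar>a k\<bar> \<le> C" "\<And>k. \<bar>b k\<bar> \<le> C'"
  shows "poisson_mean t (\<lambda>k. a k - b k) = poisson_mean t a - poisson_mean t b"
  unfolding poisson_mean_def
  by (intro Bochner_Integration.integral_diff integrable_pmf_bounded[where C=C] integrable_pmf_bounded[where C=C'] assms)

lemma poisson_mean_add:
  assumes "\<And>k. \<bar>a k\<bar> \<le> C" "\<And>k. \<bar>b k\<bar> \<le> C'"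
  shows "poisson_mean t (\<lambda>k. a k + b k) = poisson_mean t a + poisson_mean t b"
  unfolding poisson_mean_def
  by (intro Bochner_Integration.integral_add integrable_pmf_bounded[where C=C] integrable_pmf_bounded[where C=C'] assms)

lemma poisson_mean_scale: "poisson_mean t (\<lambda>k. c * a k) = c * poisson_mean t a"
  unfolding poisson_mean_def by simp

lemma poisson_mean_const [simp]: "poisson_mean t (\<lambda>k. c) = c"
  unfolding poisson_mean_def by simp

lemma poisson_mean_mono:
  assumes "\<And>k. \<bar>a k\<bar> \<le> C" "\<And>k. \<bar>b k\<bar> \<le> C'" "\<And>k. a k \<le> b k"
  shows "poisson_mean t a \<le> poisson_mean t b"
  unfolding poisson_mean_def
  by (intro integral_mono integrable_pmf_bounded[where C=C] integrable_pmf_bounded[where C=C'] assms)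

lemma poisson_mean_sum:
  assumes "\<And>i k. i \<in> I \<Longrightarrow> \<bar>a i k\<bar> \<le> C i"
  shows "poisson_mean t (\<lambda>k. \<Sum>i\<in>I. a i k) = (\<Sum>i\<in>I. poisson_mean t (a i))"
  unfolding poisson_mean_def
  by (intro Bochner_Integration.integral_sum integrable_pmf_bounded) (use assms in auto)

lemma pmf_poisson_Suc:
  assumes "0 < t"
  shows "pmf (poisson_pmf t) (Suc k) * real (Suc k) = t * pmf (poisson_pmf t) k"
proof -
  have "fact (Suc k) = real (Suc k) * (fact k :: real)" by simp
  then show ?thesis using assms by (simp del: fact_Suc of_nat_Suc)
qed

lemma poisson_factorial_moments:
  assumes t: "0 < t"
  shows "has_bochner_integral (measure_pmf (poisson_pmf t)) real t"
    and "has_bochner_integral (measure_pmf (poisson_pmf t)) (\<lambda>k. real k * (real k - 1)) (t\<^sup>2)"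
proof -
  have exp_sums: "(\<lambda>k. t ^ k / fact k * exp (-t) * c) sums c" for c
  proof -
    have "(\<lambda>k. (exp (-t) * c) * (t ^ k /\<^sub>R fact k)) sums ((exp (-t) * c) * exp t)"
      by (intro sums_mult exp_converges)
    then show ?thesis by (simp add: field_simps exp_minus scaleR_conv_of_real)
  qed
  have gen: "has_bochner_integral (measure_pmf (poisson_pmf t)) f s"
    if f: "\<And>k. 0 \<le> f k" and s: "(\<lambda>k. pmf (poisson_pmf t) k * f k) sums s" for f :: "nat \<Rightarrow> real" and s
  proof -
    have "has_bochner_integral (count_space UNIV) (\<lambda>k. pmf (poisson_pmf t) k * f k) s"
      using s f by (subst has_bochner_integral_iff)
        (auto simp: integrable_count_space_nat_iff integral_count_space_nat sums_iff abs_mult pmf_nonneg)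
    then show ?thesis
      by (simp add: measure_pmf_eq_density[of "poisson_pmf t"] has_bochner_integral_density pmf_nonneg)
  qed
  show "has_bochner_integral (measure_pmf (poisson_pmf t)) real t"
  proof (rule gen)
    have "(\<lambda>k. pmf (poisson_pmf t) (Suc k) * real (Suc k)) sums t"
      unfolding pmf_poisson_Suc[OF t] using exp_sums[of t] t by (simp add: mult_ac)
    then show "(\<lambda>k. pmf (poisson_pmf t) k * real k) sums t"
      by (subst (asm) sums_Suc_iff) simp
  qed simp
  show "has_bochner_integral (measure_pmf (poisson_pmf t)) (\<lambda>k. real k * (real k - 1)) (t\<^sup>2)"
  proof (rule gen)
    show "0 \<le> real k * (real k - 1)" for k by (cases k) auto
    have "(\<lambda>k. pmf (poisson_pmf t) (Suc (Suc k)) * (real (Suc (Suc k)) * (real (Suc (Suc k)) - 1))) sums t\<^sup>2"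
    proof -
      have "pmf (poisson_pmf t) (Suc (Suc k)) * (real (Suc (Suc k)) * (real (Suc (Suc k)) - 1))
          = t ^ k / fact k * exp (-t) * t\<^sup>2" for k
      proof -
        have "pmf (poisson_pmf t) (Suc (Suc k)) * (real (Suc (Suc k)) * (real (Suc (Suc k)) - 1))
          = (pmf (poisson_pmf t) (Suc (Suc k)) * real (Suc (Suc k))) * real (Suc k)"
          by simp
        also have "\<dots> = t * (pmf (poisson_pmf t) (Suc k) * real (Suc k))"
          unfolding pmf_poisson_Suc[OF t, of "Suc k"] by (simp only: mult.assoc)
        also have "\<dots> = t ^ k / fact k * exp (-t) * t\<^sup>2"
          unfolding pmf_poisson_Suc[OF t] using t by (simp add: power2_eq_square)
        finally show ?thesis .
      qed
      then show ?thesis using exp_sums[of "t^2"] by simp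
    qed
    then have "(\<lambda>k. pmf (poisson_pmf t) (Suc k) * (real (Suc k) * (real (Suc k) - 1))) sums t\<^sup>2"
      by (subst (asm) sums_Suc_iff) simp
    then show "(\<lambda>k. pmf (poisson_pmf t) k * (real k * (real k - 1))) sums t\<^sup>2"
      by (subst (asm) sums_Suc_iff) simp
  qed
qed

text \<open>
  The Poisson law with mean \<open>t\<close> has variance \<open>t\<close>, so \<open>k / t - 1\<close> is of order \<open>1 / sqrt t\<close>.
\<close>

lemma poisson_relative_deviation:
  assumes t: "0 < t"
  shows "integrable (measure_pmf (poisson_pmf t)) (\<lambda>k. \<bar>real k / t - 1\<bar>)"
    and "measure_pmf.expectation (poisson_pmf t) (\<lambda>k. \<bar>real k / t - 1\<bar>) \<le> 1 / sqrt t"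
proof -
  note m = poisson_factorial_moments[OF t]
  have i1: "integrable (measure_pmf (poisson_pmf t)) real"
    and e1: "measure_pmf.expectation (poisson_pmf t) real = t"
    using m(1) by (auto simp: has_bochner_integral_iff)
  have i2: "integrable (measure_pmf (poisson_pmf t)) (\<lambda>k. real k * (real k - 1))"
    and e2: "measure_pmf.expectation (poisson_pmf t) (\<lambda>k. real k * (real k - 1)) = t\<^sup>2"
    using m(2) by (auto simp: has_bochner_integral_iff)
  show int: "integrable (measure_pmf (poisson_pmf t)) (\<lambda>k. \<bar>real k / t - 1\<bar>)"
    using i1 by simp
  let ?g = "\<lambda>k. (1 / t\<^sup>2) * (real k * (real k - 1)) + (1 / t\<^sup>2 - 2 / t) * real k + 1"
  have sq: "(real k / t - 1)\<^sup>2 = ?g k" for k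
    using t by (simp add: power2_eq_square field_simps)
  have ig: "integrable (measure_pmf (poisson_pmf t)) ?g"
    using i1 i2 by (intro Bochner_Integration.integrable_add Bochner_Integration.integrable_mult_right) auto
  have "measure_pmf.expectation (poisson_pmf t) ?g = (1 / t\<^sup>2) * t\<^sup>2 + (1 / t\<^sup>2 - 2 / t) * t + 1"
    using i1 i2 e1 e2 by simp
  also have "\<dots> = 1 / t" using t by (simp add: power2_eq_square field_simps)
  finally have eg: "measure_pmf.expectation (poisson_pmf t) ?g = 1 / t" .
  \<comment> \<open>\<open>2 \<bar>y\<bar> \<le> sqrt t \<cdot> y\<^sup>2 + 1 / sqrt t\<close>; the weights balance the two terms when \<open>y\<^sup>2\<close> is about \<open>1 / t\<close>.\<close>
  have "\<bar>real k / t - 1\<bar> \<le> (sqrt t / 2) * ?g k + 1 / (2 * sqrt t)" for k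
  proof -
    define y where "y = \<bar>real k / t - 1\<bar>"
    have "0 \<le> (sqrt t * y - 1)\<^sup>2" by simp
    then have "2 * (sqrt t * y) \<le> t * y\<^sup>2 + 1"
      using t by (simp add: power2_diff power_mult_distrib)
    moreover have "((sqrt t / 2) * y\<^sup>2 + 1 / (2 * sqrt t)) * (2 * sqrt t) = (sqrt t * sqrt t) * y\<^sup>2 + 1"
      using t by (simp add: field_simps del: real_sqrt_mult_self)
    ultimately have "y * (2 * sqrt t) \<le> ((sqrt t / 2) * y\<^sup>2 + 1 / (2 * sqrt t)) * (2 * sqrt t)"
      using t by (simp add: mult_ac)
    then have "y \<le> (sqrt t / 2) * y\<^sup>2 + 1 / (2 * sqrt t)"
      by (rule mult_right_le_imp_le) (use t in simp)
    then show ?thesis unfolding y_def power2_abs sq .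
  qed
  then have "measure_pmf.expectation (poisson_pmf t) (\<lambda>k. \<bar>real k / t - 1\<bar>)
      \<le> measure_pmf.expectation (poisson_pmf t) (\<lambda>k. (sqrt t / 2) * ?g k + 1 / (2 * sqrt t))"
    using ig by (intro integral_mono int) auto
  also have "\<dots> = (sqrt t / 2) * (1 / t) + 1 / (2 * sqrt t)"
    using ig eg by simp
  also have "\<dots> = 1 / sqrt t" 
    using t real_sqrt_mult_self[of t] by (simp add: field_simps)
  finally show "measure_pmf.expectation (poisson_pmf t) (\<lambda>k. \<bar>real k / t - 1\<bar>) \<le> 1 / sqrt t" .
qed

lemma pmf_nat_expectation:
  fixes f :: "nat \<Rightarrow> real"
  assumes "integrable (measure_pmf p) f"
  shows "measure_pmf.expectation p f = (\<Sum>k. pmf p k * f k)"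
    and "summable (\<lambda>k. pmf p k * f k)"
proof -
  have i: "integrable (count_space UNIV) (\<lambda>k. pmf p k * f k)"
    using assms by (simp add: measure_pmf_eq_density[of p] integrable_density pmf_nonneg)
  show "measure_pmf.expectation p f = (\<Sum>k. pmf p k * f k)"
    using i by (simp add: measure_pmf_eq_density[of p] integral_density pmf_nonneg integral_count_space_nat)
  show "summable (\<lambda>k. pmf p k * f k)"
    using i by (auto simp: integrable_count_space_nat_iff intro: summable_norm_cancel)
qed

text \<open>
  Size biasing of the Poisson law: passing from \<open>k\<close> to \<open>k + 1\<close> in the argument costs the weight \<open>k / t\<close>.
\<close>

lemma poisson_mean_shift_eq:
  assumes t: "0 < t" and a: "\<And>k. \<bar>a k\<bar> \<le> C"
  shows "poisson_mean t (\<lambda>k. a (Suc k)) = measure_pmf.expectation (poisson_pmf t) (\<lambda>k. real k / t * a k)"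
proof -
  have int: "integrable (measure_pmf (poisson_pmf t)) (\<lambda>k. real k / t * a k)"
  proof (rule Bochner_Integration.integrable_bound)
    show "integrable (measure_pmf (poisson_pmf t)) (\<lambda>k. real k * (C / t))"
      using poisson_factorial_moments(1)[OF t] by (auto simp: has_bochner_integral_iff)
    have C: "0 \<le> C" using a[of 0] by linarith
    show "AE k in measure_pmf (poisson_pmf t). norm (real k / t * a k) \<le> norm (real k * (C / t))"
      using a t C by (intro AE_I2) (auto simp: abs_mult divide_simps intro!: mult_left_mono)
  qed simp
  have "(\<Sum>k. pmf (poisson_pmf t) k * (real k / t * a k))
      = (\<Sum>k. pmf (poisson_pmf t) (Suc k) * (real (Suc k) / t * a (Suc k)))"
    using suminf_split_head[OF pmf_nat_expectation(2)[OF int]] by simp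
  also have "\<dots> = (\<Sum>k. pmf (poisson_pmf t) k * a (Suc k))"
  proof (rule suminf_cong)
    fix k
    have "pmf (poisson_pmf t) (Suc k) * (real (Suc k) / t * a (Suc k))
       = (pmf (poisson_pmf t) (Suc k) * real (Suc k)) / t * a (Suc k)" by simp
    then show "pmf (poisson_pmf t) (Suc k) * (real (Suc k) / t * a (Suc k)) = pmf (poisson_pmf t) k * a (Suc k)"
      unfolding pmf_poisson_Suc[OF t] using t by simp
  qed
  finally show ?thesis
    unfolding poisson_mean_def using pmf_nat_expectation(1)[OF int] pmf_nat_expectation(1)[of _ "\<lambda>k. a (Suc k)"] integrable_pmf_bounded[of "\<lambda>k. a (Suc k)" C] a
    by simp
qed

text \<open>
  Sequences that Poisson averages do not see at large times.
\<close>

definition poisson_null :: "(nat \<Rightarrow> real) \<Rightarrow> bool" where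
  "poisson_null a \<longleftrightarrow> ((\<lambda>t. poisson_mean t a) \<longlongrightarrow> 0) at_top"

text \<open>
  By size biasing the Poisson average of the difference is the mean of \<open>(k / t - 1) \<cdot> a k\<close>, and
  \<open>k / t\<close> concentrates at 1.
\<close>

lemma poisson_null_shift:
  assumes a: "\<And>k. \<bar>a k\<bar> \<le> C"
  shows "poisson_null (\<lambda>k. a (Suc k) - a k)"
  unfolding poisson_null_def
proof (rule Lim_null_comparison)
  show "((\<lambda>t. C * (1 / sqrt t)) \<longlongrightarrow> 0) at_top"
    by (intro tendsto_mult_right_zero tendsto_divide_0[OF tendsto_const]
        filterlim_at_top_imp_at_infinity sqrt_at_top)
  have C: "0 \<le> C" using a[of 0] by linarith
  show "\<forall>\<^sub>F t in at_top. norm (poisson_mean t (\<lambda>k. a (Suc k) - a k)) \<le> C * (1 / sqrt t)"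
    using eventually_gt_at_top[of 0]
  proof eventually_elim
    case (elim t)
    note dev = poisson_relative_deviation[OF elim]
    have dev': "integrable (measure_pmf (poisson_pmf t)) (\<lambda>k. (real k / t - 1) * a k)"
      by (rule Bochner_Integration.integrable_bound[OF Bochner_Integration.integrable_mult_right[OF dev(1), of C]])
         (use a C in \<open>auto simp: abs_mult mult.commute[of C] intro!: mult_left_mono\<close>)
    have ia: "integrable (measure_pmf (poisson_pmf t)) a"
      using a by (rule integrable_pmf_bounded)
    have sh: "real k / t * a k = (real k / t - 1) * a k + a k" for k by (simp add: left_diff_distrib)
    have "poisson_mean t (\<lambda>k. a (Suc k) - a k) = poisson_mean t (\<lambda>k. a (Suc k)) - poisson_mean t a"
      by (rule poisson_mean_diff) (rule a)+
    also have "poisson_mean t (\<lambda>k. a (Suc k)) 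
        = measure_pmf.expectation (poisson_pmf t) (\<lambda>k. (real k / t - 1) * a k + a k)"
      unfolding sh[symmetric] by (rule poisson_mean_shift_eq[of t a C, OF elim a])
    also have "\<dots> = measure_pmf.expectation (poisson_pmf t) (\<lambda>k. (real k / t - 1) * a k) + poisson_mean t a"
      unfolding poisson_mean_def by (rule Bochner_Integration.integral_add[OF dev' ia])
    finally have "poisson_mean t (\<lambda>k. a (Suc k) - a k)
       = measure_pmf.expectation (poisson_pmf t) (\<lambda>k. (real k / t - 1) * a k)" by simp
    then have "norm (poisson_mean t (\<lambda>k. a (Suc k) - a k))
       \<le> measure_pmf.expectation (poisson_pmf t) (\<lambda>k. norm ((real k / t - 1) * a k))"
      by (metis integral_norm_bound)
    also have "\<dots> \<le> measure_pmf.expectation (poisson_pmf t) (\<lambda>k. C * \<bar>real k / t - 1\<bar>)"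
      by (intro integral_mono dev Bochner_Integration.integrable_mult_right Bochner_Integration.integrable_norm dev')
         (use a C in \<open>auto simp: abs_mult mult.commute[of C] intro!: mult_left_mono\<close>)
    also have "\<dots> \<le> C * (1 / sqrt t)"
      using mult_left_mono[OF dev(2) C] by simp
    finally show ?case .
  qed
qed

text \<open>
  The Poisson law with mean \<open>t\<close> leaves every finite set of indices as \<open>t\<close> grows.
\<close>

lemma poisson_null_of_tendsto_0:
  assumes a: "a \<longlonglongrightarrow> 0"
  shows "poisson_null a"
  unfolding poisson_null_def
proof (rule tendstoI)
  fix e :: real assume e: "0 < e"
  obtain C where C: "\<And>k. \<bar>a k\<bar> \<le> C"
    using convergent_imp_Bseq[OF convergentI[OF a]] by (auto simp: Bseq_def)
  have C0: "0 \<le> C" using C[of 0] by linarith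
  obtain K where K: "\<And>k. k \<ge> K \<Longrightarrow> \<bar>a k\<bar> < e / 2"
    using LIMSEQ_D[OF a, of "e/2"] e by auto
  have "((\<lambda>t. \<Sum>k<K. C * (t ^ k / fact k * exp (- t))) \<longlongrightarrow> (\<Sum>k<K. C * (0 / fact k))) at_top"
    by (intro tendsto_sum tendsto_mult_left)
       (use tendsto_divide[OF tendsto_power_div_exp_0 tendsto_const] in \<open>simp add: exp_minus field_simps\<close>)
  then have "\<forall>\<^sub>F t in at_top. (\<Sum>k<K. C * (t ^ k / fact k * exp (- t))) < e / 2"
    using e by (intro order_tendstoD(2)) auto
  then show "\<forall>\<^sub>F t in at_top. dist (poisson_mean t a) 0 < e"
    using eventually_gt_at_top[of 0]
  proof eventually_elim
    case (elim t)
    have "\<bar>a k\<bar> \<le> C * indicator {..<K} k + e / 2" for k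
      using C[of k] K[of k] e by (cases "k < K") (auto simp: indicator_def)
    then have "measure_pmf.expectation (poisson_pmf t) (\<lambda>k. \<bar>a k\<bar>)
       \<le> measure_pmf.expectation (poisson_pmf t) (\<lambda>k. C * indicator {..<K} k + e / 2)"
      by (intro integral_mono integrable_pmf_bounded[of _ C] integrable_pmf_bounded[of _ "C + e/2"])
         (use C C0 e in \<open>auto simp: indicator_def\<close>)
    also have "\<dots> = C * measure_pmf.prob (poisson_pmf t) {..<K} + e / 2"
    proof -
      have "integrable (measure_pmf (poisson_pmf t)) (\<lambda>k. indicator {..<K} k :: real)"
        by (rule integrable_pmf_bounded[of _ 1]) (auto simp: indicator_def)
      then show ?thesis by simp
    qed
    also have "measure_pmf.prob (poisson_pmf t) {..<K} = (\<Sum>k<K. pmf (poisson_pmf t) k)"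
      by (rule measure_measure_pmf_finite) simp
    also have "C * (\<Sum>k<K. pmf (poisson_pmf t) k) + e / 2 < e"
      using elim by (simp add: sum_distrib_left)
    finally have "measure_pmf.expectation (poisson_pmf t) (\<lambda>k. \<bar>a k\<bar>) < e" .
    then show ?case
      unfolding poisson_mean_def dist_real_def diff_0_right by (rule le_less_trans[OF integral_abs_bound])
  qed
qed

lemma poisson_null_cong:
  assumes a: "poisson_null a" and C: "\<And>k. \<bar>a k\<bar> \<le> C" and eq: "\<And>k. k \<ge> K \<Longrightarrow> b k = a k"
  shows "poisson_null b"
proof -
  have "poisson_null (\<lambda>k. b k - a k)"
    by (rule poisson_null_of_tendsto_0, rule tendsto_eventually)
       (use eq in \<open>auto simp: eventually_sequentially\<close>)
  moreover obtain C' where C': "\<And>k. \<bar>b k - a k\<bar> \<le> C'"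
  proof -
    have "\<bar>b k - a k\<bar> \<le> (\<Sum>j<K. \<bar>b j - a j\<bar>)" for k
      using member_le_sum[of k "{..<K}" "\<lambda>j. \<bar>b j - a j\<bar>"] eq[of k] by (cases "k < K") (auto simp: sum_nonneg)
    then show ?thesis using that by blast
  qed
  ultimately have "((\<lambda>t. poisson_mean t (\<lambda>k. b k - a k) + poisson_mean t a) \<longlongrightarrow> 0 + 0) at_top"
    using a unfolding poisson_null_def by (intro tendsto_add)
  moreover have "poisson_mean t (\<lambda>k. b k - a k) + poisson_mean t a = poisson_mean t b" for t
    using poisson_mean_add[of "\<lambda>k. b k - a k" C' a C t] C C' by simp
  ultimately show ?thesis unfolding poisson_null_def by simp
qed

section \<open>Averaging on a regular graph and its Green function\<close>

text \<open>
  The parameter \<open>L\<close> bounds the diameter; it enters the bound on the Green function.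
\<close>

locale regular_graph =
  fixes V :: "'v set" and E :: "'v \<Rightarrow> 'v \<Rightarrow> bool" and D L :: nat
  assumes finite_V: "finite V" and V_nonempty: "V \<noteq> {}"
    and E_sym: "E u v \<Longrightarrow> E v u" and E_in_V: "E u v \<Longrightarrow> u \<in> V" and E_irrefl: "\<not> E v v"
    and degree: "v \<in> V \<Longrightarrow> vertex_degree E v = D" and D_pos: "0 < D"
    and reachable: "u \<in> V \<Longrightarrow> v \<in> V \<Longrightarrow> \<exists>k\<le>L. (E ^^ k) u v"
begin

definition avg :: "('v \<Rightarrow> real) \<Rightarrow> 'v \<Rightarrow> real" where
  "avg g v = (\<Sum>u | E v u. g u) / real D"

abbreviation N :: real where "N \<equiv> real (card V)"

lemma N_pos: "0 < N"
  using finite_V V_nonempty by (simp add: card_gt_0_iff)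

lemma E_in_V': "E u v \<Longrightarrow> v \<in> V"
  using E_sym E_in_V by blast

lemma finite_nbrs: "finite {u. E v u}"
  by (rule finite_subset[OF _ finite_V]) (auto dest: E_in_V')

lemma card_nbrs: "v \<in> V \<Longrightarrow> card {u. E v u} = D"
  using degree by (simp add: vertex_degree_def)

lemma exists_nbr: "v \<in> V \<Longrightarrow> \<exists>u. E v u"
  using card_nbrs[of v] D_pos by (cases "{u. E v u} = {}") auto

lemma avg_cong: "(\<And>u. E v u \<Longrightarrow> f u = g u) \<Longrightarrow> avg f v = avg g v"
  unfolding avg_def by (auto intro!: arg_cong2[where f="(/)"] sum.cong)

lemma avg_const: "v \<in> V \<Longrightarrow> avg (\<lambda>_. c) v = c"
  unfolding avg_def using card_nbrs D_pos by simp

lemma avg_mono: "(\<And>u. E v u \<Longrightarrow> f u \<le> g u) \<Longrightarrow> avg f v \<le> avg g v"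
  unfolding avg_def by (auto intro!: divide_right_mono sum_mono)

lemma avg_add: "avg (\<lambda>u. f u + g u) v = avg f v + avg g v"
  unfolding avg_def by (simp add: sum.distrib add_divide_distrib)

lemma avg_diff: "avg (\<lambda>u. f u - g u) v = avg f v - avg g v"
  unfolding avg_def by (simp add: sum_subtractf diff_divide_distrib)

lemma avg_scale: "avg (\<lambda>u. c * f u) v = c * avg f v"
  unfolding avg_def by (simp add: sum_distrib_left)

lemma avg_scale_right: "avg (\<lambda>u. f u * c) v = avg f v * c"
  unfolding avg_def by (simp add: sum_distrib_right)

lemma avg_sum: "avg (\<lambda>u. \<Sum>i\<in>I. f i u) v = (\<Sum>i\<in>I. avg (f i) v)"
  unfolding avg_def by (subst sum.swap) (simp add: sum_divide_distrib)

lemma avg_le: "v \<in> V \<Longrightarrow> (\<And>u. E v u \<Longrightarrow> f u \<le> c) \<Longrightarrow> avg f v \<le> c"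
  using avg_mono[of v f "\<lambda>_. c"] avg_const by simp

lemma avg_ge: "v \<in> V \<Longrightarrow> (\<And>u. E v u \<Longrightarrow> c \<le> f u) \<Longrightarrow> c \<le> avg f v"
  using avg_mono[of v "\<lambda>_. c" f] avg_const by simp

lemma abs_avg_le_avg: "\<bar>avg f v\<bar> \<le> avg (\<lambda>u. \<bar>f u\<bar>) v"
  unfolding avg_def by (simp add: abs_divide divide_right_mono sum_abs)

lemma abs_avg_le: "v \<in> V \<Longrightarrow> (\<And>u. E v u \<Longrightarrow> \<bar>f u\<bar> \<le> c) \<Longrightarrow> \<bar>avg f v\<bar> \<le> c"
  by (rule order_trans[OF abs_avg_le_avg avg_le])

lemma avg_altdef: "avg g v = (\<Sum>u\<in>V. if E v u then g u else 0) / real D"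
proof -
  have "{u. E v u} = V \<inter> {u. E v u}" by (auto dest: E_in_V')
  then have "(\<Sum>u | E v u. g u) = (\<Sum>u\<in>V. if E v u then g u else 0)"
    using sum.inter_restrict[OF finite_V, of g "{u. E v u}"] by simp
  then show ?thesis by (simp add: avg_def)
qed

lemma avg_selfadjoint: "(\<Sum>v\<in>V. f v * avg g v) = (\<Sum>v\<in>V. avg f v * g v)"
proof -
  have "(\<Sum>v\<in>V. f v * avg g v) = (\<Sum>v\<in>V. \<Sum>u\<in>V. (if E v u then f v * g u else 0) / real D)"
    unfolding avg_altdef sum_divide_distrib sum_distrib_left by (intro sum.cong refl) auto
  also have "\<dots> = (\<Sum>u\<in>V. \<Sum>v\<in>V. (if E v u then f v * g u else 0) / real D)"
    by (rule sum.swap)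
  also have "\<dots> = (\<Sum>u\<in>V. \<Sum>v\<in>V. (if E u v then f v * g u else 0) / real D)"
    by (intro sum.cong refl) (auto dest: E_sym)
  also have "\<dots> = (\<Sum>u\<in>V. avg f u * g u)"
    unfolding avg_altdef sum_divide_distrib sum_distrib_right by (intro sum.cong refl) auto
  finally show ?thesis .
qed

lemma sum_avg: "(\<Sum>v\<in>V. avg g v) = (\<Sum>v\<in>V. g v)"
proof -
  have "(\<Sum>v\<in>V. avg g v) = (\<Sum>v\<in>V. avg (\<lambda>_. 1) v * g v)"
    using avg_selfadjoint[of "\<lambda>_. 1" g] by simp
  then show ?thesis by (simp add: avg_const)
qed

text \<open>
  Summation by parts. The energy is summed over ordered pairs of neighbours, hence the factor 2.
\<close>

lemma dirichlet_form:
  "(\<Sum>v\<in>V. \<Sum>u\<in>V. if E v u then (f u - f v)\<^sup>2 else 0)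
    = 2 * real D * (\<Sum>v\<in>V. f v * (f v - avg f v))"
proof -
  have nb: "(\<Sum>u\<in>V. if E v u then g u else 0) = real D * avg g v" for g v
    using D_pos by (simp add: avg_altdef)
  have "(\<Sum>v\<in>V. \<Sum>u\<in>V. if E v u then (f u - f v)\<^sup>2 else 0)
      = (\<Sum>v\<in>V. real D * avg (\<lambda>u. (f u - f v)\<^sup>2) v)"
    by (simp only: nb)
  also have "\<dots> = (\<Sum>v\<in>V. real D * (avg (\<lambda>u. (f u)\<^sup>2) v - 2 * (f v * avg f v) + (f v)\<^sup>2))"
  proof (rule sum.cong[OF refl])
    fix v assume v: "v \<in> V"
    have "avg (\<lambda>u. (f u - f v)\<^sup>2) v = avg (\<lambda>u. ((f u)\<^sup>2 - (2 * f v) * f u) + (f v)\<^sup>2) v"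
      by (rule avg_cong) (simp add: power2_diff)
    also have "\<dots> = avg (\<lambda>u. (f u)\<^sup>2) v - 2 * (f v * avg f v) + (f v)\<^sup>2"
      by (simp only: avg_add avg_diff avg_scale avg_const[OF v] mult.assoc)
    finally show "real D * avg (\<lambda>u. (f u - f v)\<^sup>2) v
        = real D * (avg (\<lambda>u. (f u)\<^sup>2) v - 2 * (f v * avg f v) + (f v)\<^sup>2)" by simp
  qed
  also have "\<dots> = real D * ((\<Sum>v\<in>V. avg (\<lambda>u. (f u)\<^sup>2) v) - 2 * (\<Sum>v\<in>V. f v * avg f v) + (\<Sum>v\<in>V. (f v)\<^sup>2))"
    by (simp add: sum_distrib_left[symmetric] sum.distrib sum_subtractf)
  also have "\<dots> = 2 * real D * (\<Sum>v\<in>V. f v * (f v - avg f v))"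
    by (simp add: sum_avg right_diff_distrib sum_subtractf power2_eq_square algebra_simps)
  finally show ?thesis .
qed

text \<open>
  Cauchy--Schwarz along a shortest path from \<open>x\<close> to \<open>y\<close>: its edges are distinct, so the squares of
  the increments along it add up to at most the energy.
\<close>

lemma oscillation_le_energy:
  assumes x: "x \<in> V" and y: "y \<in> V"
  shows "(f y - f x)\<^sup>2 \<le> 2 * real L * real D * (\<Sum>v\<in>V. f v * (f v - avg f v))"
proof -
  define k where "k = (LEAST k. (E ^^ k) x y)"
  obtain k' where k': "k' \<le> L" "(E ^^ k') x y" using reachable[OF x y] by blast
  then have path: "(E ^^ k) x y" and min: "\<And>j. (E ^^ j) x y \<Longrightarrow> k \<le> j"
    unfolding k_def by (auto intro: LeastI Least_le)
  have kL: "k \<le> L" using min[OF k'(2)] k'(1) by simp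
  obtain p where p: "p 0 = x" "p k = y" "\<And>i. i < k \<Longrightarrow> E (p i) (p (Suc i))"
    using path unfolding relpowp_fun_conv by blast
  have inj: "inj_on p {..k}"
  proof -
    have "p i \<noteq> p j" if "i < j" "j \<le> k" for i j
    proof
      assume eq: "p i = p j"
      have "(E ^^ i) x (p i)"
        unfolding relpowp_fun_conv using p that by (intro exI[of _ p]) auto
      moreover have "(E ^^ (k - j)) (p j) y"
        unfolding relpowp_fun_conv using p that by (intro exI[of _ "\<lambda>l. p (j + l)"]) auto
      ultimately have "(E ^^ (i + (k - j))) x y"
        using eq by (auto simp: relpowp_add)
      then show False using min that by fastforce
    qed
    then show ?thesis by (intro linorder_inj_onI) auto
  qed
  have "f y - f x = (\<Sum>i<k. f (p (Suc i)) - f (p i))"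
    using sum_lessThan_telescope[of "\<lambda>i. f (p i)" k] by (simp add: p)
  then have "(f y - f x)\<^sup>2 \<le> (\<Sum>i<k. 1\<^sup>2) * (\<Sum>i<k. (f (p (Suc i)) - f (p i))\<^sup>2)"
    using Cauchy_Schwarz_ineq_sum[of "\<lambda>_. 1" "\<lambda>i. f (p (Suc i)) - f (p i)" "{..<k}"] by simp
  also have "\<dots> = real k * (\<Sum>i<k. (f (p (Suc i)) - f (p i))\<^sup>2)"
    by simp
  also have "(\<Sum>i<k. (f (p (Suc i)) - f (p i))\<^sup>2)
      = (\<Sum>(v,u)\<in>(\<lambda>i. (p i, p (Suc i))) ` {..<k}. if E v u then (f u - f v)\<^sup>2 else 0)"
    using p by (subst sum.reindex) (auto intro!: inj_onI inj_onD[OF inj])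
  also have "\<dots> \<le> (\<Sum>(v,u)\<in>V\<times>V. if E v u then (f u - f v)\<^sup>2 else 0)"
    using finite_V p by (intro sum_mono2) (auto dest: E_in_V E_in_V')
  also have "\<dots> = 2 * real D * (\<Sum>v\<in>V. f v * (f v - avg f v))"
    by (simp add: sum.cartesian_product[symmetric] dirichlet_form)
  finally have "(f y - f x)\<^sup>2 \<le> real k * (2 * real D * (\<Sum>v\<in>V. f v * (f v - avg f v)))"
    by (simp add: mult_left_mono)
  also have "\<dots> \<le> real L * (2 * real D * (\<Sum>v\<in>V. f v * (f v - avg f v)))"
  proof (rule mult_right_mono)
    show "0 \<le> 2 * real D * (\<Sum>v\<in>V. f v * (f v - avg f v))"
      unfolding dirichlet_form[symmetric] by (intro sum_nonneg) auto
  qed (use kL in simp)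
  finally show ?thesis by (simp add: algebra_simps)
qed

text \<open>
  The mean of \<open>min T K\<close>, where \<open>T\<close> is the time at which the walk started at \<open>v\<close> hits \<open>x\<close>.
\<close>

primrec truncated_hitting :: "'v \<Rightarrow> nat \<Rightarrow> 'v \<Rightarrow> real" where
  "truncated_hitting x 0 = (\<lambda>v. 0)"
| "truncated_hitting x (Suc K) = (\<lambda>v. if v = x then 0 else 1 + avg (truncated_hitting x K) v)"

lemma truncated_hitting_target [simp]: "truncated_hitting x K x = 0"
  by (cases K) auto

lemma truncated_hitting_nonneg: "v \<in> V \<Longrightarrow> 0 \<le> truncated_hitting x K v"
  by (induction K arbitrary: v) (auto intro!: add_nonneg_nonneg avg_ge dest: E_in_V')

lemma truncated_hitting_mono: "v \<in> V \<Longrightarrow> truncated_hitting x K v \<le> truncated_hitting x (Suc K) v"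
proof (induction K arbitrary: v)
  case 0
  then show ?case using truncated_hitting_nonneg[of v x "Suc 0"] by simp
next
  case (Suc K)
  then show ?case
    by (auto intro!: avg_mono dest: E_in_V' simp del: truncated_hitting.simps(2)
        simp: truncated_hitting.simps(2)[of x K] truncated_hitting.simps(2)[of x "Suc K"])
qed

text \<open>
  As the truncated means increase with \<open>K\<close>, the function \<open>f - avg f\<close> is at most 1 away from the target,
  so the energy of \<open>f\<close> is at most \<open>N\<close> times its maximum. The square of the maximum is itself bounded by
  the energy, which gives a bound that does not depend on \<open>K\<close>.
\<close>

lemma truncated_hitting_le:
  assumes x: "x \<in> V" and v: "v \<in> V"
  shows "truncated_hitting x K v \<le> 2 * real L * real D * N"
proof -
  let ?f = "truncated_hitting x K"
  obtain w where w: "w \<in> V" "\<And>u. u \<in> V \<Longrightarrow> ?f u \<le> ?f w"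
  proof -
    have "Max (?f ` V) \<in> ?f ` V" using finite_V V_nonempty by (intro Max_in) auto
    moreover have "\<And>u. u \<in> V \<Longrightarrow> ?f u \<le> Max (?f ` V)" using finite_V by simp
    ultimately show ?thesis using that by force
  qed
  have nn: "0 \<le> ?f w" using truncated_hitting_nonneg[OF w(1)] .
  have "(\<Sum>u\<in>V. ?f u * (?f u - avg ?f u)) \<le> (\<Sum>u\<in>V. ?f w)"
  proof (rule sum_mono)
    fix u assume u: "u \<in> V"
    show "?f u * (?f u - avg ?f u) \<le> ?f w"
    proof (cases "u = x")
      case True then show ?thesis using nn by simp
    next
      case False
      then have "?f u - avg ?f u \<le> 1" using truncated_hitting_mono[OF u, of x K] by simp
      then have "?f u * (?f u - avg ?f u) \<le> ?f u * 1"
        using truncated_hitting_nonneg[OF u] by (intro mult_left_mono)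
      then show ?thesis using w(2)[OF u] by simp
    qed
  qed
  then have "(?f w)\<^sup>2 \<le> 2 * real L * real D * (N * ?f w)"
    using oscillation_le_energy[OF x w(1), of ?f] 
      mult_left_mono[of "\<Sum>u\<in>V. ?f u * (?f u - avg ?f u)" "N * ?f w" "2 * real L * real D"]
    by simp
  then have "?f w * ?f w \<le> (2 * real L * real D * N) * ?f w" by (simp add: power2_eq_square mult.assoc)
  then have "?f w \<le> 2 * real L * real D * N"
    using nn by (cases "?f w = 0") (auto simp: mult_le_cancel_right)
  then show ?thesis using w(2)[OF v] by simp
qed

definition hitting :: "'v \<Rightarrow> 'v \<Rightarrow> real" where
  "hitting x v = lim (\<lambda>K. truncated_hitting x K v)"

lemma truncated_hitting_tendsto:
  assumes "x \<in> V" "v \<in> V"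
  shows "(\<lambda>K. truncated_hitting x K v) \<longlonglongrightarrow> hitting x v"
proof -
  have "incseq (\<lambda>K. truncated_hitting x K v)"
    by (rule incseq_SucI) (rule truncated_hitting_mono[OF assms(2)])
  then have "convergent (\<lambda>K. truncated_hitting x K v)"
    using truncated_hitting_le[OF assms] by (auto simp: convergent_def elim!: incseq_convergent)
  then show ?thesis unfolding hitting_def by (rule convergent_LIMSEQ_iff[THEN iffD1])
qed

lemma hitting_bounds:
  assumes "x \<in> V" "v \<in> V"
  shows "0 \<le> hitting x v" "hitting x v \<le> 2 * real L * real D * N"
  using truncated_hitting_tendsto[OF assms]
  by (auto intro: LIMSEQ_le_const LIMSEQ_le_const2 truncated_hitting_nonneg truncated_hitting_le assms)

lemma hitting_target: "hitting x x = 0"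
  unfolding hitting_def by simp

lemma hitting_step:
  assumes "x \<in> V" "v \<in> V" "v \<noteq> x"
  shows "hitting x v = 1 + avg (hitting x) v"
proof (rule LIMSEQ_unique)
  show "(\<lambda>K. truncated_hitting x (Suc K) v) \<longlonglongrightarrow> hitting x v"
    using truncated_hitting_tendsto[OF assms(1,2)] by (rule LIMSEQ_Suc)
  have "(\<lambda>K. 1 + avg (truncated_hitting x K) v) \<longlonglongrightarrow> 1 + avg (hitting x) v"
    unfolding avg_def using D_pos
    by (intro tendsto_intros truncated_hitting_tendsto assms) (auto dest: E_in_V')
  then show "(\<lambda>K. truncated_hitting x (Suc K) v) \<longlonglongrightarrow> 1 + avg (hitting x) v"
    using assms(3) by simp
qed

text \<open>
  Kac's formula: \<open>f - avg f\<close> sums to zero over the graph and equals 1 away from the target.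
\<close>

lemma hitting_return:
  assumes x: "x \<in> V"
  shows "avg (hitting x) x = N - 1"
proof -
  have "0 = (\<Sum>v\<in>V. hitting x v - avg (hitting x) v)"
    by (simp add: sum_subtractf sum_avg)
  also have "\<dots> = (hitting x x - avg (hitting x) x) + (\<Sum>v\<in>V - {x}. hitting x v - avg (hitting x) v)"
    using x finite_V by (simp add: sum.remove)
  also have "(\<Sum>v\<in>V - {x}. hitting x v - avg (hitting x) v) = (\<Sum>v\<in>V - {x}. 1)"
    using hitting_step[OF x] by (intro sum.cong) auto
  also have "\<dots> = N - 1"
    using x finite_V N_pos by (simp add: card_Diff_singleton of_nat_diff)
  finally show ?thesis by (simp add: hitting_target)
qed

text \<open>
  Hitting times centred to have mean zero, divided by \<open>- N\<close>. The equation \<open>avg_green\<close> says that this is the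
  kernel of the inverse of \<open>1 - avg\<close> on functions of mean zero.
\<close>

definition green :: "'v \<Rightarrow> 'v \<Rightarrow> real" where
  "green x v = ((\<Sum>w\<in>V. hitting x w) / N - hitting x v) / N"

lemma avg_green:
  assumes x: "x \<in> V" and v: "v \<in> V"
  shows "avg (green x) v = green x v + 1 / N - (if v = x then 1 else 0)"
proof -
  have "avg (green x) v = ((\<Sum>w\<in>V. hitting x w) / N - avg (hitting x) v) / N"
    unfolding green_def[abs_def] using avg_scale_right[of "\<lambda>u. (\<Sum>w\<in>V. hitting x w) / N - hitting x u" "1 / N" v]
    by (simp add: avg_diff avg_const[OF v])
  then show ?thesis
    using hitting_step[OF x v] hitting_return[OF x] hitting_target[of x] N_pos
    by (cases "v = x") (auto simp: green_def field_simps)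
qed

lemma sum_green: "(\<Sum>v\<in>V. green x v) = 0"
  using N_pos by (simp add: green_def sum_divide_distrib[symmetric] sum_subtractf)

text \<open>
  The number of vertices cancels between the bound for the hitting times and the normalisation.
\<close>

lemma abs_green_le:
  assumes "x \<in> V" "v \<in> V"
  shows "\<bar>green x v\<bar> \<le> 2 * real L * real D"
proof -
  have "(\<Sum>w\<in>V. hitting x w) \<le> (\<Sum>w\<in>V. 2 * real L * real D * N)"
    using hitting_bounds assms by (intro sum_mono) auto
  then have "(\<Sum>w\<in>V. hitting x w) / N \<le> 2 * real L * real D * N"
    using N_pos by (simp add: field_simps)
  moreover have "0 \<le> (\<Sum>w\<in>V. hitting x w) / N"
    using hitting_bounds assms by (intro divide_nonneg_nonneg sum_nonneg) auto
  ultimately have "\<bar>(\<Sum>w\<in>V. hitting x w) / N - hitting x v\<bar> \<le> 2 * real L * real D * N"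
    using hitting_bounds[OF assms] by linarith
  then show ?thesis using N_pos by (simp add: green_def abs_divide field_simps)
qed

lemma green_le_diagonal:
  assumes "x \<in> V" "v \<in> V"
  shows "green x v \<le> green x x"
  unfolding green_def hitting_target
  by (intro divide_right_mono) (use hitting_bounds(1)[OF assms] N_pos in auto)

text \<open>
  Self-adjointness of \<open>avg\<close> moves the operator onto the Green function. In particular a function that
  is nearly harmonic is nearly constant.
\<close>

lemma green_representation:
  assumes y: "y \<in> V"
  shows "f y - (\<Sum>v\<in>V. f v) / N = (\<Sum>v\<in>V. (f v - avg f v) * green y v)"
proof -
  have "(\<Sum>v\<in>V. (f v - avg f v) * green y v) = (\<Sum>v\<in>V. f v * (green y v - avg (green y) v))"
    by (simp add: left_diff_distrib right_diff_distrib sum_subtractf avg_selfadjoint)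
  also have "\<dots> = (\<Sum>v\<in>V. f v * (if v = y then 1 else 0) - f v / N)"
    by (rule sum.cong[OF refl]) (simp add: avg_green[OF y] algebra_simps)
  also have "\<dots> = f y - (\<Sum>v\<in>V. f v) / N"
  proof -
    have "(\<Sum>v\<in>V. f v * (if v = y then 1 else 0)) = (\<Sum>v\<in>V. if v = y then f v else 0)"
      by (intro sum.cong) auto
    then show ?thesis using y finite_V by (simp add: sum_subtractf sum_divide_distrib)
  qed
  finally show ?thesis by simp
qed

lemma green_sym:
  assumes x: "x \<in> V" and y: "y \<in> V"
  shows "green x y = green y x"
proof -
  have "green x y = (\<Sum>v\<in>V. (green x v - avg (green x) v) * green y v)"
    using green_representation[OF y, of "green x"] by (simp add: sum_green)
  also have "\<dots> = (\<Sum>v\<in>V. green y v * (if v = x then 1 else 0) - green y v / N)"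
    by (rule sum.cong[OF refl]) (simp add: avg_green[OF x] algebra_simps)
  also have "\<dots> = green y x"
  proof -
    have "(\<Sum>v\<in>V. green y v * (if v = x then 1 else 0)) = (\<Sum>v\<in>V. if v = x then green y v else 0)"
      by (intro sum.cong) auto
    then show ?thesis
      using x finite_V by (simp add: sum_subtractf sum_divide_distrib[symmetric] sum_green)
  qed
  finally show ?thesis .
qed

end

section \<open>Functionals of the path of a random walk\<close>

text \<open>
  Functionals of a path are functions on all of \<open>nat \<Rightarrow> 'v\<close>, so that they can be applied to random
  trajectories, to finite paths and to reversed paths alike.
\<close>

definition adapted :: "nat \<Rightarrow> ((nat \<Rightarrow> 'v) \<Rightarrow> 'a) \<Rightarrow> bool" where
  "adapted k F \<longleftrightarrow> (\<forall>x y. (\<forall>i\<le>k. x i = y i) \<longrightarrow> F x = F y)"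

lemma adaptedD: "adapted k F \<Longrightarrow> (\<And>i. i \<le> k \<Longrightarrow> x i = y i) \<Longrightarrow> F x = F y"
  by (auto simp: adapted_def)

lemma adapted_restrict: "adapted k F \<Longrightarrow> F (restrict x {..k}) = F x"
  by (erule adaptedD) auto

lemma adapted_mono: "adapted k F \<Longrightarrow> k \<le> l \<Longrightarrow> adapted l F"
  by (auto simp: adapted_def)

lemma adapted_mass_after: "adapted k (\<lambda>x. mass_after E m0 x k)"
proof (induction k)
  case (Suc k)
  show ?case unfolding adapted_def
  proof (intro allI impI)
    fix x y :: "nat \<Rightarrow> 'a" assume eq: "\<forall>i\<le>Suc k. x i = y i"
    then have "mass_after E m0 x k = mass_after E m0 y k"
      by (intro adaptedD[OF Suc]) auto
    then show "mass_after E m0 x (Suc k) = mass_after E m0 y (Suc k)"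
      using eq by simp
  qed
qed (simp add: adapted_def)

lemma adapted_comp: "adapted k F \<Longrightarrow> adapted k (\<lambda>x. h (F x))"
  unfolding adapted_def by (intro allI impI arg_cong[where f=h]) blast

lemma adapted_comp2: "adapted k F \<Longrightarrow> adapted k (\<lambda>x. h (F x) (x k))"
  unfolding adapted_def by (intro allI impI arg_cong2[where f=h]) auto

context regular_graph
begin

definition paths :: "nat \<Rightarrow> (nat \<Rightarrow> 'v) set" where "paths k = PiE {..k} (\<lambda>_. V)"

text \<open>
  The probability of a path given its starting point.
\<close>

definition weight :: "nat \<Rightarrow> (nat \<Rightarrow> 'v) \<Rightarrow> real" where
  "weight n p = (\<Prod>i<n. if E (p i) (p (Suc i)) then 1 / real D else 0)"

end

locale regular_walk = regular_graph V E D L + prob_space P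
  for V :: "'v set" and E D L and P :: "'w measure" +
  fixes X :: "nat \<Rightarrow> 'w \<Rightarrow> 'v"
  assumes position: "\<And>k. X k \<in> P \<rightarrow>\<^sub>M count_space V"
    and uniform_step: "\<And>k x.
      prob {\<omega> \<in> space P. \<forall>i\<le>Suc k. X i \<omega> = x i} =
      prob {\<omega> \<in> space P. \<forall>i\<le>k. X i \<omega> = x i} *
        (if E (x k) (x (Suc k)) then 1 / real (vertex_degree E (x k)) else 0)"
begin

abbreviation trajectory :: "'w \<Rightarrow> nat \<Rightarrow> 'v" where "trajectory \<omega> \<equiv> \<lambda>i. X i \<omega>"

definition follows :: "nat \<Rightarrow> (nat \<Rightarrow> 'v) \<Rightarrow> 'w set" where
  "follows k p = {\<omega> \<in> space P. \<forall>i\<le>k. X i \<omega> = p i}"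

lemma X_in_V: "\<omega> \<in> space P \<Longrightarrow> X k \<omega> \<in> V"
  using measurable_space[OF position] by simp

lemma X_eq_event [measurable]: "{\<omega> \<in> space P. X k \<omega> = v} \<in> events"
proof -
  have "{\<omega> \<in> space P. X k \<omega> = v} = X k -` ({v} \<inter> V) \<inter> space P"
    using X_in_V by auto
  then show ?thesis using measurable_sets[OF position, of "{v} \<inter> V"] by simp
qed

lemma follows_event [measurable]: "follows k p \<in> events"
  unfolding follows_def by measurable

lemma finite_paths: "finite (paths k)"
  unfolding paths_def using finite_V by (intro finite_PiE) auto

lemma path_restrict_in: "\<omega> \<in> space P \<Longrightarrow> restrict (trajectory \<omega>) {..k} \<in> paths k"
  unfolding paths_def using X_in_V by auto

text \<open>
  Only finitely many paths of length \<open>k\<close> exist, so a functional of such a path is a simple function.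
\<close>

lemma adapted_expand:
  fixes F :: "(nat \<Rightarrow> 'v) \<Rightarrow> real"
  assumes "adapted k F" "\<omega> \<in> space P"
  shows "F (trajectory \<omega>) = (\<Sum>p\<in>paths k. indicator (follows k p) \<omega> * F p)"
proof -
  have "indicator (follows k p) \<omega> * F p = (if p = restrict (trajectory \<omega>) {..k} then F p else 0)"
    if "p \<in> paths k" for p
  proof (cases "\<omega> \<in> follows k p")
    case True
    then have "p = restrict (trajectory \<omega>) {..k}"
      using that by (auto simp: follows_def paths_def fun_eq_iff PiE_def extensional_def)
    then show ?thesis using True by simp
  next
    case False
    then have "p \<noteq> restrict (trajectory \<omega>) {..k}"
      using assms(2) by (auto simp: follows_def)
    then show ?thesis using False by simp
  qed
  then have "(\<Sum>p\<in>paths k. indicator (follows k p) \<omega> * F p) = F (restrict (trajectory \<omega>) {..k})"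
    using finite_paths path_restrict_in[OF assms(2)] by (simp add: sum.delta cong: sum.cong)
  then show ?thesis using adapted_restrict[OF assms(1)] by simp
qed

lemma adapted_measurable:
  fixes F :: "(nat \<Rightarrow> 'v) \<Rightarrow> real"
  assumes "adapted k F"
  shows "(\<lambda>\<omega>. F (trajectory \<omega>)) \<in> borel_measurable P"
proof -
  have "(\<lambda>\<omega>. \<Sum>p\<in>paths k. indicator (follows k p) \<omega> * F p) \<in> borel_measurable P"
    by measurable
  then show ?thesis using adapted_expand[OF assms] by (simp cong: measurable_cong)
qed

lemma adapted_bounded:
  fixes F :: "(nat \<Rightarrow> 'v) \<Rightarrow> real"
  assumes "adapted k F"
  obtains C where "\<And>\<omega>. \<omega> \<in> space P \<Longrightarrow> \<bar>F (trajectory \<omega>)\<bar> \<le> C"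
proof
  fix \<omega> assume "\<omega> \<in> space P"
  then show "\<bar>F (trajectory \<omega>)\<bar> \<le> (\<Sum>p\<in>paths k. \<bar>F p\<bar>)"
    using member_le_sum[of "restrict (trajectory \<omega>) {..k}" "paths k" "\<lambda>p. \<bar>F p\<bar>"]
      path_restrict_in[of \<omega> k] finite_paths adapted_restrict[OF assms, of "trajectory \<omega>"] by auto
qed

lemma adapted_integrable:
  fixes F :: "(nat \<Rightarrow> 'v) \<Rightarrow> real"
  assumes "adapted k F"
  shows "integrable P (\<lambda>\<omega>. F (trajectory \<omega>))"
  by (rule adapted_bounded[OF assms])
     (rule integrable_const_bound[OF _ adapted_measurable[OF assms]], auto)

lemma adapted_expectation_on:
  fixes F :: "(nat \<Rightarrow> 'v) \<Rightarrow> real"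
  assumes F: "adapted k F" and A: "A \<in> events"
  shows "expectation (\<lambda>\<omega>. indicator A \<omega> * F (trajectory \<omega>)) = (\<Sum>p\<in>paths k. prob (A \<inter> follows k p) * F p)"
proof -
  have "expectation (\<lambda>\<omega>. indicator A \<omega> * F (trajectory \<omega>))
      = expectation (\<lambda>\<omega>. \<Sum>p\<in>paths k. indicator (A \<inter> follows k p) \<omega> * F p)"
    by (intro Bochner_Integration.integral_cong refl)
       (simp add: adapted_expand[OF F] indicator_inter_arith sum_distrib_left mult.assoc)
  also have "\<dots> = (\<Sum>p\<in>paths k. expectation (\<lambda>\<omega>. indicator (A \<inter> follows k p) \<omega> * F p))"
    using A by (intro Bochner_Integration.integral_sum integrable_mult_left) (auto simp: emeasure_eq_measure)
  also have "\<dots> = (\<Sum>p\<in>paths k. prob (A \<inter> follows k p) * F p)"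
    using A sets.sets_into_space[OF A] by (intro sum.cong refl) (simp add: Int_absorb2 inf.coboundedI1)
  finally show ?thesis .
qed

lemma adapted_expectation:
  fixes F :: "(nat \<Rightarrow> 'v) \<Rightarrow> real"
  assumes F: "adapted k F"
  shows "expectation (\<lambda>\<omega>. F (trajectory \<omega>)) = (\<Sum>p\<in>paths k. prob (follows k p) * F p)"
proof -
  have "expectation (\<lambda>\<omega>. F (trajectory \<omega>)) = expectation (\<lambda>\<omega>. indicator (space P) \<omega> * F (trajectory \<omega>))"
    by (intro Bochner_Integration.integral_cong) auto
  also have "\<dots> = (\<Sum>p\<in>paths k. prob (space P \<inter> follows k p) * F p)"
    by (rule adapted_expectation_on[OF F]) simp
  also have "\<dots> = (\<Sum>p\<in>paths k. prob (follows k p) * F p)"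
  proof -
    have "space P \<inter> follows k p = follows k p" for p by (auto simp: follows_def)
    then show ?thesis by simp
  qed
  finally show ?thesis .
qed

lemma follows_step:
  assumes p: "p \<in> paths k"
  shows "prob ({\<omega> \<in> space P. X (Suc k) \<omega> = y} \<inter> follows k p)
      = prob (follows k p) * (if E (p k) y then 1 / real D else 0)"
proof -
  have "{\<omega> \<in> space P. X (Suc k) \<omega> = y} \<inter> follows k p
      = {\<omega> \<in> space P. \<forall>i\<le>Suc k. X i \<omega> = (p(Suc k := y)) i}"
    by (auto simp: follows_def le_Suc_eq)
  moreover have "{\<omega> \<in> space P. \<forall>i\<le>k. X i \<omega> = (p(Suc k := y)) i} = follows k p"
    by (auto simp: follows_def)
  moreover have "p k \<in> V" using p by (auto simp: paths_def)
  ultimately show ?thesis using uniform_step[of k "p(Suc k := y)"] by (simp add: degree)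
qed

text \<open>
  The Markov property in integrated form: given the path up to \<open>k\<close>, the next position is uniform among
  the neighbours of the present one.
\<close>

lemma markov:
  fixes G :: "(nat \<Rightarrow> 'v) \<Rightarrow> 'v \<Rightarrow> real"
  assumes G: "\<And>v. adapted k (\<lambda>x. G x v)"
  shows "expectation (\<lambda>\<omega>. G (trajectory \<omega>) (X (Suc k) \<omega>)) = expectation (\<lambda>\<omega>. avg (G (trajectory \<omega>)) (X k \<omega>))"
proof -
  have aG: "adapted k (\<lambda>x. avg (G x) (x k))"
    unfolding adapted_def
  proof (intro allI impI)
    fix x y :: "nat \<Rightarrow> 'v" assume eq: "\<forall>i\<le>k. x i = y i"
    then have "G x = G y" using adaptedD[OF G, of x y] by auto
    then show "avg (G x) (x k) = avg (G y) (y k)" using eq by simp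
  qed
  have "expectation (\<lambda>\<omega>. G (trajectory \<omega>) (X (Suc k) \<omega>))
      = expectation (\<lambda>\<omega>. \<Sum>y\<in>V. indicator {\<omega> \<in> space P. X (Suc k) \<omega> = y} \<omega> * G (trajectory \<omega>) y)"
  proof (intro Bochner_Integration.integral_cong refl)
    fix \<omega> assume \<omega>: "\<omega> \<in> space P"
    have "(\<Sum>y\<in>V. indicator {\<omega> \<in> space P. X (Suc k) \<omega> = y} \<omega> * G (trajectory \<omega>) y)
        = (\<Sum>y\<in>V. if X (Suc k) \<omega> = y then G (trajectory \<omega>) y else 0)"
      using \<omega> by (intro sum.cong) auto
    then show "G (trajectory \<omega>) (X (Suc k) \<omega>)
        = (\<Sum>y\<in>V. indicator {\<omega> \<in> space P. X (Suc k) \<omega> = y} \<omega> * G (trajectory \<omega>) y)"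
      using finite_V X_in_V[OF \<omega>] by simp
  qed
  also have "\<dots> = (\<Sum>y\<in>V. expectation (\<lambda>\<omega>. indicator {\<omega> \<in> space P. X (Suc k) \<omega> = y} \<omega> * G (trajectory \<omega>) y))"
    using integrable_real_mult_indicator[OF X_eq_event adapted_integrable[OF G]]
    by (intro Bochner_Integration.integral_sum) (simp add: mult.commute)
  also have "\<dots> = (\<Sum>y\<in>V. \<Sum>p\<in>paths k. prob (follows k p) * (if E (p k) y then 1 / real D else 0) * G p y)"
    by (intro sum.cong refl) (simp add: adapted_expectation_on[OF G] follows_step)
  also have "\<dots> = (\<Sum>p\<in>paths k. \<Sum>y\<in>V. prob (follows k p) * (if E (p k) y then 1 / real D else 0) * G p y)"
    by (rule sum.swap)
  also have "\<dots> = (\<Sum>p\<in>paths k. prob (follows k p) * avg (G p) (p k))"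
    unfolding avg_altdef sum_divide_distrib sum_distrib_left by (intro sum.cong refl) auto
  also have "\<dots> = expectation (\<lambda>\<omega>. avg (G (trajectory \<omega>)) (X k \<omega>))"
    using adapted_expectation[OF aG] by simp
  finally show ?thesis .
qed

lemma prob_follows:
  assumes "\<And>i. i \<le> n \<Longrightarrow> p i \<in> V"
  shows "prob (follows n p) = prob {\<omega> \<in> space P. X 0 \<omega> = p 0} * weight n p"
  using assms
proof (induction n)
  case 0
  then show ?case by (simp add: follows_def weight_def)
next
  case (Suc n)
  then have "p n \<in> V" by auto
  then show ?case
    using uniform_step[of n p] Suc degree by (simp add: follows_def[symmetric] weight_def)
qed

end

section \<open>Redistribution of masses\<close>

context regular_graph
begin

text \<open>
  The dual of a redistribution at \<open>v\<close>, see \<open>sum_spread_update\<close>.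
\<close>

definition update :: "'v \<Rightarrow> ('v \<Rightarrow> real) \<Rightarrow> 'v \<Rightarrow> real" where
  "update v f = f(v := avg f v)"

lemma sum_spread:
  assumes v: "v \<in> V"
  shows "(\<Sum>x\<in>V. f x * spread E v m x) = (\<Sum>x\<in>V. f x * m x) + m v * (avg f v - f v)"
proof -
  have "f x * spread E v m x = f x * m x + (if E v x then f x else 0) * (m v / real D)
      - (if x = v then f v * m v else 0)" for x
    using degree[OF v] E_irrefl by (auto simp: spread_def algebra_simps)
  then have "(\<Sum>x\<in>V. f x * spread E v m x)
      = (\<Sum>x\<in>V. f x * m x) + (\<Sum>x\<in>V. if E v x then f x else 0) * (m v / real D) - f v * m v"
    using v finite_V by (simp only: sum.distrib sum_subtractf sum_distrib_right[symmetric]) simp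
  then show ?thesis by (simp add: avg_altdef algebra_simps)
qed

lemma sum_spread_update:
  assumes v: "v \<in> V"
  shows "(\<Sum>x\<in>V. f x * spread E v m x) = (\<Sum>x\<in>V. update v f x * m x)"
proof -
  have "update v f x * m x = f x * m x + (if x = v then m v * (avg f v - f v) else 0)" for x
    by (simp add: update_def algebra_simps)
  then have "(\<Sum>x\<in>V. update v f x * m x) = (\<Sum>x\<in>V. f x * m x) + m v * (avg f v - f v)"
    using v finite_V by (simp add: sum.distrib)
  then show ?thesis using sum_spread[OF v] by simp
qed

definition mass_dist :: "('v \<Rightarrow> real) \<Rightarrow> bool" where
  "mass_dist m \<longleftrightarrow> (\<forall>v\<in>V. 0 \<le> m v) \<and> (\<Sum>v\<in>V. m v) = 1"

lemma mass_dist_spread: "v \<in> V \<Longrightarrow> mass_dist m \<Longrightarrow> mass_dist (spread E v m)"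
  using sum_spread[of v "\<lambda>_. 1" m] avg_const[of v 1]
  by (auto simp: mass_dist_def spread_def)

lemma mass_dist_mass_after:
  "mass_dist m0 \<Longrightarrow> (\<And>i. x i \<in> V) \<Longrightarrow> mass_dist (mass_after E m0 x k)"
  by (induction k) (auto intro: mass_dist_spread)

lemma mass_dist_le_1: "mass_dist m \<Longrightarrow> v \<in> V \<Longrightarrow> m v \<le> 1"
  using member_le_sum[of v V m] finite_V by (auto simp: mass_dist_def)

lemma mass_dist_integral_le:
  assumes "mass_dist m" "\<And>v. v \<in> V \<Longrightarrow> f v \<le> c"
  shows "(\<Sum>v\<in>V. f v * m v) \<le> c"
proof -
  have "(\<Sum>v\<in>V. f v * m v) \<le> (\<Sum>v\<in>V. c * m v)"
    using assms by (intro sum_mono mult_right_mono) (auto simp: mass_dist_def)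
  then show ?thesis using assms by (simp add: sum_distrib_left[symmetric] mass_dist_def)
qed

lemma mass_dist_integral_abs_le:
  assumes "mass_dist m" "\<And>v. v \<in> V \<Longrightarrow> \<bar>f v\<bar> \<le> c"
  shows "\<bar>\<Sum>v\<in>V. f v * m v\<bar> \<le> c"
proof -
  have "f v \<le> c" "- f v \<le> c" if "v \<in> V" for v using assms(2)[OF that] by auto
  then show ?thesis
    using mass_dist_integral_le[OF assms(1), of f c] mass_dist_integral_le[OF assms(1), of "\<lambda>v. - f v" c]
    by (auto simp: sum_negf)
qed

end

section \<open>Number of jumps\<close>

context random_walk
begin

abbreviation jump_time :: "nat \<Rightarrow> 'w \<Rightarrow> real" where
  "jump_time k \<omega> \<equiv> \<Sum>i<k. \<tau> i \<omega>"

lemma holding_measurable [measurable]: "\<tau> i \<in> borel_measurable P"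
  using holding_exponential[of i] by (auto dest: distributed_measurable)

lemma jump_count_measurable [measurable]: "jump_count \<tau> t \<in> P \<rightarrow>\<^sub>M count_space UNIV"
  unfolding jump_count_def by measurable

lemma AE_holding_pos: "AE \<omega> in P. \<forall>i. 0 < \<tau> i \<omega>"
proof (subst AE_all_countable, intro allI)
  fix i
  have "\<P>(\<omega> in P. \<tau> i \<omega> \<le> 0) = 0"
    using erlang_distributed_le[of "\<tau> i" 0 1 0] holding_exponential[of i]
    by (simp add: erlang_CDF_at0)
  then have "AE \<omega> in P. \<not> \<tau> i \<omega> \<le> 0"
    by (subst (asm) prob_eq_0) auto
  then show "AE \<omega> in P. 0 < \<tau> i \<omega>" by auto
qed

lemma prob_jump_time_le:
  assumes t: "0 < t"
  shows "\<P>(\<omega> in P. jump_time k \<omega> \<le> t) = 1 - (\<Sum>n<k. t ^ n * exp (- t) / fact n)"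
proof (cases k)
  case 0
  then show ?thesis using t by (simp add: prob_space)
next
  case (Suc k')
  have "distributed P lborel (\<lambda>x. \<Sum>i\<in>{..<k}. \<tau> i x) (erlang_density (card {..<k} - 1) 1)"
    by (rule exponential_distributed_sum)
       (use Suc holding_exponential indep_vars_subset[OF holding_indep] in auto)
  then have "distributed P lborel (jump_time k) (erlang_density k' 1)"
    using Suc by simp
  from erlang_distributed_le[OF this, of t] show ?thesis
    using t Suc by (simp add: erlang_CDF_def lessThan_Suc_atMost)
qed

text \<open>
  On the event that the \<open>k\<close>-th jump occurs by time \<open>t\<close> and the next one does not, there are exactly \<open>k\<close>
  jumps. Differences of Erlang distribution functions show that these events have the Poisson
  probabilities. They add up to one, so these lower bounds are attained; in particular the event of
  infinitely many jumps, on which \<open>jump_count\<close> is 0 by convention, contributes nothing.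
\<close>

lemma prob_jump_count:
  assumes t: "0 < t"
  shows "\<P>(\<omega> in P. jump_count \<tau> t \<omega> = k) = pmf (poisson_pmf t) k"
proof -
  interpret N: prob_space "distr P (count_space UNIV) (jump_count \<tau> t)"
    by (rule prob_space_distr) simp
  define q where "q k = \<P>(\<omega> in P. jump_count \<tau> t \<omega> = k)" for k
  have lower: "pmf (poisson_pmf t) k \<le> q k" for k
  proof -
    have "\<P>(\<omega> in P. jump_time k \<omega> \<le> t) \<le> \<P>(\<omega> in P. jump_time (Suc k) \<omega> \<le> t \<or> jump_count \<tau> t \<omega> = k)"
    proof (rule finite_measure_mono_AE)
      show "AE \<omega> in P. \<omega> \<in> {\<omega> \<in> space P. jump_time k \<omega> \<le> t} \<longrightarrow>
          \<omega> \<in> {\<omega> \<in> space P. jump_time (Suc k) \<omega> \<le> t \<or> jump_count \<tau> t \<omega> = k}"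
        using AE_holding_pos
      proof eventually_elim
        case (elim \<omega>)
        have mono: "jump_time i \<omega> \<le> jump_time j \<omega>" if "i \<le> j" for i j
          using that elim by (intro sum_mono2) (auto intro: less_imp_le)
        show ?case
        proof (intro impI)
          assume le: "\<omega> \<in> {\<omega> \<in> space P. jump_time k \<omega> \<le> t}"
          have "jump_count \<tau> t \<omega> = k" if gt: "t < jump_time (Suc k) \<omega>"
          proof -
            have "{j. 1 \<le> j \<and> jump_time j \<omega> \<le> t} = {1..k}"
            proof (intro equalityI subsetI)
              fix j assume j: "j \<in> {j. 1 \<le> j \<and> jump_time j \<omega> \<le> t}"
              have "j \<le> k" 
              proof (rule ccontr)
                assume "\<not> j \<le> k"
                then have "jump_time (Suc k) \<omega> \<le> jump_time j \<omega>" by (intro mono) simp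
                then show False using gt j by simp
              qed
              then show "j \<in> {1..k}" using j by simp
            next
              fix j assume "j \<in> {1..k}"
              then show "j \<in> {j. 1 \<le> j \<and> jump_time j \<omega> \<le> t}" using mono[of j k] le by auto
            qed
            then show ?thesis by (simp add: jump_count_def)
          qed
          then show "\<omega> \<in> {\<omega> \<in> space P. jump_time (Suc k) \<omega> \<le> t \<or> jump_count \<tau> t \<omega> = k}"
            using le by force
        qed
      qed
    qed measurable
    also have "\<dots> \<le> \<P>(\<omega> in P. jump_time (Suc k) \<omega> \<le> t) + q k"
    proof -
      have eq: "{\<omega> \<in> space P. jump_time (Suc k) \<omega> \<le> t \<or> jump_count \<tau> t \<omega> = k}
         = {\<omega> \<in> space P. jump_time (Suc k) \<omega> \<le> t} \<union> {\<omega> \<in> space P. jump_count \<tau> t \<omega> = k}" by auto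
      show ?thesis unfolding q_def eq by (intro measure_Un_le) measurable
    qed
    finally show ?thesis
      unfolding prob_jump_time_le[OF t] using t by (simp add: field_simps)
  qed
  have q_sums: "q sums 1"
  proof -
    have "(\<lambda>k. measure P {\<omega> \<in> space P. jump_count \<tau> t \<omega> = k}) sums measure P (\<Union>k. {\<omega> \<in> space P. jump_count \<tau> t \<omega> = k})"
      by (rule finite_measure_UNION) (auto simp: disjoint_family_on_def)
    moreover have "(\<Union>k. {\<omega> \<in> space P. jump_count \<tau> t \<omega> = k}) = space P" by auto
    ultimately show ?thesis unfolding q_def by (simp add: prob_space)
  qed
  have p_sums: "(\<lambda>k. pmf (poisson_pmf t) k) sums 1"
  proof -
    have "(\<lambda>k. exp (-t) * (t ^ k /\<^sub>R fact k)) sums (exp (-t) * exp t)"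
      by (intro sums_mult exp_converges)
    then show ?thesis using t by (simp add: field_simps exp_minus scaleR_conv_of_real)
  qed
  have "(\<lambda>k. q k - pmf (poisson_pmf t) k) sums (1 - 1)"
    by (rule sums_diff[OF q_sums p_sums])
  then have "\<forall>k. q k - pmf (poisson_pmf t) k = 0"
    using lower suminf_eq_zero_iff[of "\<lambda>k. q k - pmf (poisson_pmf t) k"] by (simp add: sums_iff)
  then show ?thesis unfolding q_def by simp
qed

lemma prob_path_jump_count:
  "prob ({\<omega> \<in> space P. jump_count \<tau> t \<omega> = j} \<inter> {\<omega> \<in> space P. \<forall>i\<le>k. X i \<omega> = p i})
    = prob {\<omega> \<in> space P. jump_count \<tau> t \<omega> = j} * prob {\<omega> \<in> space P. \<forall>i\<le>k. X i \<omega> = p i}"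
proof -
  let ?A = "{\<omega> \<in> space P. \<forall>i\<le>k. X i \<omega> = p i}" and ?B = "{\<omega> \<in> space P. jump_count \<tau> t \<omega> = j}"
  have "?A = (\<lambda>\<omega> k. X k \<omega>) -` (\<Inter>i\<in>{..k}. {x \<in> UNIV \<inter> space (Pi\<^sub>M UNIV (\<lambda>_. count_space V)). x i = p i}) \<inter> space P"
    using measurable_space[OF position] by (auto simp: space_PiM PiE_def)
  moreover have "(\<Inter>i\<in>{..k}. {x \<in> UNIV \<inter> space (Pi\<^sub>M UNIV (\<lambda>_. count_space V)). x i = p i}) \<in> sets (Pi\<^sub>M UNIV (\<lambda>_. count_space V))"
  proof (intro sets.finite_INT)
    fix i :: nat
    have "{x \<in> UNIV \<inter> space (Pi\<^sub>M UNIV (\<lambda>_. count_space V)). x i = p i} 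
       = (\<lambda>x. x i) -` ({p i} \<inter> V) \<inter> space (Pi\<^sub>M UNIV (\<lambda>_. count_space V))"
      by (auto simp: space_PiM)
    then show "{x \<in> UNIV \<inter> space (Pi\<^sub>M UNIV (\<lambda>_. count_space V)). x i = p i} \<in> sets (Pi\<^sub>M UNIV (\<lambda>_. count_space V))"
      using measurable_sets[OF measurable_component_singleton[of i UNIV "\<lambda>_. count_space V"], of "{p i} \<inter> V"] by simp
  qed auto
  ultimately have A: "?A \<in> sets (vimage_algebra (space P) (\<lambda>\<omega> k. X k \<omega>) (Pi\<^sub>M UNIV (\<lambda>_. count_space V)))"
    by (auto intro!: in_vimage_algebra)
  define c where "c = (\<lambda>y :: nat \<Rightarrow> real. card {k. 1 \<le> k \<and> (\<Sum>i<k. y i) \<le> t})"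
  have [measurable]: "c \<in> Pi\<^sub>M UNIV (\<lambda>_. borel) \<rightarrow>\<^sub>M count_space UNIV"
    unfolding c_def by measurable
  have "?B = (\<lambda>\<omega> k. \<tau> k \<omega>) -` {y \<in> space (Pi\<^sub>M UNIV (\<lambda>_. borel)). c y = j} \<inter> space P"
    by (auto simp: space_PiM c_def jump_count_def)
  then have B: "?B \<in> sets (vimage_algebra (space P) (\<lambda>\<omega> k. \<tau> k \<omega>) (Pi\<^sub>M UNIV (\<lambda>_. borel)))"
    by (simp only:) (intro in_vimage_algebra, measurable)
  show ?thesis
    using indep_setD[OF positions_indep_holding A B] by (simp add: Int_commute mult.commute)
qed

end

context regular_graph
begin

section \<open>Oscillation and its contraction\<close>

definition osc :: "('v \<Rightarrow> real) \<Rightarrow> real" where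
  "osc f = Max (f ` V) - Min (f ` V)"

lemma osc_le:
  assumes "\<And>v. v \<in> V \<Longrightarrow> a \<le> f v" "\<And>v. v \<in> V \<Longrightarrow> f v \<le> b"
  shows "osc f \<le> b - a"
proof -
  have "Max (f ` V) \<le> b" "a \<le> Min (f ` V)"
    using assms finite_V V_nonempty by auto
  then show ?thesis by (simp add: osc_def)
qed

lemma osc_bounds:
  obtains lo hi where "\<And>v. v \<in> V \<Longrightarrow> lo \<le> f v" "\<And>v. v \<in> V \<Longrightarrow> f v \<le> hi" "hi - lo = osc f"
  using that[of "Min (f ` V)" "Max (f ` V)"] finite_V by (simp add: osc_def)

lemma osc_nonneg: "0 \<le> osc f"
proof -
  obtain v where "v \<in> V" using V_nonempty by blast
  moreover obtain lo hi where "\<And>v. v \<in> V \<Longrightarrow> lo \<le> f v" "\<And>v. v \<in> V \<Longrightarrow> f v \<le> hi" "hi - lo = osc f"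
    by (rule osc_bounds[of f]) blast
  ultimately show ?thesis by (smt (verit))
qed

lemma update_apply: "update w f v = (if v = w then avg f w else f v)"
  by (simp add: update_def)

lemma update_bounds:
  assumes "w \<in> V" "\<And>v. v \<in> V \<Longrightarrow> a \<le> f v" "\<And>v. v \<in> V \<Longrightarrow> f v \<le> b" "v \<in> V"
  shows "a \<le> update w f v" "update w f v \<le> b"
  using assms by (auto simp: update_def intro!: avg_ge avg_le dest: E_in_V')

lemma osc_update: "w \<in> V \<Longrightarrow> osc (update w f) \<le> osc f"
proof -
  assume w: "w \<in> V"
  obtain lo hi where b: "\<And>v. v \<in> V \<Longrightarrow> lo \<le> f v" "\<And>v. v \<in> V \<Longrightarrow> f v \<le> hi" "hi - lo = osc f"
    by (rule osc_bounds[of f]) blast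
  show ?thesis
    unfolding b(3)[symmetric] by (intro osc_le update_bounds[OF w b(1,2)])
qed

lemma mass_dist_integral_osc:
  assumes "mass_dist m" "mass_dist m'"
  shows "\<bar>(\<Sum>v\<in>V. f v * m v) - (\<Sum>v\<in>V. f v * m' v)\<bar> \<le> osc f"
proof -
  obtain lo hi where b: "\<And>v. v \<in> V \<Longrightarrow> lo \<le> f v" "\<And>v. v \<in> V \<Longrightarrow> f v \<le> hi" "hi - lo = osc f"
    by (rule osc_bounds[of f]) blast
  have "(\<Sum>v\<in>V. f v * p v) \<le> hi \<and> lo \<le> (\<Sum>v\<in>V. f v * p v)" if "mass_dist p" for p
    using mass_dist_integral_le[OF that, of f hi] mass_dist_integral_le[OF that, of "\<lambda>v. - f v" "- lo"] b
    by (simp add: sum_negf)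
  from this[OF assms(1)] this[OF assms(2)] show ?thesis using b(3) by linarith
qed

primrec walk_from :: "'v \<Rightarrow> 'v list \<Rightarrow> bool" where
  "walk_from c [] = True"
| "walk_from c (w # ws) = (E c w \<and> walk_from w ws)"

lemma walk_from_append: "walk_from c (ws @ vs) \<longleftrightarrow> walk_from c ws \<and> walk_from (last (c # ws)) vs"
  by (induction ws arbitrary: c) auto

lemma walk_from_in_V: "walk_from c ws \<Longrightarrow> c \<in> V \<Longrightarrow> set ws \<subseteq> V"
  by (induction ws arbitrary: c) (auto dest: E_in_V')

lemma walk_from_relpowp: "(E ^^ k) a b \<Longrightarrow> \<exists>ws. walk_from a ws \<and> last (a # ws) = b"
proof (induction k arbitrary: a)
  case 0
  then show ?case by (intro exI[of _ "[]"]) auto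
next
  case (Suc k)
  then obtain c where "E a c" "(E ^^ k) c b" by (metis relpowp_Suc_D2)
  with Suc.IH[of c] obtain ws where "walk_from c ws" "last (c # ws) = b" by blast
  then show ?case using \<open>E a c\<close> by (intro exI[of _ "c # ws"]) auto
qed

text \<open>
  One vertex after the other is appended by way of a path from the current end point.
\<close>

lemma covering_walk:
  assumes "c \<in> V"
  shows "\<exists>ws. walk_from c ws \<and> V \<subseteq> insert c (set ws)"
proof -
  have "\<exists>ws. walk_from c ws \<and> S \<subseteq> insert c (set ws)" if "S \<subseteq> V" for S
    using finite_subset[OF that finite_V] that
  proof (induction S rule: finite_induct)
    case empty
    show ?case by (intro exI[of _ "[]"]) auto
  next
    case (insert s S)
    then obtain ws where ws: "walk_from c ws" "S \<subseteq> insert c (set ws)" by auto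
    have "last (c # ws) \<in> V" using walk_from_in_V[OF ws(1) assms] assms by auto
    then obtain k where "(E ^^ k) (last (c # ws)) s" using reachable insert.prems by blast
    then obtain vs where vs: "walk_from (last (c # ws)) vs" "last (last (c # ws) # vs) = s"
      using walk_from_relpowp by blast
    have "s \<in> insert c (set (ws @ vs))"
      using vs(2) by (cases "vs = []"; cases "ws = []") auto
    then show ?case
      using ws vs(1) by (intro exI[of _ "ws @ vs"]) (auto simp: walk_from_append)
  qed
  then show ?thesis by blast
qed

text \<open>
  After the updates along a walk from \<open>c\<close>, the value at every visited vertex contains \<open>f c\<close> with weight
  at least \<open>1 / D ^ length ws\<close>: a newly updated vertex is adjacent to the one updated just before, which
  carries this weight, and averaging over neighbours loses at most a factor \<open>D\<close>. A vertex that is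
  updated again is refreshed in the same way, so the weight never disappears.
\<close>

lemma fold_update_lower:
  assumes "c \<in> V" "\<And>v. v \<in> V \<Longrightarrow> lo \<le> f v" "walk_from c ws"
  shows "(\<forall>v\<in>V. lo \<le> fold update ws f v) \<and>
    (\<forall>v\<in>insert c (set ws). lo + (f c - lo) / real D ^ length ws \<le> fold update ws f v)"
  using assms(3)
proof (induction ws rule: rev_induct)
  case Nil
  then show ?case using assms by simp
next
  case (snoc w ws)
  let ?g = "fold update ws f"
  have ws: "walk_from c ws" and Ew: "E (last (c # ws)) w"
    using snoc.prems by (auto simp: walk_from_append simp del: last.simps)
  note IH = snoc.IH[OF ws]
  have w: "w \<in> V" using Ew by (rule E_in_V')
  have D1: "1 \<le> real D" using D_pos by simp
  have le: "lo + (f c - lo) / real D ^ Suc (length ws) \<le> lo + (f c - lo) / real D ^ length ws"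
    using D1 assms(2)[OF assms(1)] by (auto intro!: divide_left_mono)
  have last: "lo + (f c - lo) / real D ^ length ws \<le> ?g (last (c # ws))"
    using IH by auto
  have "(?g (last (c # ws)) - lo) / real D \<le> avg (\<lambda>u. ?g u - lo) w"
    unfolding avg_def
  proof (rule divide_right_mono)
    show "?g (last (c # ws)) - lo \<le> (\<Sum>u | E w u. ?g u - lo)"
      using finite_nbrs Ew IH by (intro member_le_sum) (auto dest: E_sym E_in_V' simp del: last.simps)
  qed simp
  then have low: "lo + (f c - lo) / real D ^ Suc (length ws) \<le> avg ?g w"
    using last D_pos avg_const[OF w, of lo] 
      divide_right_mono[of "(f c - lo) / real D ^ length ws" "?g (last (c # ws)) - lo" "real D"]
    by (simp add: avg_diff mult.commute del: last.simps)
  have "lo \<le> avg ?g w"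
    using IH w by (intro avg_ge) (auto dest: E_in_V')
  have eq: "fold update (ws @ [w]) f x = (if x = w then avg ?g w else ?g x)" for x
    by (simp add: update_apply)
  show ?case
  proof (intro conjI ballI)
    fix v assume "v \<in> V"
    then show "lo \<le> fold update (ws @ [w]) f v"
      using IH \<open>lo \<le> avg ?g w\<close> unfolding eq by simp
  next
    fix v assume v: "v \<in> insert c (set (ws @ [w]))"
    show "lo + (f c - lo) / real D ^ length (ws @ [w]) \<le> fold update (ws @ [w]) f v"
    proof (cases "v = w")
      case True
      then show ?thesis
        using low unfolding eq by simp
    next
      case False
      then have "lo + (f c - lo) / real D ^ length ws \<le> ?g v" using IH v by auto
      then show ?thesis using False le unfolding eq by simp
    qed
  qed
qed

lemma update_uminus: "update v (\<lambda>x. - f x) = (\<lambda>x. - update v f x)"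
  using avg_scale[of "-1" f v] by (auto simp: update_def fun_eq_iff)

lemma fold_update_uminus: "fold update ws (\<lambda>x. - f x) = (\<lambda>x. - fold update ws f x)"
  by (induction ws arbitrary: f) (simp_all add: update_uminus)

text \<open>
  All values contain the common value \<open>f c\<close> with a fixed weight; the upper bound is the lower bound for
  \<open>- f\<close>.
\<close>

lemma osc_fold_update:
  assumes c: "c \<in> V" and ws: "walk_from c ws" "V \<subseteq> insert c (set ws)"
  shows "osc (fold update ws f) \<le> (1 - 1 / real D ^ length ws) * osc f"
proof -
  obtain lo hi where b: "\<And>v. v \<in> V \<Longrightarrow> lo \<le> f v" "\<And>v. v \<in> V \<Longrightarrow> f v \<le> hi" "hi - lo = osc f"
    by (rule osc_bounds[of f]) blast
  let ?d = "1 / real D ^ length ws"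
  have "lo + (f c - lo) * ?d \<le> fold update ws f v" if "v \<in> V" for v
    using fold_update_lower[OF c, of lo f, OF b(1) ws(1)] ws(2) that by auto
  moreover have "fold update ws f v \<le> hi - (hi - f c) * ?d" if "v \<in> V" for v
  proof -
    have "- hi + (- f c - - hi) / real D ^ length ws \<le> fold update ws (\<lambda>x. - f x) v"
    proof (rule fold_update_lower[OF c, of "- hi" "\<lambda>x. - f x", THEN conjunct2, THEN bspec])
      show "v \<in> insert c (set ws)" using ws(2) that by blast
    qed (use b(2) ws(1) in auto)
    then show ?thesis by (simp add: fold_update_uminus)
  qed
  ultimately have "osc (fold update ws f) \<le> (hi - (hi - f c) * ?d) - (lo + (f c - lo) * ?d)"
    by (intro osc_le) auto
  also have "\<dots> = (1 - ?d) * (hi - lo)" by (simp add: algebra_simps diff_divide_distrib)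
  finally show ?thesis using b(3) by simp
qed

text \<open>
  The mean oscillation after \<open>j\<close> further steps of a walk that stands at \<open>c\<close> and updates the vertices that
  it steps on.
\<close>

primrec mean_osc :: "nat \<Rightarrow> ('v \<Rightarrow> real) \<Rightarrow> 'v \<Rightarrow> real" where
  "mean_osc 0 f c = osc f"
| "mean_osc (Suc j) f c = avg (\<lambda>y. mean_osc j (update y f) y) c"

lemma mean_osc_Suc_le: "c \<in> V \<Longrightarrow> mean_osc (Suc j) f c \<le> mean_osc j f c"
proof (induction j arbitrary: f c)
  case 0
  then show ?case by (auto intro!: avg_le osc_update dest: E_in_V')
next
  case (Suc j)
  have "avg (\<lambda>y. mean_osc (Suc j) (update y f) y) c \<le> avg (\<lambda>y. mean_osc j (update y f) y) c"
    by (intro avg_mono Suc.IH) (auto dest: E_in_V')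
  then show ?case by simp
qed

lemma mean_osc_decreasing: "c \<in> V \<Longrightarrow> j \<le> l \<Longrightarrow> mean_osc l f c \<le> mean_osc j f c"
  by (rule lift_Suc_antimono_le[of "\<lambda>j. mean_osc j f c"], rule mean_osc_Suc_le)

lemma mean_osc_le_osc: "c \<in> V \<Longrightarrow> mean_osc j f c \<le> osc f"
  using mean_osc_decreasing[of c 0 j f] by simp

lemma avg_le_one_exception:
  assumes "E c w" "\<And>y. E c y \<Longrightarrow> g y \<le> M"
  shows "avg g c \<le> (1 - 1 / real D) * M + g w / real D"
proof -
  have c: "c \<in> V" using assms(1) by (rule E_in_V)
  have "(\<Sum>u | E c u. g u) = g w + (\<Sum>u\<in>{u. E c u} - {w}. g u)"
    using assms(1) finite_nbrs by (subst sum.remove[of _ w]) auto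
  also have "(\<Sum>u\<in>{u. E c u} - {w}. g u) \<le> (\<Sum>u\<in>{u. E c u} - {w}. M)"
    using assms(2) by (intro sum_mono) auto
  also have "\<dots> = (real D - 1) * M"
    using assms(1) finite_nbrs card_nbrs[OF c] D_pos by (simp add: of_nat_diff)
  finally show ?thesis
    using D_pos by (simp add: avg_def field_simps)
qed

text \<open>
  With probability \<open>1 / D ^ length ws\<close> the walk follows \<open>ws\<close>; in all other cases the oscillation does not
  increase.
\<close>

lemma mean_osc_along:
  assumes "c \<in> V" "walk_from c ws"
  shows "mean_osc (length ws) f c
    \<le> (1 - 1 / real D ^ length ws) * osc f + (1 / real D ^ length ws) * osc (fold update ws f)"
  using assms
proof (induction ws arbitrary: f c)
  case (Cons w ws)
  let ?p = "1 / real D ^ length ws"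
  have w: "E c w" "walk_from w ws" "w \<in> V" using Cons.prems by (auto dest: E_in_V')
  have p: "0 \<le> 1 - ?p" using D_pos by (simp add: divide_simps)
  have "mean_osc (length ws) (update w f) w
      \<le> (1 - ?p) * osc (update w f) + ?p * osc (fold update ws (update w f))"
    using Cons.IH[OF w(3,2)] .
  also have "\<dots> \<le> (1 - ?p) * osc f + ?p * osc (fold update ws (update w f))"
    using mult_left_mono[OF osc_update[OF w(3), of f] p] by simp
  finally have ih: "mean_osc (length ws) (update w f) w
      \<le> (1 - ?p) * osc f + ?p * osc (fold update ws (update w f))" .
  have "mean_osc (length (w # ws)) f c
      \<le> (1 - 1 / real D) * osc f + mean_osc (length ws) (update w f) w / real D"
    unfolding list.size(4) add_0_right add_Suc_right mean_osc.simps(2)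
    by (rule avg_le_one_exception[OF w(1)], rule order_trans[OF mean_osc_le_osc osc_update]) (auto dest: E_in_V')
  also have "\<dots> \<le> (1 - 1 / real D) * osc f + ((1 - ?p) * osc f + ?p * osc (fold update ws (update w f))) / real D"
    using ih by (intro add_left_mono divide_right_mono) auto
  also have "\<dots> = (1 - 1 / real D ^ length (w # ws)) * osc f
      + (1 / real D ^ length (w # ws)) * osc (fold update (w # ws) f)"
    using D_pos by (simp add: field_simps)
  finally show ?case .
qed simp

text \<open>
  A covering walk exists from every vertex. Their lengths differ, but by monotonicity the longest one
  serves for all starting points.
\<close>

lemma mean_osc_contraction:
  obtains j r where "r < 1" "\<And>f c. c \<in> V \<Longrightarrow> mean_osc j f c \<le> r * osc f"
proof -
  obtain W where W: "\<And>c. c \<in> V \<Longrightarrow> walk_from c (W c) \<and> V \<subseteq> insert c (set (W c))"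
    using covering_walk by metis
  define j where "j = Max ((\<lambda>c. length (W c)) ` V)"
  let ?p = "\<lambda>k. 1 / real D ^ k"
  show thesis
  proof (rule that[of "1 - ?p j * ?p j" j])
    show "1 - ?p j * ?p j < 1" using D_pos by simp
    fix f c assume c: "c \<in> V"
    define k where "k = length (W c)"
    have kj: "k \<le> j" unfolding j_def k_def using c finite_V by (intro Max_ge) auto
    have D1: "1 \<le> real D" using D_pos by simp
    have pj: "?p j \<le> ?p k" using D1 kj by (intro divide_left_mono power_increasing) auto
    have "mean_osc j f c \<le> mean_osc k f c"
      using c kj by (rule mean_osc_decreasing)
    also have "\<dots> \<le> (1 - ?p k) * osc f + ?p k * osc (fold update (W c) f)"
      unfolding k_def using mean_osc_along[OF c] W[OF c] by blast
    also have "\<dots> \<le> (1 - ?p k) * osc f + ?p k * ((1 - ?p k) * osc f)"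
      using osc_fold_update[OF c] W[OF c] unfolding k_def
      by (intro add_left_mono mult_left_mono) auto
    also have "\<dots> = (1 - ?p k * ?p k) * osc f" by (simp add: algebra_simps)
    also have "\<dots> \<le> (1 - ?p j * ?p j) * osc f"
      using pj by (intro mult_right_mono diff_left_mono mult_mono osc_nonneg) auto
    finally show "mean_osc j f c \<le> (1 - ?p j * ?p j) * osc f" .
  qed
qed

section \<open>Running the masses backwards\<close>

primrec updates :: "(nat \<Rightarrow> 'v) \<Rightarrow> ('v \<Rightarrow> real) \<Rightarrow> nat \<Rightarrow> 'v \<Rightarrow> real" where
  "updates y f 0 = f"
| "updates y f (Suc k) = update (y k) (updates y f k)"

text \<open>
  Time is reversed: \<open>y 0\<close> is the vertex at which mass is redistributed last, and \<open>y n\<close> is the initial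
  position, which triggers no redistribution.
\<close>

definition back_mass :: "('v \<Rightarrow> real) \<Rightarrow> (nat \<Rightarrow> 'v) \<Rightarrow> nat \<Rightarrow> 'v \<Rightarrow> real" where
  "back_mass m0 y n = mass_after E m0 (\<lambda>i. y (n - i)) n"

lemma updates_duality:
  assumes "\<And>i. x i \<in> V" "j \<le> n"
  shows "(\<Sum>v\<in>V. f v * mass_after E m0 x n v)
    = (\<Sum>v\<in>V. updates (\<lambda>i. x (n - i)) f j v * mass_after E m0 x (n - j) v)"
  using assms(2)
proof (induction j)
  case (Suc j)
  then have "mass_after E m0 x (n - j) = spread E (x (n - j)) (mass_after E m0 x (n - Suc j))"
    by (metis Suc_diff_Suc Suc_le_lessD mass_after.simps(2))
  then show ?case using Suc sum_spread_update[OF assms(1)] by simp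
qed simp

lemma updates_cong: "(\<And>i. i < k \<Longrightarrow> x i = y i) \<Longrightarrow> updates x f k = updates y f k"
  by (induction k) auto

lemma mass_after_cong: "(\<And>i. i \<le> k \<Longrightarrow> x i = y i) \<Longrightarrow> mass_after E m0 x k = mass_after E m0 y k"
  using adaptedD[OF adapted_mass_after] by blast

lemma adapted_back_mass: "adapted n (\<lambda>y. back_mass m0 y n)"
  unfolding adapted_def back_mass_def by (auto intro!: mass_after_cong)

lemma adapted_updates: "adapted k (\<lambda>y. updates y f (Suc k))"
  unfolding adapted_def by (auto intro!: updates_cong simp del: updates.simps)

text \<open>
  Extending the walk further into the past changes only the masses to which the last \<open>k\<close> redistributions
  are applied; dually, the same function is integrated against two different probability vectors.
\<close>

lemma back_mass_cauchy:
  assumes m0: "mass_dist m0" and y: "\<And>i. y i \<in> V" and kn: "k \<le> n" and v: "v \<in> V"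
  shows "\<bar>back_mass m0 y n v - back_mass m0 y k v\<bar> \<le> osc (updates y (\<lambda>x. if x = v then 1 else 0) k)"
proof -
  let ?f = "\<lambda>x. if x = v then 1 else 0 :: real"
  have eval: "m v = (\<Sum>x\<in>V. ?f x * m x)" for m
    using v finite_V by (simp add: if_distrib if_distribR cong: if_cong)
  have rep: "back_mass m0 y l v = (\<Sum>x\<in>V. updates y ?f k x * mass_after E m0 (\<lambda>i. y (l - i)) (l - k) x)"
    if "k \<le> l" for l
  proof -
    have "back_mass m0 y l v = (\<Sum>x\<in>V. ?f x * mass_after E m0 (\<lambda>i. y (l - i)) l x)"
      unfolding back_mass_def by (rule eval)
    also have "\<dots> = (\<Sum>x\<in>V. updates (\<lambda>i. y (l - (l - i))) ?f k x * mass_after E m0 (\<lambda>i. y (l - i)) (l - k) x)"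
      by (rule updates_duality) (use y that in auto)
    also have "updates (\<lambda>i. y (l - (l - i))) ?f k = updates y ?f k"
      using that by (intro updates_cong) auto
    finally show ?thesis .
  qed
  show ?thesis
    unfolding rep[OF kn] rep[OF order_refl]
    by (intro mass_dist_integral_osc mass_dist_mass_after m0 y)
qed

end

section \<open>The backward masses converge\<close>

context regular_walk
begin

lemma expectation_osc_updates:
  "expectation (\<lambda>\<omega>. osc (updates (trajectory \<omega>) f (Suc (k + j))))
    = expectation (\<lambda>\<omega>. mean_osc j (updates (trajectory \<omega>) f (Suc k)) (X k \<omega>))"
proof (induction j arbitrary: k)
  case (Suc j)
  have "expectation (\<lambda>\<omega>. osc (updates (trajectory \<omega>) f (Suc (k + Suc j))))
     = expectation (\<lambda>\<omega>. mean_osc j (updates (trajectory \<omega>) f (Suc (Suc k))) (X (Suc k) \<omega>))"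
    using Suc[of "Suc k"] by simp
  also have "\<dots> = expectation (\<lambda>\<omega>. avg (\<lambda>y. mean_osc j (update y (updates (trajectory \<omega>) f (Suc k))) y) (X k \<omega>))"
    unfolding updates.simps(2)[of _ _ "Suc k"]
    by (rule markov) (rule adapted_comp[OF adapted_updates])
  finally show ?case by simp
qed simp

text \<open>
  The means decrease and are contracted by a fixed factor every \<open>j\<close> steps.
\<close>

lemma expectation_osc_tendsto_0:
  "(\<lambda>k. expectation (\<lambda>\<omega>. osc (updates (trajectory \<omega>) f (Suc k)))) \<longlonglongrightarrow> 0"
proof -
  define e where "e k = expectation (\<lambda>\<omega>. osc (updates (trajectory \<omega>) f (Suc k)))" for k
  have ad: "adapted k (\<lambda>y. osc (updates y f (Suc k)))" for k
    by (rule adapted_comp[OF adapted_updates])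
  have e_nonneg: "0 \<le> e k" for k unfolding e_def by (intro integral_nonneg_AE) (auto simp: osc_nonneg)
  have int: "integrable P (\<lambda>\<omega>. osc (updates (trajectory \<omega>) f (Suc k)))" for k
    by (rule adapted_integrable[OF ad])
  have dec: "e (Suc k) \<le> e k" for k
    unfolding e_def by (rule integral_mono[OF int int]) (auto intro: osc_update X_in_V)
  obtain j r where jr: "r < 1" "\<And>f c. c \<in> V \<Longrightarrow> mean_osc j f c \<le> r * osc f"
    by (rule mean_osc_contraction) blast
  have contr: "e (k + j) \<le> r * e k" for k
  proof -
    have ad': "adapted k (\<lambda>y. mean_osc j (updates y f (Suc k)) (y k))"
      by (rule adapted_comp2[OF adapted_updates])
    have "e (k + j) = expectation (\<lambda>\<omega>. mean_osc j (updates (trajectory \<omega>) f (Suc k)) (X k \<omega>))"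
      unfolding e_def by (rule expectation_osc_updates)
    also have "\<dots> \<le> expectation (\<lambda>\<omega>. r * osc (updates (trajectory \<omega>) f (Suc k)))"
      by (intro integral_mono adapted_integrable[OF ad'] integrable_mult_right int jr X_in_V)
    finally show ?thesis unfolding e_def by simp
  qed
  obtain l where l: "e \<longlonglongrightarrow> l" "\<And>k. l \<le> e k"
    using decseq_convergent[of e 0] dec e_nonneg by (auto intro: decseq_SucI)
  have "l \<le> r * l"
    by (rule LIMSEQ_le[OF LIMSEQ_ignore_initial_segment[OF l(1), of j] tendsto_mult_left[OF l(1), of r]])
       (use contr in auto)
  moreover have "0 \<le> l" using LIMSEQ_le_const[OF l(1)] e_nonneg by blast
  ultimately have "l = 0" using jr(1) by (cases "l = 0") (auto simp: mult_le_cancel_right)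
  then show ?thesis using l(1) unfolding e_def by simp
qed

text \<open>
  Along every trajectory the oscillation decreases, so it has a limit, and the mean of this limit is
  zero.
\<close>

lemma AE_osc_tendsto_0: "AE \<omega> in P. (\<lambda>k. osc (updates (trajectory \<omega>) f k)) \<longlonglongrightarrow> 0"
proof -
  let ?o = "\<lambda>k \<omega>. osc (updates (trajectory \<omega>) f (Suc k))"
  have ad: "adapted k (\<lambda>y. osc (updates y f (Suc k)))" for k
    by (rule adapted_comp[OF adapted_updates])
  have meas [measurable]: "?o k \<in> borel_measurable P" for k
    by (rule adapted_measurable[OF ad])
  have dec: "?o (Suc k) \<omega> \<le> ?o k \<omega>" if "\<omega> \<in> space P" for k \<omega>
    using that by (auto intro: osc_update X_in_V)
  have conv: "(\<lambda>k. ?o k \<omega>) \<longlonglongrightarrow> lim (\<lambda>k. ?o k \<omega>)" if "\<omega> \<in> space P" for \<omega>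
  proof -
    have "decseq (\<lambda>k. ?o k \<omega>)" by (intro decseq_SucI dec that)
    then have "convergent (\<lambda>k. ?o k \<omega>)"
      using osc_nonneg by (auto simp: convergent_def elim!: decseq_convergent)
    then show ?thesis by (rule convergent_LIMSEQ_iff[THEN iffD1])
  qed
  have bound: "\<bar>?o k \<omega>\<bar> \<le> osc f" if "\<omega> \<in> space P" for k \<omega>
  proof (induction k)
    case 0
    then show ?case using osc_update[OF X_in_V[OF that], of 0 f] osc_nonneg by simp
  next
    case (Suc k)
    then show ?case using dec[OF that, of k] osc_nonneg[of "updates (trajectory \<omega>) f (Suc (Suc k))"] by linarith
  qed
  have lim_meas [measurable]: "(\<lambda>\<omega>. lim (\<lambda>k. ?o k \<omega>)) \<in> borel_measurable P"
    by (rule borel_measurable_lim_metric) measurable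
  have "(\<lambda>k. expectation (?o k)) \<longlonglongrightarrow> expectation (\<lambda>\<omega>. lim (\<lambda>k. ?o k \<omega>))"
    by (rule integral_dominated_convergence[where w="\<lambda>_. osc f", OF lim_meas meas])
       (auto intro!: AE_I2 conv bound simp del: updates.simps)
  then have "expectation (\<lambda>\<omega>. lim (\<lambda>k. ?o k \<omega>)) = 0"
    using expectation_osc_tendsto_0 LIMSEQ_unique by blast
  moreover have nn: "0 \<le> lim (\<lambda>k. ?o k \<omega>)" if "\<omega> \<in> space P" for \<omega>
    using LIMSEQ_le_const[OF conv[OF that]] osc_nonneg by blast
  moreover have "integrable P (\<lambda>\<omega>. lim (\<lambda>k. ?o k \<omega>))"
  proof (rule integrable_const_bound[OF _ lim_meas])
    show "AE \<omega> in P. norm (lim (\<lambda>k. ?o k \<omega>)) \<le> osc f"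
    proof (rule AE_I2)
      fix \<omega> assume \<omega>: "\<omega> \<in> space P"
      have "?o k \<omega> \<le> osc f" for k using bound[OF \<omega>, of k] by linarith
      then have "lim (\<lambda>k. ?o k \<omega>) \<le> osc f" using LIMSEQ_le_const2[OF conv[OF \<omega>]] by blast
      then show "norm (lim (\<lambda>k. ?o k \<omega>)) \<le> osc f" using nn[OF \<omega>] by simp
    qed
  qed
  ultimately have "AE \<omega> in P. lim (\<lambda>k. ?o k \<omega>) = 0"
    by (subst (asm) integral_nonneg_eq_0_iff_AE) auto
  then show ?thesis
    using AE_space
  proof eventually_elim
    case (elim \<omega>)
    then have "(\<lambda>k. osc (updates (trajectory \<omega>) f (Suc k))) \<longlonglongrightarrow> 0" using conv[of \<omega>] by simp
    then show ?case by (rule LIMSEQ_imp_Suc)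
  qed
qed

definition limit_mass :: "('v \<Rightarrow> real) \<Rightarrow> 'w \<Rightarrow> 'v \<Rightarrow> real" where
  "limit_mass m0 \<omega> v = lim (\<lambda>n. back_mass m0 (trajectory \<omega>) n v)"

lemma back_mass_measurable [measurable]: "(\<lambda>\<omega>. back_mass m0 (trajectory \<omega>) n v) \<in> borel_measurable P"
  by (rule adapted_measurable[OF adapted_comp[OF adapted_back_mass, of n "\<lambda>m. m v"]])

lemma limit_mass_measurable [measurable]: "(\<lambda>\<omega>. limit_mass m0 \<omega> v) \<in> borel_measurable P"
  unfolding limit_mass_def by (rule borel_measurable_lim_metric) measurable

lemma AE_back_mass_tendsto:
  assumes m0: "mass_dist m0"
  shows "AE \<omega> in P. \<forall>v\<in>V. (\<lambda>n. back_mass m0 (trajectory \<omega>) n v) \<longlonglongrightarrow> limit_mass m0 \<omega> v"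
proof (rule AE_finite_allI[OF finite_V])
  fix v assume v: "v \<in> V"
  let ?f = "\<lambda>x. if x = v then 1 else 0 :: real"
  show "AE \<omega> in P. (\<lambda>n. back_mass m0 (trajectory \<omega>) n v) \<longlonglongrightarrow> limit_mass m0 \<omega> v"
    using AE_osc_tendsto_0[of ?f] AE_space
  proof eventually_elim
    case (elim \<omega>)
    have "Cauchy (\<lambda>n. back_mass m0 (trajectory \<omega>) n v)"
    proof (rule CauchyI')
      fix e :: real assume "0 < e"
      then have "\<forall>\<^sub>F k in sequentially. osc (updates (trajectory \<omega>) ?f k) < e"
        using elim(1) by (intro order_tendstoD) auto
      then obtain K where K: "\<And>k. k \<ge> K \<Longrightarrow> osc (updates (trajectory \<omega>) ?f k) < e"
        by (auto simp: eventually_sequentially)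
      show "\<exists>M. \<forall>m\<ge>M. \<forall>n>m. dist (back_mass m0 (trajectory \<omega>) m v) (back_mass m0 (trajectory \<omega>) n v) < e"
      proof (intro exI allI impI)
        fix m n assume "K \<le> m" "m < n"
        then show "dist (back_mass m0 (trajectory \<omega>) m v) (back_mass m0 (trajectory \<omega>) n v) < e"
          using back_mass_cauchy[OF m0, of "trajectory \<omega>" m n v] X_in_V[OF elim(2)] v K[of m]
          by (simp add: dist_real_def abs_minus_commute)
      qed
    qed
    then show ?case
      unfolding limit_mass_def by (simp add: Cauchy_convergent_iff convergent_LIMSEQ_iff)
  qed
qed

end

context regular_graph
begin

section \<open>A stationary random walk\<close>

definition nbr :: "'v \<Rightarrow> nat \<Rightarrow> 'v" where
  "nbr v = (SOME f. bij_betw f {..<D} {u. E v u})"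

lemma nbr_bij: "v \<in> V \<Longrightarrow> bij_betw (nbr v) {..<D} {u. E v u}"
proof -
  assume v: "v \<in> V"
  obtain f where "bij_betw f {0..<card {u. E v u}} {u. E v u}"
    using ex_bij_betw_nat_finite[OF finite_nbrs] by blast
  then have "bij_betw f {..<D} {u. E v u}" by (simp add: card_nbrs[OF v] atLeast0LessThan)
  then show ?thesis
    unfolding nbr_def by (rule someI[of "\<lambda>f. bij_betw f {..<D} {u. E v u}"])
qed

lemma nbr_adjacent: "v \<in> V \<Longrightarrow> j < D \<Longrightarrow> E v (nbr v j)"
  using nbr_bij[of v] by (auto simp: bij_betw_def)

lemma nbr_index: "E v u \<Longrightarrow> \<exists>!j. j < D \<and> nbr v j = u"
proof -
  assume "E v u"
  then have b: "bij_betw (nbr v) {..<D} {u. E v u}" and u: "u \<in> {u. E v u}"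
    using nbr_bij E_in_V by auto
  have "u \<in> nbr v ` {..<D}" using b u by (simp add: bij_betw_def)
  then obtain j where j: "j < D" "nbr v j = u" by auto
  show ?thesis
  proof (rule ex1I[of _ j])
    fix i assume "i < D \<and> nbr v i = u"
    then show "i = j" using b j by (auto simp: bij_betw_def dest: inj_onD)
  qed (use j in simp)
qed

text \<open>
  A uniform vertex and independent uniform labels that select the successive neighbours.
\<close>

definition choice_space :: "('v \<times> (nat \<Rightarrow> nat)) measure" where
  "choice_space = uniform_count_measure V \<Otimes>\<^sub>M Pi\<^sub>M UNIV (\<lambda>_. uniform_count_measure {..<D})"

primrec stationary_walk :: "nat \<Rightarrow> 'v \<times> (nat \<Rightarrow> nat) \<Rightarrow> 'v" where
  "stationary_walk 0 \<omega> = fst \<omega>"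
| "stationary_walk (Suc k) \<omega> = nbr (stationary_walk k \<omega>) (snd \<omega> k)"

lemma prob_space_uniform_V: "prob_space (uniform_count_measure V)"
  by (rule prob_space_uniform_count_measure[OF finite_V V_nonempty])

lemma prob_space_uniform_D: "prob_space (uniform_count_measure {..<D})"
  using D_pos by (intro prob_space_uniform_count_measure) auto

lemma space_choice_space: "space choice_space = V \<times> (UNIV \<rightarrow>\<^sub>E {..<D})"
  by (simp add: choice_space_def space_pair_measure space_PiM space_uniform_count_measure)

lemma choice_less: "\<omega> \<in> space choice_space \<Longrightarrow> snd \<omega> k < D"
  unfolding space_choice_space using PiE_mem[of "snd \<omega>" UNIV "\<lambda>_. {..<D}" k] by auto

lemma prob_space_choice_space: "prob_space choice_space"
  unfolding choice_space_def
  by (intro prob_space_pair prob_space_PiM prob_space_uniform_V prob_space_uniform_D)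

lemma stationary_walk_in_V: "\<omega> \<in> space choice_space \<Longrightarrow> stationary_walk k \<omega> \<in> V"
  by (induction k) (auto simp: space_choice_space intro!: E_in_V'[OF nbr_adjacent] dest: PiE_mem)

lemma stationary_walk_step: "\<omega> \<in> space choice_space \<Longrightarrow> E (stationary_walk k \<omega>) (stationary_walk (Suc k) \<omega>)"
  using stationary_walk_in_V by (auto simp: space_choice_space intro!: nbr_adjacent dest: PiE_mem)

lemma stationary_walk_measurable: "stationary_walk k \<in> choice_space \<rightarrow>\<^sub>M count_space V"
proof (induction k)
  case 0
  have "fst \<in> choice_space \<rightarrow>\<^sub>M uniform_count_measure V"
    unfolding choice_space_def by measurable
  moreover have "sets (uniform_count_measure V) = sets (count_space V)"
    by (simp add: sets_uniform_count_measure)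
  ultimately have "fst \<in> choice_space \<rightarrow>\<^sub>M count_space V"
    using measurable_cong_sets[OF refl, of "uniform_count_measure V" "count_space V" choice_space] by simp
  moreover have "stationary_walk 0 = fst" by (simp add: fun_eq_iff)
  ultimately show ?case by (simp only:)
next
  case (Suc k)
  have coord: "(\<lambda>\<omega>. snd \<omega> k) \<in> choice_space \<rightarrow>\<^sub>M uniform_count_measure {..<D}"
    unfolding choice_space_def by measurable
  show ?case
  proof (subst measurable_count_space_eq2[OF finite_V], intro conjI ballI)
    show "stationary_walk (Suc k) \<in> space choice_space \<rightarrow> V"
      using stationary_walk_in_V by blast
    fix a assume a: "a \<in> V"
    have "stationary_walk (Suc k) -` {a} \<inter> space choice_space
      = (\<Union>v\<in>V. \<Union>j\<in>{j\<in>{..<D}. nbr v j = a}.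
          (stationary_walk k -` {v} \<inter> space choice_space) \<inter> ((\<lambda>\<omega>. snd \<omega> k) -` {j} \<inter> space choice_space))"
      using stationary_walk_in_V choice_less by force
    also have "\<dots> \<in> sets choice_space"
    proof (intro sets.finite_UN)
      fix v j assume v: "v \<in> V" and j: "j \<in> {j\<in>{..<D}. nbr v j = a}"
      have "stationary_walk k -` {v} \<inter> space choice_space \<in> sets choice_space"
        using v by (intro measurable_sets[OF Suc]) simp
      moreover have "(\<lambda>\<omega>. snd \<omega> k) -` {j} \<inter> space choice_space \<in> sets choice_space"
        using j by (intro measurable_sets[OF coord]) (simp add: sets_uniform_count_measure)
      ultimately show "(stationary_walk k -` {v} \<inter> space choice_space) \<inter> ((\<lambda>\<omega>. snd \<omega> k) -` {j} \<inter> space choice_space)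
          \<in> sets choice_space" by (rule sets.Int)
    qed (use finite_V in auto)
    finally show "stationary_walk (Suc k) -` {a} \<inter> space choice_space \<in> sets choice_space" .
  qed
qed

lemma prob_stationary_path:
  assumes x0: "x 0 \<in> V" and step: "\<And>i. i < n \<Longrightarrow> E (x i) (x (Suc i))"
  shows "measure choice_space {\<omega> \<in> space choice_space. \<forall>i\<le>n. stationary_walk i \<omega> = x i} = 1 / N * (1 / real D) ^ n"
proof -
  interpret V: prob_space "uniform_count_measure V" by (rule prob_space_uniform_V)
  interpret PD: prob_space "uniform_count_measure {..<D}" by (rule prob_space_uniform_D)
  interpret PP: product_prob_space "\<lambda>_::nat. uniform_count_measure {..<D}" UNIV ..
  have "prob_space (Pi\<^sub>M UNIV (\<lambda>_::nat. uniform_count_measure {..<D}))"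
    by (intro prob_space_PiM prob_space_uniform_D)
  note Times = sigma_finite_measure.emeasure_pair_measure_Times[OF prob_space_imp_sigma_finite[OF this]]
  define idx where "idx i = (THE j. j < D \<and> nbr (x i) j = x (Suc i))" for i
  have idx: "idx i < D \<and> nbr (x i) (idx i) = x (Suc i)" if "i < n" for i
    unfolding idx_def by (rule theI'[OF nbr_index[OF step[OF that]]])
  have uniq: "j = idx i" if "i < n" "j < D" "nbr (x i) j = x (Suc i)" for i j
    using nbr_index[OF step[OF that(1)]] idx[OF that(1)] that by blast
  let ?J = "{j \<in> space (Pi\<^sub>M UNIV (\<lambda>_::nat. uniform_count_measure {..<D})). \<forall>i\<in>{..<n}. j i \<in> {idx i}}"
  have iff: "(\<forall>i\<le>k. stationary_walk i \<omega> = x i) \<longleftrightarrow> fst \<omega> = x 0 \<and> (\<forall>i<k. snd \<omega> i = idx i)"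
    if "\<omega> \<in> space choice_space" "k \<le> n" for \<omega> k
    using that(2)
  proof (induction k)
    case (Suc k)
    have "(\<forall>i\<le>Suc k. stationary_walk i \<omega> = x i) \<longleftrightarrow>
       (\<forall>i\<le>k. stationary_walk i \<omega> = x i) \<and> nbr (x k) (snd \<omega> k) = x (Suc k)"
    proof -
      have "(\<forall>i\<le>Suc k. stationary_walk i \<omega> = x i) \<longleftrightarrow>
         (\<forall>i\<le>k. stationary_walk i \<omega> = x i) \<and> stationary_walk (Suc k) \<omega> = x (Suc k)"
        by (auto simp: le_Suc_eq simp del: stationary_walk.simps)
      also have "\<dots> \<longleftrightarrow> (\<forall>i\<le>k. stationary_walk i \<omega> = x i) \<and> nbr (x k) (snd \<omega> k) = x (Suc k)"
        by (rule conj_cong) auto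
      finally show ?thesis .
    qed
    also have "nbr (x k) (snd \<omega> k) = x (Suc k) \<longleftrightarrow> snd \<omega> k = idx k"
      using idx[of k] uniq[of k "snd \<omega> k"] Suc.prems choice_less[OF that(1)] by auto
    finally show ?case using Suc by (auto simp: less_Suc_eq)
  qed auto
  have "{\<omega> \<in> space choice_space. \<forall>i\<le>n. stationary_walk i \<omega> = x i}
      = {\<omega> \<in> space choice_space. fst \<omega> = x 0 \<and> (\<forall>i<n. snd \<omega> i = idx i)}"
    using iff[OF _ order_refl] by blast
  also have "\<dots> = {x 0} \<times> ?J"
    using x0 by (auto simp: space_choice_space space_PiM space_uniform_count_measure)
  finally have "{\<omega> \<in> space choice_space. \<forall>i\<le>n. stationary_walk i \<omega> = x i} = {x 0} \<times> ?J" .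
  moreover have "emeasure (Pi\<^sub>M UNIV (\<lambda>_::nat. uniform_count_measure {..<D})) ?J
     = (\<Prod>i\<in>{..<n}. emeasure (uniform_count_measure {..<D}) {idx i})"
    using idx by (intro PP.emeasure_PiM_Collect) (auto simp: sets_uniform_count_measure)
  moreover have "(\<Prod>i\<in>{..<n}. emeasure (uniform_count_measure {..<D}) {idx i}) = ennreal ((1 / real D) ^ n)"
  proof -
    have "(\<Prod>i\<in>{..<n}. emeasure (uniform_count_measure {..<D}) {idx i}) = (\<Prod>i\<in>{..<n}. ennreal (1 / real D))"
      using idx by (intro prod.cong refl) (simp add: emeasure_uniform_count_measure)
    then show ?thesis by (simp add: ennreal_power)
  qed
  moreover have "?J \<in> sets (Pi\<^sub>M UNIV (\<lambda>_::nat. uniform_count_measure {..<D}))"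
  proof (rule sets.sets_Collect_finite_All)
    fix i assume i: "i \<in> {..<n}"
    have "{j \<in> space (Pi\<^sub>M UNIV (\<lambda>_::nat. uniform_count_measure {..<D})). j i \<in> {idx i}}
        = (\<lambda>j. j i) -` {idx i} \<inter> space (Pi\<^sub>M UNIV (\<lambda>_::nat. uniform_count_measure {..<D}))" by auto
    also have "\<dots> \<in> sets (Pi\<^sub>M UNIV (\<lambda>_::nat. uniform_count_measure {..<D}))"
      using idx i by (intro measurable_sets[OF measurable_component_singleton]) (auto simp: sets_uniform_count_measure)
    finally show "{j \<in> space (Pi\<^sub>M UNIV (\<lambda>_::nat. uniform_count_measure {..<D})). j i \<in> {idx i}}
        \<in> sets (Pi\<^sub>M UNIV (\<lambda>_::nat. uniform_count_measure {..<D}))" .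
  qed simp
  ultimately have "emeasure choice_space {\<omega> \<in> space choice_space. \<forall>i\<le>n. stationary_walk i \<omega> = x i}
      = ennreal (1 / N) * ennreal ((1 / real D) ^ n)"
    using x0 finite_V unfolding choice_space_def
    by (simp add: Times sets_uniform_count_measure emeasure_uniform_count_measure)
  then show ?thesis
    by (simp add: measure_def ennreal_mult'[symmetric])
qed

lemma regular_walk_stationary: "regular_walk V E D L choice_space stationary_walk"
proof -
  interpret prob_space choice_space by (rule prob_space_choice_space)
  show ?thesis
  proof
    show "stationary_walk k \<in> choice_space \<rightarrow>\<^sub>M count_space V" for k
      by (rule stationary_walk_measurable)
    fix k and x :: "nat \<Rightarrow> 'v"
    let ?A = "\<lambda>k. {\<omega> \<in> space choice_space. \<forall>i\<le>k. stationary_walk i \<omega> = x i}"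
    show "prob (?A (Suc k)) = prob (?A k) * (if E (x k) (x (Suc k)) then 1 / real (vertex_degree E (x k)) else 0)"
    proof (cases "x 0 \<in> V \<and> (\<forall>i<k. E (x i) (x (Suc i)))")
      case True
      then have pk: "prob (?A k) = 1 / N * (1 / real D) ^ k" by (intro prob_stationary_path) auto
      show ?thesis
      proof (cases "E (x k) (x (Suc k))")
        case E: True
        then have "prob (?A (Suc k)) = 1 / N * (1 / real D) ^ Suc k"
          using True by (intro prob_stationary_path) (auto simp: less_Suc_eq)
        then show ?thesis using pk E degree[OF E_in_V[OF E]] by simp
      next
        case False
        have "\<omega> \<notin> ?A (Suc k)" for \<omega>
        proof
          assume A: "\<omega> \<in> ?A (Suc k)"
          then have "E (x k) (x (Suc k))" using stationary_walk_step[of \<omega> k] by (simp del: stationary_walk.simps)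
          then show False using False by simp
        qed
        then have empty: "?A (Suc k) = {}" by blast
        show ?thesis unfolding empty using False by simp
      qed
    next
      case False
      have "\<omega> \<notin> ?A k" for \<omega>
      proof
        assume A: "\<omega> \<in> ?A k"
        then have "E (x i) (x (Suc i))" if "i < k" for i
          using stationary_walk_step[of \<omega> i] that by (simp del: stationary_walk.simps)
        moreover have "x 0 \<in> V" using A stationary_walk_in_V[of \<omega> 0] by (simp del: stationary_walk.simps)
        ultimately show False using False by blast
      qed
      then have empty: "?A k = {}" by blast
      have "?A (Suc k) \<subseteq> ?A k" by auto
      then have empty': "?A (Suc k) = {}" using empty by blast
      show ?thesis unfolding empty empty' by simp
    qed
  qed
qed

lemma stationary_walk_start:
  assumes "v \<in> V"
  shows "measure choice_space {\<omega> \<in> space choice_space. stationary_walk 0 \<omega> = v} = 1 / N"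
  using prob_stationary_path[of "\<lambda>_. v" 0] assms by simp

end

section \<open>Mixing\<close>

context regular_walk
begin

text \<open>
  For \<open>n \<ge> K\<close> the mean of \<open>G\<close> over the event \<open>X n = x\<close>, as a function of \<open>x\<close>, evolves with \<open>n\<close> by \<open>avg\<close>.
  Shift invariance of Poisson averages makes its Poisson average nearly harmonic, hence nearly constant
  by \<open>green_representation\<close>, and its sum over all \<open>x\<close> is the mean of \<open>G\<close>.
\<close>

lemma visits_mean:
  fixes G :: "(nat \<Rightarrow> 'v) \<Rightarrow> real"
  assumes G: "adapted K G" and KC: "\<And>\<omega>. \<omega> \<in> space P \<Longrightarrow> \<bar>G (trajectory \<omega>)\<bar> \<le> C" and y: "y \<in> V"
  shows "((\<lambda>t. poisson_mean t (\<lambda>n. expectation (\<lambda>\<omega>. indicator {y} (X n \<omega>) * G (trajectory \<omega>))))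
     \<longlongrightarrow> expectation (\<lambda>\<omega>. G (trajectory \<omega>)) / N) at_top"
proof -
  define b where "b x n = expectation (\<lambda>\<omega>. indicator {x} (X n \<omega>) * G (trajectory \<omega>))" for x n
  have int: "integrable P (\<lambda>\<omega>. indicator {x} (X n \<omega>) * G (trajectory \<omega>))" for x n
  proof -
    have "adapted (max n K) (\<lambda>z. indicator {x} (z n) * G z)"
      unfolding adapted_def
    proof (intro allI impI)
      fix z z' :: "nat \<Rightarrow> 'v" assume eq: "\<forall>i\<le>max n K. z i = z' i"
      then have "G z = G z'" by (intro adaptedD[OF G]) simp
      then show "indicator {x} (z n) * G z = indicator {x} (z' n) * G z'" using eq by simp
    qed
    then show ?thesis by (rule adapted_integrable)
  qed
  obtain \<omega>0 where \<omega>0: "\<omega>0 \<in> space P" using not_empty by blast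
  have C: "0 \<le> C" using KC[OF \<omega>0] by linarith
  have bC: "\<bar>b x n\<bar> \<le> C" for x n
  proof -
    have "\<bar>b x n\<bar> \<le> expectation (\<lambda>\<omega>. \<bar>indicator {x} (X n \<omega>) * G (trajectory \<omega>)\<bar>)"
      unfolding b_def by (rule integral_abs_bound)
    also have "\<dots> \<le> C"
      using KC C by (intro integral_le_const integrable_abs int) (auto intro!: AE_I2 simp: indicator_def abs_mult)
    finally show ?thesis .
  qed
  have step: "b x (Suc n) = avg (\<lambda>z. b z n) x" if n: "K \<le> n" for x n
  proof -
    have G': "adapted n G" using adapted_mono[OF G n] .
    have "b x (Suc n) = expectation (\<lambda>\<omega>. (\<lambda>z v. indicator {x} v * G z) (trajectory \<omega>) (X (Suc n) \<omega>))"
      by (simp add: b_def)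
    also have "\<dots> = expectation (\<lambda>\<omega>. avg (\<lambda>v. indicator {x} v * G (trajectory \<omega>)) (X n \<omega>))"
      by (rule markov) (rule adapted_comp[OF G'])
    also have "\<dots> = expectation (\<lambda>\<omega>. avg (\<lambda>z. indicator {z} (X n \<omega>) * G (trajectory \<omega>)) x)"
    proof (intro Bochner_Integration.integral_cong refl)
      fix \<omega> assume "\<omega> \<in> space P"
      have "(\<Sum>u | E (X n \<omega>) u. indicator {x} u :: real) = (\<Sum>u | E x u. indicator {u} (X n \<omega>))"
      proof -
        have "indicator {x} u = (if u = x then 1 else 0 :: real)" 
          "indicator {u} x = (if u = x then 1 else 0 :: real)" for u x :: 'v
          by (auto simp: indicator_def)
        then have "(\<Sum>u | E a u. indicator {x} u :: real) = (if E a x then 1 else 0)"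
          "(\<Sum>u | E x u. indicator {u} a :: real) = (if E x a then 1 else 0)" for a
          using finite_nbrs by simp_all
        then show ?thesis using E_sym by auto
      qed
      then show "avg (\<lambda>v. indicator {x} v * G (trajectory \<omega>)) (X n \<omega>)
          = avg (\<lambda>z. indicator {z} (X n \<omega>) * G (trajectory \<omega>)) x"
        by (simp add: avg_scale_right) (simp add: avg_def)
    qed
    also have "\<dots> = avg (\<lambda>z. b z n) x"
      unfolding avg_def b_def using int by simp
    finally show ?thesis .
  qed
  have total: "(\<Sum>x\<in>V. b x n) = expectation (\<lambda>\<omega>. G (trajectory \<omega>))" for n
  proof -
    have "(\<Sum>x\<in>V. b x n) = expectation (\<lambda>\<omega>. \<Sum>x\<in>V. indicator {x} (X n \<omega>) * G (trajectory \<omega>))"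
      unfolding b_def using int by (intro Bochner_Integration.integral_sum[symmetric])
    also have "\<dots> = expectation (\<lambda>\<omega>. G (trajectory \<omega>))"
    proof (intro Bochner_Integration.integral_cong refl)
      fix \<omega> assume "\<omega> \<in> space P"
      then show "(\<Sum>x\<in>V. indicator {x} (X n \<omega>) * G (trajectory \<omega>)) = G (trajectory \<omega>)"
        using finite_V X_in_V[of \<omega> n] by (simp add: sum_distrib_right[symmetric] indicator_def of_bool_def)
    qed
    finally show ?thesis .
  qed
  define \<beta> where "\<beta> t x = poisson_mean t (b x)" for t x
  have avg\<beta>: "avg (\<beta> t) x = poisson_mean t (\<lambda>n. avg (\<lambda>z. b z n) x)" for t x
    unfolding avg_def \<beta>_def using poisson_mean_sum[of "{u. E x u}" b "\<lambda>_. C" t] bC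
    using poisson_mean_scale[of t "1 / real D" "\<lambda>n. \<Sum>u | E x u. b u n"] by simp
  have null: "((\<lambda>t. \<beta> t x - avg (\<beta> t) x) \<longlongrightarrow> 0) at_top" if x: "x \<in> V" for x
  proof -
    have "poisson_null (\<lambda>n. (- b x (Suc n)) - (- b x n))"
      by (rule poisson_null_shift[of "\<lambda>n. - b x n" C]) (use bC in auto)
    then have "poisson_null (\<lambda>n. b x n - avg (\<lambda>z. b z n) x)"
    proof (rule poisson_null_cong)
      show "\<bar>(- b x (Suc n)) - (- b x n)\<bar> \<le> 2 * C" for n
        using bC[of x n] bC[of x "Suc n"] by linarith
      show "b x n - avg (\<lambda>z. b z n) x = - b x (Suc n) - - b x n" if "K \<le> n" for n
        using step[OF that] by simp
    qed
    moreover have "poisson_mean t (\<lambda>n. b x n - avg (\<lambda>z. b z n) x) = \<beta> t x - avg (\<beta> t) x" for t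
      unfolding avg\<beta> \<beta>_def by (rule poisson_mean_diff[of _ C _ C]) (use bC abs_avg_le[OF x] in auto)
    ultimately show ?thesis by (simp add: poisson_null_def)
  qed
  have "((\<lambda>t. (\<Sum>x\<in>V. (\<beta> t x - avg (\<beta> t) x) * green y x) + expectation (\<lambda>\<omega>. G (trajectory \<omega>)) / N)
      \<longlongrightarrow> (\<Sum>x\<in>V. 0 * green y x) + expectation (\<lambda>\<omega>. G (trajectory \<omega>)) / N) at_top"
    by (intro tendsto_intros null)
  moreover have "(\<Sum>x\<in>V. (\<beta> t x - avg (\<beta> t) x) * green y x) + expectation (\<lambda>\<omega>. G (trajectory \<omega>)) / N = \<beta> t y" for t
  proof -
    have "(\<Sum>x\<in>V. \<beta> t x) = poisson_mean t (\<lambda>n. \<Sum>x\<in>V. b x n)"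
      unfolding \<beta>_def by (rule poisson_mean_sum[symmetric, where C="\<lambda>_. C"]) (rule bC)
    then have "(\<Sum>x\<in>V. \<beta> t x) = expectation (\<lambda>\<omega>. G (trajectory \<omega>))" by (simp add: total)
    then show ?thesis using green_representation[OF y, of "\<beta> t"] by simp
  qed
  ultimately show ?thesis by (simp add: \<beta>_def b_def[abs_def])
qed

end

section \<open>Convergence of the masses in distribution\<close>

context regular_graph
begin

definition reverse :: "nat \<Rightarrow> (nat \<Rightarrow> 'v) \<Rightarrow> nat \<Rightarrow> 'v" where
  "reverse n p = (\<lambda>i\<in>{..n}. p (n - i))"

lemma reverse_in_paths: "p \<in> paths n \<Longrightarrow> reverse n p \<in> paths n"
  by (auto simp: paths_def reverse_def)

lemma reverse_reverse: "p \<in> paths n \<Longrightarrow> reverse n (reverse n p) = p"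
  by (auto simp: paths_def reverse_def fun_eq_iff PiE_def extensional_def)

lemma weight_reverse: "weight n (reverse n p) = weight n p"
proof -
  have "weight n (reverse n p) = (\<Prod>i<n. if E (p (n - i)) (p (n - Suc i)) then 1 / real D else 0)"
    unfolding weight_def reverse_def by (intro prod.cong) auto
  also have "\<dots> = (\<Prod>i<n. if E (p (Suc (n - Suc i))) (p (n - Suc i)) then 1 / real D else 0)"
    by (intro prod.cong) (auto simp: Suc_diff_Suc)
  also have "\<dots> = (\<Prod>i<n. if E (p (Suc i)) (p i) then 1 / real D else 0)"
    by (rule prod.nat_diff_reindex)
  also have "\<dots> = weight n p"
    unfolding weight_def by (intro prod.cong refl) (auto dest: E_sym)
  finally show ?thesis .
qed

lemma mass_after_reverse: "mass_after E m0 (reverse n p) n = back_mass m0 p n"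
  unfolding back_mass_def by (rule mass_after_cong) (simp add: reverse_def)

lemma back_mass_reverse: "back_mass m0 (reverse n p) n = mass_after E m0 p n"
  unfolding back_mass_def by (rule mass_after_cong) (simp add: reverse_def)

text \<open>
  In an undirected regular graph a path and its reversal have the same weight. The factor \<open>N\<close> undoes the
  probability \<open>1 / N\<close> of the start of \<open>Y\<close>.
\<close>

lemma masses_reversal:
  assumes X: "regular_walk V E D L P X" and Y: "regular_walk V E D L Q Y"
    and start: "\<And>v. v \<in> V \<Longrightarrow> measure Q {\<omega> \<in> space Q. Y 0 \<omega> = v} = 1 / N"
  shows "(\<integral>\<omega>. h (mass_after E m0 (\<lambda>i. X i \<omega>) n) \<partial>P)
    = (\<Sum>x\<in>V. measure P {\<omega> \<in> space P. X 0 \<omega> = x} * N *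
        (\<integral>\<omega>. indicator {x} (Y n \<omega>) * h (back_mass m0 (\<lambda>i. Y i \<omega>) n) \<partial>Q))"
proof -
  interpret X: regular_walk V E D L P X by (rule X)
  interpret Y: regular_walk V E D L Q Y by (rule Y)
  let ?\<mu> = "\<lambda>x. measure P {\<omega> \<in> space P. X 0 \<omega> = x}"
  have in_V: "p i \<in> V" if "p \<in> paths n" "i \<le> n" for p i
    using that by (auto simp: paths_def)
  have "(\<Sum>x\<in>V. ?\<mu> x * N * (\<integral>\<omega>. indicator {x} (Y n \<omega>) * h (back_mass m0 (\<lambda>i. Y i \<omega>) n) \<partial>Q))
     = (\<Sum>x\<in>V. \<Sum>p\<in>paths n. if x = p n then ?\<mu> x * weight n p * h (back_mass m0 p n) else 0)"
  proof (intro sum.cong refl)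
    fix x assume "x \<in> V"
    have "(\<integral>\<omega>. indicator {x} (Y n \<omega>) * h (back_mass m0 (\<lambda>i. Y i \<omega>) n) \<partial>Q)
       = (\<Sum>p\<in>paths n. measure Q (Y.follows n p) * (indicator {x} (p n) * h (back_mass m0 p n)))"
      by (rule Y.adapted_expectation, rule adapted_comp2[OF adapted_back_mass])
    also have "\<dots> = (\<Sum>p\<in>paths n. (1 / N * weight n p) * (indicator {x} (p n) * h (back_mass m0 p n)))"
      using in_V by (intro sum.cong refl) (simp add: Y.prob_follows start)
    finally show "?\<mu> x * N * (\<integral>\<omega>. indicator {x} (Y n \<omega>) * h (back_mass m0 (\<lambda>i. Y i \<omega>) n) \<partial>Q)
       = (\<Sum>p\<in>paths n. if x = p n then ?\<mu> x * weight n p * h (back_mass m0 p n) else 0)"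
      using N_pos by (auto simp: sum_distrib_left indicator_def intro!: sum.cong)
  qed
  also have "\<dots> = (\<Sum>p\<in>paths n. \<Sum>x\<in>V. if x = p n then ?\<mu> x * weight n p * h (back_mass m0 p n) else 0)"
    by (rule sum.swap)
  also have "\<dots> = (\<Sum>p\<in>paths n. ?\<mu> (p n) * weight n p * h (back_mass m0 p n))"
    using finite_V in_V by (intro sum.cong refl) simp
  also have "\<dots> = (\<Sum>p\<in>paths n. ?\<mu> (p 0) * weight n p * h (mass_after E m0 p n))"
    by (rule sum.reindex_bij_witness[of _ "reverse n" "reverse n"])
       (auto simp: reverse_in_paths reverse_reverse weight_reverse mass_after_reverse back_mass_reverse, simp_all add: reverse_def)
  also have "\<dots> = (\<Sum>p\<in>paths n. measure P (X.follows n p) * h (mass_after E m0 p n))"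
    using in_V by (intro sum.cong refl) (simp add: X.prob_follows)
  also have "\<dots> = (\<integral>\<omega>. h (mass_after E m0 (\<lambda>i. X i \<omega>) n) \<partial>P)"
    by (rule X.adapted_expectation[symmetric], rule adapted_comp[OF adapted_mass_after])
  finally show ?thesis ..
qed

text \<open>
  After reversal the quantity of interest is the mean of \<open>h\<close> of the backward masses at \<open>n\<close> over the event
  \<open>Y n = x\<close>. Replacing the backward masses at \<open>n\<close> by those at a fixed \<open>K\<close> costs little in \<open>L\<^sup>1\<close>, uniformly
  in \<open>n\<close>; after that the event decouples by \<open>visits_mean\<close>.
\<close>

lemma masses_converge:
  fixes h :: "('v \<Rightarrow> real) \<Rightarrow> real"
  assumes X: "regular_walk V E D L P X" and Y: "regular_walk V E D L Q Y"
    and start: "\<And>v. v \<in> V \<Longrightarrow> measure Q {\<omega> \<in> space Q. Y 0 \<omega> = v} = 1 / N"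
    and m0: "mass_dist m0"
    and h_meas: "(\<lambda>\<omega>. h (regular_walk.limit_mass E Y m0 \<omega>)) \<in> borel_measurable Q"
    and h_bound: "\<And>m. \<bar>h m\<bar> \<le> C"
    and h_cont: "\<And>m m'. (\<And>v. v \<in> V \<Longrightarrow> (\<lambda>n. m n v) \<longlonglongrightarrow> m' v) \<Longrightarrow> (\<lambda>n. h (m n)) \<longlonglongrightarrow> h m'"
  shows "((\<lambda>t. poisson_mean t (\<lambda>n. \<integral>\<omega>. h (mass_after E m0 (\<lambda>i. X i \<omega>) n) \<partial>P))
    \<longlongrightarrow> (\<integral>\<omega>. h (regular_walk.limit_mass E Y m0 \<omega>) \<partial>Q)) at_top"
proof -
  interpret X: regular_walk V E D L P X by (rule X)
  interpret Y: regular_walk V E D L Q Y by (rule Y)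
  let ?\<mu> = "\<lambda>x. measure P {\<omega> \<in> space P. X 0 \<omega> = x}"
  let ?B = "\<lambda>n \<omega>. h (back_mass m0 (\<lambda>i. Y i \<omega>) n)" and ?I = "\<lambda>\<omega>. h (Y.limit_mass m0 \<omega>)"
  have C0: "0 \<le> C" using h_bound[of m0] by linarith
  have adB: "adapted n (\<lambda>y. h (back_mass m0 y n))" for n
    by (rule adapted_comp[OF adapted_back_mass])
  have intB: "integrable Q (?B n)" for n
    by (rule Y.adapted_integrable[OF adB])
  have intI: "integrable Q ?I"
    by (rule Y.integrable_const_bound[OF _ h_meas, of C]) (use h_bound in auto)
  define d where "d n = Y.expectation (\<lambda>\<omega>. \<bar>?B n \<omega> - ?I \<omega>\<bar>)" for n
  have d: "d \<longlonglongrightarrow> 0"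
  proof -
    have "d \<longlonglongrightarrow> Y.expectation (\<lambda>\<omega>. 0)"
      unfolding d_def
    proof (rule integral_dominated_convergence[where w="\<lambda>_. 2 * C"])
      show "AE \<omega> in Q. (\<lambda>n. \<bar>?B n \<omega> - ?I \<omega>\<bar>) \<longlonglongrightarrow> 0"
        using Y.AE_back_mass_tendsto[OF m0]
      proof eventually_elim
        case (elim \<omega>)
        then have "(\<lambda>n. ?B n \<omega>) \<longlonglongrightarrow> ?I \<omega>" by (intro h_cont) auto
        then show ?case by (intro tendsto_rabs_zero) (simp add: LIM_zero_iff)
      qed
      show "AE \<omega> in Q. norm \<bar>?B n \<omega> - ?I \<omega>\<bar> \<le> 2 * C" for n
      proof (rule AE_I2)
        fix \<omega>
        show "norm \<bar>?B n \<omega> - ?I \<omega>\<bar> \<le> 2 * C"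
          using h_bound[of "back_mass m0 (\<lambda>i. Y i \<omega>) n"] h_bound[of "Y.limit_mass m0 \<omega>"] by simp
      qed
    qed (use borel_measurable_integrable[OF intB] h_meas in auto)
    then show ?thesis by simp
  qed
  have dC: "\<bar>d n\<bar> \<le> 2 * C" for n
  proof -
    have "\<bar>d n\<bar> \<le> Y.expectation (\<lambda>\<omega>. \<bar>\<bar>?B n \<omega> - ?I \<omega>\<bar>\<bar>)"
      unfolding d_def by (rule integral_abs_bound)
    also have "\<dots> \<le> 2 * C"
    proof (rule Y.integral_le_const)
      show "AE \<omega> in Q. \<bar>\<bar>?B n \<omega> - ?I \<omega>\<bar>\<bar> \<le> 2 * C"
      proof (rule AE_I2)
        fix \<omega>
        show "\<bar>\<bar>?B n \<omega> - ?I \<omega>\<bar>\<bar> \<le> 2 * C"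
          using h_bound[of "back_mass m0 (\<lambda>i. Y i \<omega>) n"] h_bound[of "Y.limit_mass m0 \<omega>"] by simp
      qed
    qed (use intB intI in auto)
    finally show ?thesis .
  qed
  have \<mu>_sum: "(\<Sum>x\<in>V. ?\<mu> x) = 1"
  proof -
    have "(\<Sum>x\<in>V. ?\<mu> x) = measure P (\<Union>x\<in>V. {\<omega> \<in> space P. X 0 \<omega> = x})"
      using finite_V by (intro X.finite_measure_finite_Union[symmetric]) (auto simp: disjoint_family_on_def)
    also have "(\<Union>x\<in>V. {\<omega> \<in> space P. X 0 \<omega> = x}) = space P" using X.X_in_V by auto
    finally show ?thesis by (simp add: X.prob_space)
  qed
  define a where "a n = (\<integral>\<omega>. h (mass_after E m0 (\<lambda>i. X i \<omega>) n) \<partial>P)" for n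
  define aK where "aK K n = (\<Sum>x\<in>V. ?\<mu> x * N * Y.expectation (\<lambda>\<omega>. indicator {x} (Y n \<omega>) * ?B K \<omega>))" for K n
  have a_eq: "a n = (\<Sum>x\<in>V. ?\<mu> x * N * Y.expectation (\<lambda>\<omega>. indicator {x} (Y n \<omega>) * ?B n \<omega>))" for n
    unfolding a_def by (rule masses_reversal[OF X Y start])
  have int_ind: "integrable Q (\<lambda>\<omega>. indicator {x} (Y n \<omega>) * ?B K \<omega>)" for x n K
  proof -
    have "integrable Q (\<lambda>\<omega>. ?B K \<omega> * indicator {\<omega> \<in> space Q. Y n \<omega> = x} \<omega>)"
      by (rule integrable_real_mult_indicator[OF Y.X_eq_event intB])
    also have "?this \<longleftrightarrow> ?thesis"
      by (intro Bochner_Integration.integrable_cong) (auto simp: indicator_def)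
    finally show ?thesis .
  qed
  have a_close: "\<bar>a n - aK K n\<bar> \<le> N * (d n + d K)" for n K
  proof -
    have "\<bar>a n - aK K n\<bar> = \<bar>\<Sum>x\<in>V. ?\<mu> x * N * Y.expectation (\<lambda>\<omega>. indicator {x} (Y n \<omega>) * (?B n \<omega> - ?B K \<omega>))\<bar>"
      unfolding a_eq aK_def right_diff_distrib
      using int_ind by (simp add: sum_subtractf right_diff_distrib)
    also have "\<dots> \<le> (\<Sum>x\<in>V. ?\<mu> x * N * (d n + d K))"
    proof (rule order_trans[OF sum_abs], rule sum_mono)
      fix x assume "x \<in> V"
      have "\<bar>Y.expectation (\<lambda>\<omega>. indicator {x} (Y n \<omega>) * (?B n \<omega> - ?B K \<omega>))\<bar>
         \<le> Y.expectation (\<lambda>\<omega>. \<bar>indicator {x} (Y n \<omega>) * (?B n \<omega> - ?B K \<omega>)\<bar>)"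
        by (rule integral_abs_bound)
      also have "\<dots> \<le> Y.expectation (\<lambda>\<omega>. \<bar>?B n \<omega> - ?I \<omega>\<bar> + \<bar>?B K \<omega> - ?I \<omega>\<bar>)"
        using int_ind[of x n n] int_ind[of x n K] intB intI
        by (intro integral_mono) (auto simp: right_diff_distrib indicator_def)
      also have "\<dots> = d n + d K"
        unfolding d_def using intB intI by simp
      finally show "\<bar>?\<mu> x * N * Y.expectation (\<lambda>\<omega>. indicator {x} (Y n \<omega>) * (?B n \<omega> - ?B K \<omega>))\<bar> \<le> ?\<mu> x * N * (d n + d K)"
        using N_pos by (simp add: abs_mult mult_left_mono)
    qed
    also have "\<dots> = N * (d n + d K)"
      using \<mu>_sum by (simp add: sum_distrib_right[symmetric])
    finally show ?thesis .
  qed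
  have mix: "((\<lambda>t. poisson_mean t (aK K)) \<longlongrightarrow> Y.expectation (?B K)) at_top" for K
  proof -
    have bnd: "\<bar>Y.expectation (\<lambda>\<omega>. indicator {x} (Y n \<omega>) * ?B K \<omega>)\<bar> \<le> C" for x n
    proof (rule order_trans[OF integral_abs_bound])
      show "Y.expectation (\<lambda>\<omega>. \<bar>indicator {x} (Y n \<omega>) * ?B K \<omega>\<bar>) \<le> C"
        using h_bound C0
        by (intro Y.integral_le_const integrable_abs int_ind) (auto intro!: AE_I2 simp: abs_mult indicator_def)
    qed
    have "((\<lambda>t. \<Sum>x\<in>V. ?\<mu> x * N * poisson_mean t (\<lambda>n. Y.expectation (\<lambda>\<omega>. indicator {x} (Y n \<omega>) * ?B K \<omega>)))
        \<longlongrightarrow> (\<Sum>x\<in>V. ?\<mu> x * N * (Y.expectation (?B K) / N))) at_top"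
      by (intro tendsto_sum tendsto_mult_left Y.visits_mean[OF adB, of _ C]) (use h_bound in auto)
    moreover have "(\<Sum>x\<in>V. ?\<mu> x * N * (Y.expectation (?B K) / N)) = Y.expectation (?B K)"
      using \<mu>_sum N_pos by (simp add: sum_divide_distrib[symmetric] sum_distrib_right[symmetric])
    moreover have "poisson_mean t (aK K) = (\<Sum>x\<in>V. ?\<mu> x * N * poisson_mean t (\<lambda>n. Y.expectation (\<lambda>\<omega>. indicator {x} (Y n \<omega>) * ?B K \<omega>)))" for t
      unfolding aK_def[abs_def]
      by (subst poisson_mean_sum[where C="\<lambda>x. ?\<mu> x * N * C"])
         (use bnd N_pos in \<open>auto simp: poisson_mean_scale abs_mult intro!: mult_left_mono\<close>)
    ultimately show ?thesis by simp
  qed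
  show ?thesis unfolding a_def[symmetric]
  proof (rule tendstoI)
    fix e :: real assume e: "0 < e"
    define \<epsilon> where "\<epsilon> = e / (4 * (N + 1))"
    have \<epsilon>: "0 < \<epsilon>" "N * \<epsilon> \<le> e / 4" "\<epsilon> \<le> e / 4" using e N_pos by (auto simp: \<epsilon>_def field_simps)
    have "\<forall>\<^sub>F K in sequentially. d K < \<epsilon>" using d \<epsilon>(1) by (rule order_tendstoD)
    then obtain K where K: "d K < \<epsilon>" by (auto simp: eventually_sequentially)
    have dK: "\<bar>Y.expectation (?B K) - Y.expectation ?I\<bar> \<le> d K"
    proof -
      have "\<bar>Y.expectation (\<lambda>\<omega>. ?B K \<omega> - ?I \<omega>)\<bar> \<le> d K"
        unfolding d_def by (rule integral_abs_bound)
      then show ?thesis using intB intI by simp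
    qed
    have aC: "\<bar>a n\<bar> \<le> C" for n
    proof -
      have "\<bar>a n\<bar> \<le> X.expectation (\<lambda>\<omega>. \<bar>h (mass_after E m0 (\<lambda>i. X i \<omega>) n)\<bar>)"
        unfolding a_def by (rule integral_abs_bound)
      also have "\<dots> \<le> C"
        using X.adapted_integrable[OF adapted_comp[OF adapted_mass_after, of n h E m0]] h_bound
        by (intro X.integral_le_const) auto
      finally show ?thesis .
    qed
    have aKC: "\<bar>aK K n\<bar> \<le> C + N * (4 * C)" for n
    proof -
      have "\<bar>aK K n\<bar> \<le> \<bar>a n\<bar> + \<bar>a n - aK K n\<bar>" by linarith
      also have "\<dots> \<le> C + N * (d n + d K)" using aC[of n] a_close[of n K] by linarith
      also have "\<dots> \<le> C + N * (4 * C)"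
        using dC[of n] dC[of K] N_pos by (intro add_left_mono mult_left_mono) auto
      finally show ?thesis .
    qed
    have "\<forall>\<^sub>F t in at_top. dist (poisson_mean t (aK K)) (Y.expectation (?B K)) < e / 4"
      using mix[of K] e by (auto dest: tendstoD[of _ _ _ "e/4"])
    moreover have "\<forall>\<^sub>F t in at_top. dist (poisson_mean t d) 0 < \<epsilon>"
      using poisson_null_of_tendsto_0[OF d] \<epsilon>(1) unfolding poisson_null_def by (auto dest: tendstoD)
    ultimately show "\<forall>\<^sub>F t in at_top. dist (poisson_mean t a) (Y.expectation ?I) < e"
    proof eventually_elim
      case (elim t)
      have "\<bar>poisson_mean t a - poisson_mean t (aK K)\<bar> = \<bar>poisson_mean t (\<lambda>n. a n - aK K n)\<bar>"
        using poisson_mean_diff[of a C "aK K" "C + N * (4 * C)" t] aC aKC by simp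
      also have "\<dots> \<le> poisson_mean t (\<lambda>n. N * (d n + d K))"
      proof (rule abs_leI)
        have b1: "\<bar>a n - aK K n\<bar> \<le> C + (C + N * (4 * C))" for n
          using aC[of n] aKC[of n] by linarith
        have b2: "\<bar>N * (d n + d K)\<bar> \<le> N * (4 * C)" for n
          using dC[of n] dC[of K] N_pos by (simp add: abs_mult)
        show "poisson_mean t (\<lambda>n. a n - aK K n) \<le> poisson_mean t (\<lambda>n. N * (d n + d K))"
          using a_close abs_le_D1 by (intro poisson_mean_mono[OF b1 b2]) blast
        have "poisson_mean t (\<lambda>n. (-1) * (a n - aK K n)) \<le> poisson_mean t (\<lambda>n. N * (d n + d K))"
        proof (rule poisson_mean_mono[OF _ b2])
          show "\<bar>(-1) * (a n - aK K n)\<bar> \<le> C + (C + N * (4 * C))" for n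
            using b1[of n] by (simp add: abs_minus_commute)
          show "(-1) * (a n - aK K n) \<le> N * (d n + d K)" for n
            using abs_le_D2[OF a_close[of n K]] by simp
        qed
        then show "- poisson_mean t (\<lambda>n. a n - aK K n) \<le> poisson_mean t (\<lambda>n. N * (d n + d K))"
          unfolding poisson_mean_scale by simp
      qed
      also have "\<dots> = N * (poisson_mean t d + d K)"
        unfolding poisson_mean_scale using poisson_mean_add[of d "2*C" "\<lambda>_. d K" "\<bar>d K\<bar>" t] dC by simp
      also have "\<dots> \<le> N * (\<epsilon> + \<epsilon>)"
        using elim(2) K N_pos by (intro mult_left_mono) (auto simp: dist_real_def)
      also have "\<dots> \<le> e / 2" using \<epsilon>(2) by (simp add: algebra_simps)
      finally show ?case
        using elim(1) dK K \<epsilon>(3) unfolding dist_real_def by linarith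
    qed
  qed
qed

end

section \<open>Drift identities for the masses and the position\<close>

context regular_walk
begin

context
  fixes m0 :: "'v \<Rightarrow> real"
  assumes m0: "mass_dist m0"
begin

abbreviation mass :: "nat \<Rightarrow> 'w \<Rightarrow> 'v \<Rightarrow> real" where
  "mass k \<omega> \<equiv> mass_after E m0 (trajectory \<omega>) k"

definition state_mean :: "(('v \<Rightarrow> real) \<Rightarrow> 'v \<Rightarrow> real) \<Rightarrow> nat \<Rightarrow> real" where
  "state_mean \<Psi> k = expectation (\<lambda>\<omega>. \<Psi> (mass k \<omega>) (X k \<omega>))"

text \<open>
  The Poisson average of the mean after \<open>k\<close> jumps: for the continuous-time process this is the mean at
  time \<open>t\<close>.
\<close>

definition time_mean :: "(('v \<Rightarrow> real) \<Rightarrow> 'v \<Rightarrow> real) \<Rightarrow> real \<Rightarrow> real" where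
  "time_mean \<Psi> t = poisson_mean t (state_mean \<Psi>)"

definition state_bounded :: "(('v \<Rightarrow> real) \<Rightarrow> 'v \<Rightarrow> real) \<Rightarrow> bool" where
  "state_bounded \<Psi> \<longleftrightarrow> (\<exists>C. \<forall>m b. mass_dist m \<longrightarrow> b \<in> V \<longrightarrow> \<bar>\<Psi> m b\<bar> \<le> C)"

lemma state_boundedI: "(\<And>m b. mass_dist m \<Longrightarrow> b \<in> V \<Longrightarrow> \<bar>\<Psi> m b\<bar> \<le> C) \<Longrightarrow> state_bounded \<Psi>"
  by (auto simp: state_bounded_def)

lemma state_boundedE:
  assumes "state_bounded \<Psi>"
  obtains C where "\<And>m b. mass_dist m \<Longrightarrow> b \<in> V \<Longrightarrow> \<bar>\<Psi> m b\<bar> \<le> C"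
  using assms unfolding state_bounded_def by blast

lemma state_bounded_const: "state_bounded (\<lambda>m b. c)"
  by (rule state_boundedI[of _ "\<bar>c\<bar>"]) simp

lemma state_bounded_fun: "state_bounded (\<lambda>m b. c b)"
  using finite_V by (intro state_boundedI[of _ "\<Sum>b\<in>V. \<bar>c b\<bar>"] member_le_sum) auto

lemma state_bounded_add: "state_bounded \<Phi> \<Longrightarrow> state_bounded \<Psi> \<Longrightarrow> state_bounded (\<lambda>m b. \<Phi> m b + \<Psi> m b)"
  unfolding state_bounded_def by (meson abs_triangle_ineq add_mono order_trans)

lemma state_bounded_uminus: "state_bounded \<Psi> \<Longrightarrow> state_bounded (\<lambda>m b. - \<Psi> m b)"
  unfolding state_bounded_def by simp

lemma state_bounded_diff: "state_bounded \<Phi> \<Longrightarrow> state_bounded \<Psi> \<Longrightarrow> state_bounded (\<lambda>m b. \<Phi> m b - \<Psi> m b)"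
  using state_bounded_add[OF _ state_bounded_uminus, of \<Phi> \<Psi>] by simp

lemma state_bounded_mult:
  assumes "state_bounded \<Phi>" "state_bounded \<Psi>"
  shows "state_bounded (\<lambda>m b. \<Phi> m b * \<Psi> m b)"
proof -
  obtain C where C: "\<And>m b. mass_dist m \<Longrightarrow> b \<in> V \<Longrightarrow> \<bar>\<Phi> m b\<bar> \<le> C"
    using state_boundedE[OF assms(1)] by blast
  obtain C' where C': "\<And>m b. mass_dist m \<Longrightarrow> b \<in> V \<Longrightarrow> \<bar>\<Psi> m b\<bar> \<le> C'"
    using state_boundedE[OF assms(2)] by blast
  show ?thesis
  proof (rule state_boundedI)
    fix m b assume mb: "mass_dist m" "b \<in> V"
    have "0 \<le> C" using C[OF mb] by linarith
    then show "\<bar>\<Phi> m b * \<Psi> m b\<bar> \<le> C * C'"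
      using mult_mono[OF C[OF mb] C'[OF mb]] by (simp add: abs_mult)
  qed
qed

lemma state_bounded_next:
  assumes "state_bounded \<Psi>"
  shows "state_bounded (\<lambda>m b. avg (\<Psi> m) b)"
proof -
  obtain C where C: "\<And>m b. mass_dist m \<Longrightarrow> b \<in> V \<Longrightarrow> \<bar>\<Psi> m b\<bar> \<le> C"
    using state_boundedE[OF assms] by blast
  then show ?thesis by (intro state_boundedI[of _ C] abs_avg_le) (auto dest: E_in_V')
qed

lemma state_bounded_mass: "state_bounded (\<lambda>m b. m b)"
  by (rule state_boundedI[of _ 1]) (auto intro: mass_dist_le_1 simp: mass_dist_def)

lemma state_bounded_integral: "state_bounded (\<lambda>m b. \<Sum>x\<in>V. g b x * m x)"
proof (rule state_boundedI)
  fix m b assume mb: "mass_dist m" "b \<in> V"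
  show "\<bar>\<Sum>x\<in>V. g b x * m x\<bar> \<le> (\<Sum>b\<in>V. \<Sum>x\<in>V. \<bar>g b x\<bar>)"
  proof (rule mass_dist_integral_abs_le[OF mb(1)])
    fix x assume x: "x \<in> V"
    have "\<bar>g b x\<bar> \<le> (\<Sum>x\<in>V. \<bar>g b x\<bar>)" using finite_V x by (intro member_le_sum) auto
    also have "\<dots> \<le> (\<Sum>b\<in>V. \<Sum>x\<in>V. \<bar>g b x\<bar>)"
      using finite_V mb(2) by (intro member_le_sum[of b V "\<lambda>b. \<Sum>x\<in>V. \<bar>g b x\<bar>"]) (auto intro: sum_nonneg)
    finally show "\<bar>g b x\<bar> \<le> (\<Sum>b\<in>V. \<Sum>x\<in>V. \<bar>g b x\<bar>)" .
  qed
qed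

lemmas state_bounded_intros = state_bounded_const state_bounded_fun state_bounded_add state_bounded_uminus
  state_bounded_diff state_bounded_mult state_bounded_mass state_bounded_integral

lemma mass_state: "\<omega> \<in> space P \<Longrightarrow> mass_dist (mass k \<omega>)"
  by (rule mass_dist_mass_after[OF m0]) (rule X_in_V)

lemma state_integrable:
  fixes \<Psi> :: "('v \<Rightarrow> real) \<Rightarrow> 'v \<Rightarrow> real"
  shows "integrable P (\<lambda>\<omega>. \<Psi> (mass k \<omega>) (X k \<omega>))"
  by (rule adapted_integrable[OF adapted_comp2[where h=\<Psi>, OF adapted_mass_after]])

lemma state_mean_bounded:
  assumes "state_bounded \<Psi>"
  obtains C where "\<And>k. \<bar>state_mean \<Psi> k\<bar> \<le> C"
proof -
  obtain C where C: "\<And>m b. mass_dist m \<Longrightarrow> b \<in> V \<Longrightarrow> \<bar>\<Psi> m b\<bar> \<le> C"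
    using state_boundedE[OF assms] by blast
  have "\<bar>state_mean \<Psi> k\<bar> \<le> C" for k
    unfolding state_mean_def
  proof (rule order_trans[OF integral_abs_bound])
    show "expectation (\<lambda>\<omega>. \<bar>\<Psi> (mass k \<omega>) (X k \<omega>)\<bar>) \<le> C"
      by (intro integral_le_const integrable_abs state_integrable AE_I2 C mass_state X_in_V)
  qed
  then show ?thesis using that by blast
qed

lemma state_mean_add: "state_mean (\<lambda>m b. \<Phi> m b + \<Psi> m b) k = state_mean \<Phi> k + state_mean \<Psi> k"
  unfolding state_mean_def by (rule Bochner_Integration.integral_add) (rule state_integrable)+

lemma state_mean_scale: "state_mean (\<lambda>m b. c * \<Psi> m b) k = c * state_mean \<Psi> k"
  unfolding state_mean_def by simp

lemma time_mean_add:
  assumes "state_bounded \<Phi>" "state_bounded \<Psi>"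
  shows "time_mean (\<lambda>m b. \<Phi> m b + \<Psi> m b) t = time_mean \<Phi> t + time_mean \<Psi> t"
proof -
  obtain C C' where "\<And>k. \<bar>state_mean \<Phi> k\<bar> \<le> C" "\<And>k. \<bar>state_mean \<Psi> k\<bar> \<le> C'"
    using state_mean_bounded assms by metis
  then show ?thesis
    unfolding time_mean_def state_mean_add[abs_def] by (rule poisson_mean_add)
qed

lemma time_mean_scale: "time_mean (\<lambda>m b. c * \<Psi> m b) t = c * time_mean \<Psi> t"
  unfolding time_mean_def state_mean_scale[abs_def] by (rule poisson_mean_scale)

lemma time_mean_const: "time_mean (\<lambda>m b. c) t = c"
  unfolding time_mean_def state_mean_def by (simp add: prob_space)

lemma time_mean_sum:
  assumes "finite I" "\<And>i. i \<in> I \<Longrightarrow> state_bounded (\<Psi> i)"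
  shows "time_mean (\<lambda>m b. \<Sum>i\<in>I. \<Psi> i m b) t = (\<Sum>i\<in>I. time_mean (\<Psi> i) t)"
    and "state_bounded (\<lambda>m b. \<Sum>i\<in>I. \<Psi> i m b)"
proof -
  have "time_mean (\<lambda>m b. \<Sum>i\<in>I. \<Psi> i m b) t = (\<Sum>i\<in>I. time_mean (\<Psi> i) t)
      \<and> state_bounded (\<lambda>m b. \<Sum>i\<in>I. \<Psi> i m b)"
    using assms by (induction I rule: finite_induct)
      (auto simp: time_mean_const time_mean_add intro: state_bounded_intros)
  then show "time_mean (\<lambda>m b. \<Sum>i\<in>I. \<Psi> i m b) t = (\<Sum>i\<in>I. time_mean (\<Psi> i) t)"
    and "state_bounded (\<lambda>m b. \<Sum>i\<in>I. \<Psi> i m b)" by auto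
qed

lemma state_mean_mono:
  assumes "\<And>m b. mass_dist m \<Longrightarrow> b \<in> V \<Longrightarrow> \<Phi> m b \<le> \<Psi> m b"
  shows "state_mean \<Phi> k \<le> state_mean \<Psi> k"
  unfolding state_mean_def by (intro integral_mono state_integrable assms mass_state X_in_V)

lemma time_mean_mono:
  assumes "state_bounded \<Phi>" "state_bounded \<Psi>" "\<And>m b. mass_dist m \<Longrightarrow> b \<in> V \<Longrightarrow> \<Phi> m b \<le> \<Psi> m b"
  shows "time_mean \<Phi> t \<le> time_mean \<Psi> t"
proof -
  obtain C C' where "\<And>k. \<bar>state_mean \<Phi> k\<bar> \<le> C" "\<And>k. \<bar>state_mean \<Psi> k\<bar> \<le> C'"
    using state_mean_bounded assms by metis
  then show ?thesis
    unfolding time_mean_def by (rule poisson_mean_mono) (rule state_mean_mono[OF assms(3)])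
qed

text \<open>
  The mean change of \<open>\<Phi>\<close> at the next jump, for masses \<open>m\<close> and position \<open>b\<close>.
\<close>

definition drift :: "(('v \<Rightarrow> real) \<Rightarrow> 'v \<Rightarrow> real) \<Rightarrow> ('v \<Rightarrow> real) \<Rightarrow> 'v \<Rightarrow> real" where
  "drift \<Phi> m b = avg (\<lambda>y. \<Phi> (spread E y m) y) b - \<Phi> m b"

lemma state_mean_drift: "state_mean (drift \<Phi>) k = state_mean \<Phi> (Suc k) - state_mean \<Phi> k"
proof -
  have "state_mean \<Phi> (Suc k) = expectation (\<lambda>\<omega>. (\<lambda>x y. \<Phi> (spread E y (mass_after E m0 x k)) y) (trajectory \<omega>) (X (Suc k) \<omega>))"
    by (simp add: state_mean_def)
  also have "\<dots> = expectation (\<lambda>\<omega>. avg (\<lambda>y. \<Phi> (spread E y (mass k \<omega>)) y) (X k \<omega>))"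
    by (rule markov) (rule adapted_comp[OF adapted_mass_after])
  finally show ?thesis
    unfolding state_mean_def[of "drift \<Phi>"] drift_def
    using state_integrable[of "\<lambda>m b. avg (\<lambda>y. \<Phi> (spread E y m) y) b" k] state_integrable[of \<Phi> k]
    by (simp add: state_mean_def)
qed

text \<open>
  The drift is the increment in \<open>k\<close> of the mean of \<open>\<Phi>\<close> after \<open>k\<close> jumps, to which shift invariance applies.
  After the first jump the earthworm sits on a vertex that it has just emptied, so states with \<open>m b = 0\<close>
  suffice.
\<close>

lemma time_mean_drift:
  assumes "state_bounded \<Phi>"
    and eq: "\<And>m b. mass_dist m \<Longrightarrow> b \<in> V \<Longrightarrow> m b = 0 \<Longrightarrow> \<Psi> m b = drift \<Phi> m b"
  shows "(time_mean \<Psi> \<longlongrightarrow> 0) at_top"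
proof -
  obtain C where C: "\<And>k. \<bar>state_mean \<Phi> k\<bar> \<le> C" using state_mean_bounded assms(1) by metis
  have "poisson_null (state_mean \<Psi>)"
  proof (rule poisson_null_cong)
    show "poisson_null (\<lambda>k. state_mean \<Phi> (Suc k) - state_mean \<Phi> k)"
      by (rule poisson_null_shift[OF C])
    show "\<bar>state_mean \<Phi> (Suc k) - state_mean \<Phi> k\<bar> \<le> 2 * C" for k
      using C[of k] C[of "Suc k"] by linarith
    show "state_mean \<Psi> k = state_mean \<Phi> (Suc k) - state_mean \<Phi> k" if k: "k \<ge> 1" for k
    proof -
      have "mass k \<omega> (X k \<omega>) = 0" for \<omega>
        using k by (cases k) (auto simp: spread_def)
      then have "state_mean \<Psi> k = state_mean (drift \<Phi>) k"
        unfolding state_mean_def by (intro Bochner_Integration.integral_cong refl eq mass_state X_in_V)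
      then show ?thesis by (simp add: state_mean_drift)
    qed
  qed
  then show ?thesis by (simp add: poisson_null_def time_mean_def[abs_def])
qed

text \<open>
  The mean of \<open>H\<close> at the next position, weighted by the mass found there.
\<close>

definition hit_mean :: "('v \<Rightarrow> real) \<Rightarrow> ('v \<Rightarrow> real) \<Rightarrow> 'v \<Rightarrow> real" where
  "hit_mean H m b = avg (\<lambda>y. m y * H y) b"

lemma state_bounded_hit_mean: "state_bounded (hit_mean H)"
  unfolding hit_mean_def[abs_def] by (intro state_bounded_next[of "\<lambda>m y. m y * H y"] state_bounded_intros)

text \<open>
  The equation of the Green function in its first argument; it is what makes the drift of an integral
  against \<open>green b\<close> computable.
\<close>

lemma avg_integral_green:
  assumes b: "b \<in> V"
  shows "avg (\<lambda>y. \<Sum>x\<in>V. (g x * green y x) * m x) b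
    = (\<Sum>x\<in>V. (g x * green b x) * m x) + (\<Sum>x\<in>V. g x * m x) / N - g b * m b"
proof -
  have "avg (\<lambda>y. \<Sum>x\<in>V. (g x * green y x) * m x) b = (\<Sum>x\<in>V. avg (\<lambda>y. (g x * m x) * green x y) b)"
    unfolding avg_sum by (intro sum.cong refl avg_cong) (simp add: green_sym E_in_V')
  also have "\<dots> = (\<Sum>x\<in>V. (g x * green b x) * m x + g x * m x / N - (if x = b then g b * m b else 0))"
    unfolding avg_scale using b by (intro sum.cong refl) (simp add: avg_green green_sym[OF b] algebra_simps)
  also have "\<dots> = (\<Sum>x\<in>V. (g x * green b x) * m x) + (\<Sum>x\<in>V. g x * m x) / N - g b * m b"
    using b finite_V by (simp add: sum_subtractf sum.distrib sum_divide_distrib)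
  finally show ?thesis .
qed

text \<open>
  The effect on the integral of \<open>g \<cdot> green y\<close> of redistributing a unit mass at \<open>y\<close>.
\<close>

definition green_commutator :: "('v \<Rightarrow> real) \<Rightarrow> 'v \<Rightarrow> real" where
  "green_commutator g y = avg (\<lambda>x. g x * green y x) y - g y * green y y"

lemma drift_integral:
  assumes "b \<in> V"
  shows "drift (\<lambda>m b. \<Sum>x\<in>V. g x * m x) m b = hit_mean (\<lambda>y. avg g y - g y) m b"
proof -
  have "avg (\<lambda>y. \<Sum>x\<in>V. g x * spread E y m x) b
      = avg (\<lambda>y. (\<Sum>x\<in>V. g x * m x) + m y * (avg g y - g y)) b"
    by (rule avg_cong) (simp add: sum_spread E_in_V')
  then show ?thesis by (simp add: drift_def hit_mean_def avg_add avg_const[OF assms])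
qed

lemma drift_green_integral:
  assumes b: "b \<in> V"
  shows "drift (\<lambda>m b. \<Sum>x\<in>V. (g x * green b x) * m x) m b
    = (\<Sum>x\<in>V. g x * m x) / N - g b * m b + hit_mean (green_commutator g) m b"
proof -
  have "avg (\<lambda>y. \<Sum>x\<in>V. (g x * green y x) * spread E y m x) b
      = avg (\<lambda>y. (\<Sum>x\<in>V. (g x * green y x) * m x) + m y * green_commutator g y) b"
    by (rule avg_cong) (simp add: sum_spread E_in_V' green_commutator_def)
  then show ?thesis by (simp add: drift_def hit_mean_def avg_add avg_integral_green[OF b])
qed

text \<open>
  The drift of the integral of \<open>- green y\<close>.
\<close>

lemma time_mean_hit_point:
  assumes y: "y \<in> V"
  shows "((\<lambda>t. time_mean (hit_mean (\<lambda>x. if x = y then 1 else 0)) t - time_mean (hit_mean (\<lambda>x. 1)) t / N) \<longlongrightarrow> 0) at_top"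
proof -
  let ?d = "\<lambda>x. if x = y then 1 else 0 :: real"
  let ?\<Psi> = "\<lambda>m b. hit_mean ?d m b + (- 1 / N) * hit_mean (\<lambda>x. 1) m b"
  have "(time_mean ?\<Psi> \<longlongrightarrow> 0) at_top"
  proof (rule time_mean_drift)
    show "state_bounded (\<lambda>m b. \<Sum>x\<in>V. (- green y x) * m x)"
      by (rule state_bounded_integral)
    fix m b assume mb: "mass_dist m" "b \<in> V" "m b = 0"
    have "drift (\<lambda>m b. \<Sum>x\<in>V. (- green y x) * m x) m b = hit_mean (\<lambda>x. avg (\<lambda>x. - green y x) x - - green y x) m b"
      by (rule drift_integral[OF mb(2)])
    also have "\<dots> = avg (\<lambda>x. m x * ?d x + (- 1 / N) * (m x * 1)) b"
      unfolding hit_mean_def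
    proof (rule avg_cong)
      fix x assume "E b x"
      then have a: "avg (\<lambda>x. - green y x) x = - (green y x + 1 / N - ?d x)"
        using avg_scale[of "-1" "green y" x] avg_green[OF y E_in_V', of b x] by simp
      then show "m x * (avg (\<lambda>x. - green y x) x - - green y x) = m x * ?d x + (- 1 / N) * (m x * 1)"
        unfolding a by (simp add: algebra_simps)
    qed
    finally show "?\<Psi> m b = drift (\<lambda>m b. \<Sum>x\<in>V. (- green y x) * m x) m b"
      unfolding avg_add avg_scale hit_mean_def by simp
  qed
  moreover have "time_mean ?\<Psi> = (\<lambda>t. time_mean (hit_mean ?d) t + (- 1 / N) * time_mean (hit_mean (\<lambda>x. 1)) t)"
    unfolding time_mean_scale[symmetric]
    by (intro ext time_mean_add state_bounded_hit_mean state_bounded_intros)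
  ultimately have "((\<lambda>t. time_mean (hit_mean ?d) t + (- 1 / N) * time_mean (hit_mean (\<lambda>x. 1)) t) \<longlongrightarrow> 0) at_top"
    by (simp only:)
  then show ?thesis by simp
qed

text \<open>
  The total intensity comes from the drift of the integral of \<open>green b\<close>, which involves the conserved
  total mass 1; by the previous lemma it is spread evenly over the vertices.
\<close>

lemma time_mean_hit:
  assumes N: "2 \<le> N"
  shows "(time_mean (hit_mean H) \<longlongrightarrow> (\<Sum>y\<in>V. H y) / (N * (N - 1))) at_top"
proof -
  let ?one = "hit_mean (\<lambda>x. 1)"
  have gc: "green_commutator (\<lambda>x. 1) y = 1 / N - 1" if "y \<in> V" for y
    using avg_green[OF that that] by (simp add: green_commutator_def)
  let ?\<Psi> = "\<lambda>m b. 1 / N + (1 / N - 1) * ?one m b"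
  have "(time_mean ?\<Psi> \<longlongrightarrow> 0) at_top"
  proof (rule time_mean_drift)
    show "state_bounded (\<lambda>m b. \<Sum>x\<in>V. (1 * green b x) * m x)"
      by (rule state_bounded_integral)
    fix m b assume mb: "mass_dist m" "b \<in> V" "m b = 0"
    have "hit_mean (green_commutator (\<lambda>x. 1)) m b = avg (\<lambda>y. (1 / N - 1) * (m y * 1)) b"
      unfolding hit_mean_def by (rule avg_cong) (simp add: gc E_in_V')
    then have "hit_mean (green_commutator (\<lambda>x. 1)) m b = (1 / N - 1) * ?one m b"
      by (simp only: avg_scale hit_mean_def)
    then show "?\<Psi> m b = drift (\<lambda>m b. \<Sum>x\<in>V. (1 * green b x) * m x) m b"
      using mb by (simp only: drift_green_integral) (simp add: mass_dist_def)
  qed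
  moreover have "time_mean ?\<Psi> = (\<lambda>t. 1 / N + (1 / N - 1) * time_mean ?one t)"
    using time_mean_add[OF state_bounded_const state_bounded_mult[OF state_bounded_const state_bounded_hit_mean]]
    by (intro ext) (simp add: time_mean_const time_mean_scale)
  ultimately have "((\<lambda>t. 1 / N + (1 / N - 1) * time_mean ?one t) \<longlongrightarrow> 0) at_top" by (simp only:)
  then have "((\<lambda>t. ((1 / N + (1 / N - 1) * time_mean ?one t) - 1 / N) / (1 / N - 1)) \<longlongrightarrow> (0 - 1 / N) / (1 / N - 1)) at_top"
    using N by (intro tendsto_intros) auto
  moreover have "(0 - 1 / N) / (1 / N - 1) = 1 / (N - 1)" using N by (simp add: field_simps)
  moreover have "((1 / N + (1 / N - 1) * z) - 1 / N) / (1 / N - 1) = z" for z using N by simp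
  ultimately have one: "(time_mean ?one \<longlongrightarrow> 1 / (N - 1)) at_top" by simp
  let ?d = "\<lambda>y x. if x = y then 1 else 0 :: real"
  have "((\<lambda>t. \<Sum>y\<in>V. H y * ((time_mean (hit_mean (?d y)) t - time_mean ?one t / N) + time_mean ?one t / N))
      \<longlongrightarrow> (\<Sum>y\<in>V. H y * (0 + (1 / (N - 1)) / N))) at_top"
    using N_pos by (intro tendsto_intros one time_mean_hit_point) auto
  moreover have "(\<Sum>y\<in>V. H y * ((time_mean (hit_mean (?d y)) t - time_mean ?one t / N) + time_mean ?one t / N))
      = time_mean (hit_mean H) t" for t
  proof -
    have "time_mean (hit_mean H) t = time_mean (\<lambda>m b. \<Sum>y\<in>V. H y * hit_mean (?d y) m b) t"
    proof -
      have "hit_mean H m b = (\<Sum>y\<in>V. H y * hit_mean (?d y) m b)" for m b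
      proof -
        have "hit_mean H m b = avg (\<lambda>x. \<Sum>y\<in>V. H y * (m x * ?d y x)) b"
          unfolding hit_mean_def
        proof (rule avg_cong)
          fix x assume "E b x"
          then have "x \<in> V" by (rule E_in_V')
          have "(\<Sum>y\<in>V. H y * (m x * ?d y x)) = (\<Sum>y\<in>V. if y = x then H x * m x else 0)"
            by (intro sum.cong) auto
          then show "m x * H x = (\<Sum>y\<in>V. H y * (m x * ?d y x))"
            using finite_V \<open>x \<in> V\<close> by simp
        qed
        then show ?thesis by (simp only: avg_sum avg_scale hit_mean_def)
      qed
      then have "hit_mean H = (\<lambda>m b. \<Sum>y\<in>V. H y * hit_mean (?d y) m b)" by (intro ext)
      then show ?thesis by (rule arg_cong)
    qed
    also have "\<dots> = (\<Sum>y\<in>V. H y * time_mean (hit_mean (?d y)) t)"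
      unfolding time_mean_scale[symmetric]
      by (intro time_mean_sum finite_V state_bounded_hit_mean state_bounded_intros)
    finally show ?thesis by simp
  qed
  ultimately show ?thesis by (simp add: sum_divide_distrib mult.commute)
qed

text \<open>
  The drift of the integral of \<open>g \<cdot> green b\<close> expresses the mean integral of \<open>g\<close> by the redistributed mass,
  whose spatial distribution is uniform.
\<close>

lemma time_mean_integral:
  assumes N: "2 \<le> N"
  shows "(time_mean (\<lambda>m b. \<Sum>x\<in>V. g x * m x) \<longlongrightarrow> (\<Sum>x\<in>V. g x) / N) at_top"
proof -
  let ?I = "\<lambda>m (b::'v). \<Sum>x\<in>V. g x * m x"
  let ?\<Psi> = "\<lambda>m b. (1 / N) * ?I m b + hit_mean (green_commutator g) m b"
  have "(time_mean ?\<Psi> \<longlongrightarrow> 0) at_top"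
  proof (rule time_mean_drift)
    show "state_bounded (\<lambda>m b. \<Sum>x\<in>V. (g x * green b x) * m x)"
      by (rule state_bounded_integral)
    fix m b assume mb: "mass_dist m" "b \<in> V" "m b = 0"
    then show "?\<Psi> m b = drift (\<lambda>m b. \<Sum>x\<in>V. (g x * green b x) * m x) m b"
      by (simp only: drift_green_integral) simp
  qed
  moreover have "time_mean ?\<Psi> = (\<lambda>t. (1 / N) * time_mean ?I t + time_mean (hit_mean (green_commutator g)) t)"
    unfolding time_mean_scale[symmetric]
    by (intro ext time_mean_add state_bounded_hit_mean state_bounded_intros)
  ultimately have null: "((\<lambda>t. (1 / N) * time_mean ?I t + time_mean (hit_mean (green_commutator g)) t) \<longlongrightarrow> 0) at_top"
    by (simp only:)
  have "((\<lambda>t. N * (((1 / N) * time_mean ?I t + time_mean (hit_mean (green_commutator g)) t)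
        - time_mean (hit_mean (green_commutator g)) t))
      \<longlongrightarrow> N * (0 - (\<Sum>y\<in>V. green_commutator g y) / (N * (N - 1)))) at_top"
    by (intro tendsto_mult_left tendsto_diff null time_mean_hit N)
  moreover have "(\<Sum>y\<in>V. green_commutator g y) = (1 / N - 1) * (\<Sum>x\<in>V. g x)"
  proof -
    have "(\<Sum>y\<in>V. avg (\<lambda>x. g x * green y x) y) = (\<Sum>y\<in>V. \<Sum>x\<in>V. (if E y x then g x * green y x else 0) / real D)"
      unfolding avg_altdef sum_divide_distrib ..
    also have "\<dots> = (\<Sum>x\<in>V. \<Sum>y\<in>V. (if E y x then g x * green y x else 0) / real D)"
      by (rule sum.swap)
    also have "\<dots> = (\<Sum>x\<in>V. g x * avg (green x) x)"
      unfolding avg_altdef sum_divide_distrib sum_distrib_left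
      by (intro sum.cong refl) (auto simp: green_sym dest: E_sym)
    finally have "(\<Sum>y\<in>V. green_commutator g y) = (\<Sum>x\<in>V. g x * avg (green x) x - g x * green x x)"
      by (simp add: green_commutator_def sum_subtractf)
    also have "\<dots> = (\<Sum>x\<in>V. (1 / N - 1) * g x)"
      by (intro sum.cong refl) (simp add: avg_green algebra_simps)
    finally show ?thesis by (simp add: sum_distrib_left)
  qed
  moreover have "N * (0 - (1 / N - 1) * z / (N * (N - 1))) = z / N" for z
    using N by (simp add: field_simps)
  ultimately show ?thesis using N_pos by simp
qed

text \<open>
  Let \<open>I\<close> be the integral of \<open>f\<close>. Up to small terms the drift of \<open>I\<close> times the integral of \<open>f \<cdot> green b\<close> is
  \<open>I\<^sup>2 / N\<close> minus the mean of \<open>I \<cdot> m y \<cdot> f y\<close> at the next position \<open>y\<close>, because \<open>green_commutator f\<close> is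
  close to \<open>(1 / N - 1) f\<close>. The drift of \<open>I\<^sup>2\<close> is \<open>- 2 \<lambda>\<close> times this mixed term plus a
  non-negative term of order \<open>\<lambda>\<^sup>2\<close>. A multiple of it removes the mixed term, which has no sign, at the cost of
  \<open>\<lambda> / 2\<close>. All remaining terms carry the factor \<open>m y\<close>, whose mean is about \<open>1 / N\<close>.
\<close>

lemma time_mean_square_eigenfunction:
  assumes N: "2 \<le> N" and f: "\<And>v. v \<in> V \<Longrightarrow> avg f v = (1 - lam) * f v" and lam: "0 < lam"
    and f1: "\<And>v. v \<in> V \<Longrightarrow> \<bar>f v\<bar> \<le> 1" and \<eta>: "\<And>u v. E u v \<Longrightarrow> \<bar>f u - f v\<bar> \<le> \<eta>"
    and A: "\<And>u v. u \<in> V \<Longrightarrow> v \<in> V \<Longrightarrow> \<bar>green u v\<bar> \<le> A" and e: "0 < e"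
  defines "\<kappa> \<equiv> (\<eta> + A * lam) + lam / 2 + lam * (A + (1 + \<eta> + A * lam))"
  shows "\<forall>\<^sub>F t in at_top. time_mean (\<lambda>m b. (\<Sum>x\<in>V. f x * m x)\<^sup>2) t \<le> 2 * \<kappa> + e"
proof -
  let ?I = "\<lambda>m. \<Sum>x\<in>V. f x * m x"
  let ?J = "\<lambda>y m. \<Sum>x\<in>V. (f x * green y x) * m x"
  let ?H = "green_commutator f"
  obtain v0 where v0: "v0 \<in> V" using V_nonempty by blast
  obtain u0 where u0: "E v0 u0" using exists_nbr[OF v0] by blast
  have \<eta>0: "0 \<le> \<eta>" using \<eta>[OF u0] by linarith
  have A0: "0 \<le> A" using A[OF v0 v0] by linarith
  define c where "c = 1 - 1 / N"
  have c: "0 \<le> c" "c \<le> 1" using N by (auto simp: c_def)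
  define r where "r y = ?H y + c * f y" for y
  \<comment> \<open>The differences \<open>green y y - green y x\<close> are non-negative with average below 1, so the increments of \<open>f\<close> enter without the factor \<open>A\<close>.\<close>
  have r: "\<bar>r y\<bar> \<le> \<eta> + A * lam" if y: "y \<in> V" for y
  proof -
    have "avg (\<lambda>x. (f x - f y) * (green y x - green y y)) y
        = avg (\<lambda>x. f x * green y x - f y * green y x - green y y * f x + f y * green y y) y"
      by (rule avg_cong) (simp add: algebra_simps)
    also have "\<dots> = avg (\<lambda>x. f x * green y x) y - f y * avg (green y) y - green y y * avg f y + f y * green y y"
      by (simp only: avg_add avg_diff avg_scale avg_const[OF y])
    finally have r_eq: "r y = avg (\<lambda>x. (f x - f y) * (green y x - green y y)) y - green y y * (lam * f y)"
      unfolding r_def green_commutator_def c_def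
      by (simp add: avg_green[OF y y] f[OF y] algebra_simps)
    have "\<bar>avg (\<lambda>x. (f x - f y) * (green y x - green y y)) y\<bar> \<le> avg (\<lambda>x. \<eta> * (green y y - green y x)) y"
    proof (rule order_trans[OF abs_avg_le_avg avg_mono])
      fix x assume x: "E y x"
      show "\<bar>(f x - f y) * (green y x - green y y)\<bar> \<le> \<eta> * (green y y - green y x)"
        using \<eta>[OF E_sym[OF x]] green_le_diagonal[OF y E_in_V'[OF x]]
        by (simp add: abs_mult mult_right_mono)
    qed
    also have "\<dots> = \<eta> * c"
      unfolding avg_scale avg_diff avg_const[OF y] avg_green[OF y y] c_def by simp
    also have "\<dots> \<le> \<eta>" using \<eta>0 c by (simp add: mult_left_le)
    finally have "\<bar>avg (\<lambda>x. (f x - f y) * (green y x - green y y)) y\<bar> \<le> \<eta>" .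
    moreover have "\<bar>green y y * (lam * f y)\<bar> \<le> A * (lam * 1)"
      unfolding abs_mult using A[OF y y] f1[OF y] lam A0 by (intro mult_mono) auto
    ultimately show ?thesis unfolding r_eq by linarith
  qed
  have H: "\<bar>?H y\<bar> \<le> 1 + \<eta> + A * lam" if y: "y \<in> V" for y
  proof -
    have "\<bar>c * f y\<bar> \<le> 1 * 1" unfolding abs_mult using c f1[OF y] by (intro mult_mono) auto
    then show ?thesis using r[OF y] unfolding r_def by linarith
  qed
  let ?\<Phi>3 = "\<lambda>m (b::'v). ?I m * ?I m" and ?\<Phi>4 = "\<lambda>m b. ?I m * ?J b m"
  let ?\<Psi>3 = "\<lambda>m b. avg (\<lambda>y. lam * lam * (m y * f y) * (m y * f y) - 2 * lam * (?I m * (m y * f y))) b"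
  let ?\<Psi>4 = "\<lambda>m b. ?I m * ?I m / N + avg (\<lambda>y. ?I m * (m y * ?H y) - lam * (m y * f y) * (?J y m + m y * ?H y)) b"
  have b3: "state_bounded ?\<Phi>3" and b4: "state_bounded ?\<Phi>4"
    by (intro state_bounded_intros)+
  have spread_I: "?I (spread E y m) = ?I m - lam * (m y * f y)" if "y \<in> V" for y m
    using sum_spread[OF that, of f m] f[OF that] by (simp add: algebra_simps)
  have spread_J: "?J y (spread E y m) = ?J y m + m y * ?H y" if "y \<in> V" for y m
    using sum_spread[OF that, of "\<lambda>x. f x * green y x" m] by (simp add: green_commutator_def)
  have d3: "?\<Psi>3 m b = drift ?\<Phi>3 m b" if b: "b \<in> V" for m b
  proof -
    have "avg (\<lambda>y. ?\<Phi>3 (spread E y m) y) b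
      = avg (\<lambda>y. (lam * lam * (m y * f y) * (m y * f y) - 2 * lam * (?I m * (m y * f y))) + ?I m * ?I m) b"
    proof (rule avg_cong)
      fix y assume "E b y"
      then have "y \<in> V" by (rule E_in_V')
      show "?\<Phi>3 (spread E y m) y
        = (lam * lam * (m y * f y) * (m y * f y) - 2 * lam * (?I m * (m y * f y))) + ?I m * ?I m"
        unfolding spread_I[OF \<open>y \<in> V\<close>] by (simp add: algebra_simps)
    qed
    then show ?thesis unfolding drift_def avg_add avg_const[OF b] by simp
  qed
  have d4: "?\<Psi>4 m b = drift ?\<Phi>4 m b" if b: "b \<in> V" and m: "m b = 0" for m b
  proof -
    have "avg (\<lambda>y. ?\<Phi>4 (spread E y m) y) b
      = avg (\<lambda>y. (?I m * (m y * ?H y) - lam * (m y * f y) * (?J y m + m y * ?H y)) + ?I m * ?J y m) b"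
    proof (rule avg_cong)
      fix y assume "E b y"
      then have "y \<in> V" by (rule E_in_V')
      show "?\<Phi>4 (spread E y m) y
        = (?I m * (m y * ?H y) - lam * (m y * f y) * (?J y m + m y * ?H y)) + ?I m * ?J y m"
        unfolding spread_I[OF \<open>y \<in> V\<close>] spread_J[OF \<open>y \<in> V\<close>] by (simp add: algebra_simps)
    qed
    also have "\<dots> = avg (\<lambda>y. ?I m * (m y * ?H y) - lam * (m y * f y) * (?J y m + m y * ?H y)) b + ?I m * (?J b m + ?I m / N)"
      unfolding avg_add avg_scale avg_integral_green[OF b] using m by simp
    finally show ?thesis unfolding drift_def by (simp add: algebra_simps)
  qed
  have n3: "(time_mean ?\<Psi>3 \<longlongrightarrow> 0) at_top"
    by (rule time_mean_drift[OF b3]) (rule d3)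
  have n4: "(time_mean ?\<Psi>4 \<longlongrightarrow> 0) at_top"
    by (rule time_mean_drift[OF b4]) (rule d4)
  have bI: "state_bounded (\<lambda>m b. ?I m)" by (rule state_bounded_integral)
  have bP3: "state_bounded ?\<Psi>3"
    by (intro state_bounded_next[of "\<lambda>m y. lam * lam * (m y * f y) * (m y * f y) - 2 * lam * (?I m * (m y * f y))"] state_bounded_intros)
  have bP4: "state_bounded ?\<Psi>4"
    unfolding divide_inverse
    by (intro state_bounded_add state_bounded_next[of "\<lambda>m y. ?I m * (m y * ?H y) - lam * (m y * f y) * (?J y m + m y * ?H y)"] state_bounded_intros)
  \<comment> \<open>The multiple \<open>c / (2 \<lambda>)\<close> of the drift of \<open>I\<^sup>2\<close> cancels the mixed term.\<close>
  have key: "(?I m)\<^sup>2 / N \<le> \<kappa> * hit_mean (\<lambda>_. 1) m b + (?\<Psi>4 m b + (- c / (2 * lam)) * ?\<Psi>3 m b)"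
    if m: "mass_dist m" and b: "b \<in> V" for m b
  proof -
    have I1: "\<bar>?I m\<bar> \<le> 1" by (rule mass_dist_integral_abs_le[OF m f1])
    have "(?I m)\<^sup>2 / N - (?\<Psi>4 m b + (- c / (2 * lam)) * ?\<Psi>3 m b)
      = avg (\<lambda>y. (- c / (2 * lam)) * (- (lam * lam * (m y * f y) * (m y * f y) - 2 * lam * (?I m * (m y * f y))))
            - (?I m * (m y * ?H y) - lam * (m y * f y) * (?J y m + m y * ?H y))) b"
    proof -
      have lin: "avg (\<lambda>y. \<alpha> * (- G y) - K y) b = \<alpha> * (- avg G b) - avg K b" for \<alpha> G K
        using avg_scale[of "- \<alpha>" G b] by (simp add: avg_diff)
      show ?thesis unfolding lin power2_eq_square by simp
    qed
    also have "\<dots> \<le> avg (\<lambda>y. \<kappa> * (m y * 1)) b"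
    proof (rule avg_mono)
      fix y assume "E b y"
      then have y: "y \<in> V" by (rule E_in_V')
      have my: "0 \<le> m y" "m y \<le> 1" using m y mass_dist_le_1 by (auto simp: mass_dist_def)
      have mf: "\<bar>m y * f y\<bar> \<le> m y" using my f1[OF y] by (simp add: abs_mult mult_left_le)
      have J: "\<bar>?J y m\<bar> \<le> A"
      proof (rule mass_dist_integral_abs_le[OF m])
        fix x assume x: "x \<in> V"
        have "\<bar>f x * green y x\<bar> \<le> 1 * A" unfolding abs_mult using f1[OF x] A[OF y x] by (intro mult_mono) auto
        then show "\<bar>f x * green y x\<bar> \<le> A" by simp
      qed
      have eq: "(- c / (2 * lam)) * (- (lam * lam * (m y * f y) * (m y * f y) - 2 * lam * (?I m * (m y * f y))))
            - (?I m * (m y * ?H y) - lam * (m y * f y) * (?J y m + m y * ?H y))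
          = (c * lam / 2) * ((m y * f y) * (m y * f y)) - ?I m * (m y * r y) + lam * ((m y * f y) * (?J y m + m y * ?H y))"
        unfolding r_def using lam by (simp add: field_simps)
      have t1: "(c * lam / 2) * ((m y * f y) * (m y * f y)) \<le> (lam / 2) * m y"
      proof -
        have "(m y * f y) * (m y * f y) \<le> m y * 1"
          using mult_mono[OF mf order_trans[OF mf my(2)]] my by (simp add: abs_mult_self_eq flip: abs_mult)
        moreover have "c * lam / 2 \<le> lam / 2" using c lam by simp
        ultimately show ?thesis using c lam my by (intro mult_mono) auto
      qed
      have t2: "- ?I m * (m y * r y) \<le> m y * (\<eta> + A * lam)"
      proof -
        have "\<bar>?I m * (m y * r y)\<bar> \<le> 1 * (m y * (\<eta> + A * lam))"
          unfolding abs_mult using I1 r[OF y] my by (intro mult_mono) auto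
        then show ?thesis by linarith
      qed
      have t3: "lam * ((m y * f y) * (?J y m + m y * ?H y)) \<le> lam * (m y * (A + (1 + \<eta> + A * lam)))"
      proof (rule mult_left_mono)
        have "\<bar>m y * ?H y\<bar> \<le> 1 * (1 + \<eta> + A * lam)"
          unfolding abs_mult using H[OF y] my by (intro mult_mono) auto
        then have "\<bar>?J y m + m y * ?H y\<bar> \<le> A + (1 + \<eta> + A * lam)"
          using order_trans[OF abs_triangle_ineq add_mono[OF J]] by simp
        then have "\<bar>(m y * f y) * (?J y m + m y * ?H y)\<bar> \<le> m y * (A + (1 + \<eta> + A * lam))"
          unfolding abs_mult[of "m y * f y"] using mf my by (intro mult_mono) auto
        then show "(m y * f y) * (?J y m + m y * ?H y) \<le> m y * (A + (1 + \<eta> + A * lam))" by linarith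
      qed (use lam in simp)
      show "(- c / (2 * lam)) * (- (lam * lam * (m y * f y) * (m y * f y) - 2 * lam * (?I m * (m y * f y))))
            - (?I m * (m y * ?H y) - lam * (m y * f y) * (?J y m + m y * ?H y)) \<le> \<kappa> * (m y * 1)"
        unfolding eq \<kappa>_def using t1 t2 t3 by (simp add: algebra_simps)
    qed
    also have "\<dots> = \<kappa> * hit_mean (\<lambda>_. 1) m b" unfolding avg_scale hit_mean_def ..
    finally show ?thesis by linarith
  qed
  have bound: "time_mean (\<lambda>m b. (?I m)\<^sup>2) t \<le> N * (\<kappa> * time_mean (hit_mean (\<lambda>_. 1)) t + (time_mean ?\<Psi>4 t + (- c / (2 * lam)) * time_mean ?\<Psi>3 t))" for t
  proof -
    have "time_mean (\<lambda>m b. (1 / N) * (?I m)\<^sup>2) t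
      \<le> time_mean (\<lambda>m b. \<kappa> * hit_mean (\<lambda>_. 1) m b + (?\<Psi>4 m b + (- c / (2 * lam)) * ?\<Psi>3 m b)) t"
      unfolding power2_eq_square
      by (rule time_mean_mono, intro state_bounded_intros,
          intro state_bounded_add state_bounded_mult state_bounded_const state_bounded_hit_mean bP3 bP4)
         (use key in \<open>simp add: power2_eq_square\<close>)
    also have "\<dots> = \<kappa> * time_mean (hit_mean (\<lambda>_. 1)) t + (time_mean ?\<Psi>4 t + (- c / (2 * lam)) * time_mean ?\<Psi>3 t)"
      unfolding time_mean_scale[symmetric]
      by (subst time_mean_add time_mean_add[OF bP4 state_bounded_mult[OF state_bounded_const bP3]],
          (intro state_bounded_add state_bounded_mult state_bounded_const state_bounded_hit_mean bP3 bP4)+,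
          subst time_mean_add[OF bP4 state_bounded_mult[OF state_bounded_const bP3]], rule refl)
    finally show ?thesis unfolding time_mean_scale using N_pos by (simp add: field_simps)
  qed
  have \<kappa>0: "0 \<le> \<kappa>" unfolding \<kappa>_def using \<eta>0 A0 lam by simp
  have "((\<lambda>t. N * (\<kappa> * time_mean (hit_mean (\<lambda>_. 1)) t + (time_mean ?\<Psi>4 t + (- c / (2 * lam)) * time_mean ?\<Psi>3 t)))
     \<longlongrightarrow> N * (\<kappa> * ((\<Sum>y\<in>V. 1) / (N * (N - 1))) + (0 + (- c / (2 * lam)) * 0))) at_top"
    by (intro tendsto_intros time_mean_hit N n3 n4)
  moreover have "N * (\<kappa> * ((\<Sum>y\<in>V. 1) / (N * (N - 1))) + (0 + (- c / (2 * lam)) * 0)) < 2 * \<kappa> + e"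
  proof -
    have "N / (N - 1) \<le> 2" using N by (simp add: field_simps)
    then have "\<kappa> * (N / (N - 1)) \<le> \<kappa> * 2" using \<kappa>0 by (rule mult_left_mono)
    then show ?thesis using e N_pos by (simp add: mult.commute)
  qed
  ultimately have "\<forall>\<^sub>F t in at_top. N * (\<kappa> * time_mean (hit_mean (\<lambda>_. 1)) t + (time_mean ?\<Psi>4 t + (- c / (2 * lam)) * time_mean ?\<Psi>3 t)) < 2 * \<kappa> + e"
    by (rule order_tendstoD(2))
  then show ?thesis
    by eventually_elim (use bound in \<open>meson less_imp_le order_trans\<close>)
qed

end

end

section \<open>The weak topology and its Borel sets\<close>

lemma continuous_map_from_weak_topology:
  fixes f :: "'a::topological_space \<Rightarrow> real"
  assumes "continuous_on UNIV f" "bounded (range f)"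
  shows "continuous_map weak_topology euclideanreal (\<lambda>\<mu>. \<integral>x. f x \<partial>\<mu>)"
  unfolding continuous_map_def
proof (intro conjI allI impI)
  fix U :: "real set" assume "openin euclideanreal U"
  then have "{\<mu> \<in> finite_borel_measures. (\<integral>x. f x \<partial>\<mu>) \<in> U} \<in>
     {{\<mu> \<in> finite_borel_measures. (\<integral>x. f x \<partial>\<mu>) \<in> U} | (f :: 'a \<Rightarrow> real) U.
        continuous_on UNIV f \<and> bounded (range f) \<and> open U}"
    using assms by auto
  then show "openin weak_topology {\<mu> \<in> topspace weak_topology. (\<integral>x. f x \<partial>\<mu>) \<in> U}"
    unfolding topspace_weak_topology unfolding weak_topology_def by (rule topology_generated_by_Basis)
qed simp

text \<open>
  The weak topology is generated by the integrals of bounded continuous functions.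
\<close>

lemma continuous_map_into_weak_topology:
  fixes \<psi> :: "'b \<Rightarrow> 'a::topological_space measure"
  assumes "\<And>x. x \<in> topspace T \<Longrightarrow> \<psi> x \<in> finite_borel_measures"
    and "\<And>f :: 'a \<Rightarrow> real. continuous_on UNIV f \<Longrightarrow> bounded (range f) \<Longrightarrow>
      continuous_map T euclideanreal (\<lambda>x. \<integral>y. f y \<partial>\<psi> x)"
  shows "continuous_map T weak_topology \<psi>"
  unfolding weak_topology_def continuous_on_generated_topo_iff
proof (intro conjI allI impI)
  fix B assume "B \<in> {{\<mu> \<in> finite_borel_measures. (\<integral>x. f x \<partial>\<mu>) \<in> U} | (f :: 'a \<Rightarrow> real) U.
        continuous_on UNIV f \<and> bounded (range f) \<and> open U}"
  then obtain f :: "'a \<Rightarrow> real" and U where B: "B = {\<mu> \<in> finite_borel_measures. (\<integral>x. f x \<partial>\<mu>) \<in> U}"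
    and f: "continuous_on UNIV f" "bounded (range f)" and U: "open U" by auto
  have "\<psi> -` B \<inter> topspace T = {x \<in> topspace T. (\<integral>y. f y \<partial>\<psi> x) \<in> U}"
    using assms(1) by (auto simp: B)
  then show "openin T (\<psi> -` B \<inter> topspace T)"
    using assms(2)[OF f] U by (simp add: continuous_map_def)
next
  have "finite_borel_measures \<in> {{\<mu> \<in> finite_borel_measures. (\<integral>x. f x \<partial>\<mu>) \<in> U} | (f :: 'a \<Rightarrow> real) U.
        continuous_on UNIV f \<and> bounded (range f) \<and> open U}"
    by (auto intro!: exI[of _ "\<lambda>_. 0"] exI[of _ UNIV])
  then show "\<psi> ` topspace T \<subseteq> \<Union> {{\<mu> \<in> finite_borel_measures. (\<integral>x. f x \<partial>\<mu>) \<in> U} | (f :: 'a \<Rightarrow> real) U.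
        continuous_on UNIV f \<and> bounded (range f) \<and> open U}"
    using assms(1) by blast
qed

lemma measurable_borel_ofI:
  assumes "f \<in> space M \<rightarrow> topspace T" "\<And>U. openin T U \<Longrightarrow> f -` U \<inter> space M \<in> sets M"
  shows "f \<in> M \<rightarrow>\<^sub>M borel_of T"
  unfolding borel_of_def
proof (rule measurable_measure_of)
  show "{U. openin T U} \<subseteq> Pow (topspace T)" using openin_subset by blast
qed (use assms in auto)

lemma space_borel_of: "space (borel_of T) = topspace T"
  unfolding borel_of_def by (rule space_measure_of) (auto dest: openin_subset)

lemma openin_sets_borel_of: "openin T U \<Longrightarrow> U \<in> sets (borel_of T)"
  unfolding borel_of_def by (intro in_measure_of) (auto dest: openin_subset)

lemma continuous_map_measurable_borel_of:
  assumes "continuous_map T T' f"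
  shows "f \<in> borel_of T \<rightarrow>\<^sub>M borel_of T'"
proof (rule measurable_borel_ofI)
  show "f \<in> space (borel_of T) \<rightarrow> topspace T'"
    using continuous_map_image_subset_topspace[OF assms] by (auto simp: space_borel_of)
  fix U assume "openin T' U"
  then have "openin T {x \<in> topspace T. f x \<in> U}" using assms by (simp add: continuous_map_def)
  moreover have "f -` U \<inter> space (borel_of T) = {x \<in> topspace T. f x \<in> U}" by (auto simp: space_borel_of)
  ultimately show "f -` U \<inter> space (borel_of T) \<in> sets (borel_of T)" using openin_sets_borel_of by simp
qed

lemma borel_of_euclidean: "sets (borel_of euclidean) = sets borel"
  by (simp add: borel_of_def borel_def)

lemma continuous_map_borel_measurable:
  fixes g :: "'a \<Rightarrow> real"
  assumes "continuous_map T euclideanreal g" "\<xi> \<in> P \<rightarrow>\<^sub>M borel_of T"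
  shows "(\<lambda>\<omega>. g (\<xi> \<omega>)) \<in> borel_measurable P"
proof -
  have "g \<in> borel_of T \<rightarrow>\<^sub>M borel_of euclidean" by (rule continuous_map_measurable_borel_of[OF assms(1)])
  then have "(\<lambda>\<omega>. g (\<xi> \<omega>)) \<in> P \<rightarrow>\<^sub>M borel_of euclidean" by (rule measurable_compose[OF assms(2)])
  then show ?thesis using measurable_cong_sets[OF refl borel_of_euclidean] by blast
qed

section \<open>Empirical measures\<close>

lemma empirical_measure_max: "empirical_measure V m = empirical_measure V (\<lambda>v. max 0 (m v))"
  by (simp add: empirical_measure_def ennreal_max_0)

lemma empirical_measure_finite_borel:
  assumes "finite V"
  shows "empirical_measure V m \<in> finite_borel_measures"
proof -
  have "emeasure (empirical_measure V m) UNIV \<noteq> \<infinity>"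
    using assms by (subst emeasure_empirical_measure) (auto simp: ennreal_mult_eq_top_iff)
  then show ?thesis
    by (auto simp: finite_borel_measures_def empirical_measure_def intro!: finite_measureI)
qed

lemma integral_empirical_measure:
  fixes f :: "real ^ 'd \<Rightarrow> real"
  assumes V: "finite V" and f: "f \<in> borel_measurable borel" 
  shows "(\<integral>x. f x \<partial>empirical_measure V m) = (\<Sum>v\<in>V. max 0 (m v) * f (torus_point v))"
proof -
  have "(\<integral>x. f x \<partial>empirical_measure V m) = (\<integral>v. f (torus_point v) \<partial>point_measure V (\<lambda>v. ennreal (max 0 (m v))))"
    unfolding empirical_measure_max[of V m] unfolding empirical_measure_def
    by (rule integral_distr[OF _ f]) (auto simp: measurable_def space_point_measure sets_point_measure)
  also have "\<dots> = (\<Sum>v\<in>V. max 0 (m v) *\<^sub>R f (torus_point v))"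
    by (rule lebesgue_integral_point_measure_finite) (use V in auto)
  finally show ?thesis by simp
qed

text \<open>
  Vertices are numbered by \<open>idx\<close>, so that the masses are a real sequence; the Borel sets of the space of
  real sequences are generated by the coordinates, which yields measurability below. Negative masses are
  cut off at zero by \<open>ennreal\<close>, so continuity holds on all sequences.
\<close>

lemma continuous_map_empirical_measure:
  fixes V :: "(nat ^ 'd) set" and idx :: "nat ^ 'd \<Rightarrow> nat"
  assumes "finite V"
  shows "continuous_map euclidean weak_topology (\<lambda>c :: nat \<Rightarrow> real. empirical_measure V (\<lambda>v. c (idx v)))"
proof (rule continuous_map_into_weak_topology)
  show "empirical_measure V (\<lambda>v. c (idx v)) \<in> finite_borel_measures" for c :: "nat \<Rightarrow> real"
    by (rule empirical_measure_finite_borel[OF assms])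
  fix f :: "real ^ 'd \<Rightarrow> real" assume f: "continuous_on UNIV f" "bounded (range f)"
  have "continuous_on UNIV (\<lambda>c :: nat \<Rightarrow> real. \<Sum>v\<in>V. max 0 (c (idx v)) * f (torus_point v))"
    by (intro continuous_intros continuous_on_product_coordinates)
  then show "continuous_map euclidean euclideanreal (\<lambda>c :: nat \<Rightarrow> real. \<integral>y. f y \<partial>empirical_measure V (\<lambda>v. c (idx v)))"
    using f by (simp add: integral_empirical_measure[OF assms] borel_measurable_continuous_onI)
qed

lemma empirical_measure_cong: 
  assumes "\<And>v. v \<in> V \<Longrightarrow> m v = m' v"
  shows "empirical_measure V m = empirical_measure V m'"
proof -
  have "point_measure V (\<lambda>v. ennreal (m v)) = point_measure V (\<lambda>v. ennreal (m' v))"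
    unfolding point_measure_def by (rule density_cong) (auto simp: assms AE_count_space)
  then show ?thesis by (simp add: empirical_measure_def)
qed

lemma measurable_empirical_measure:
  fixes V :: "(nat ^ 'd) set" and m :: "'w \<Rightarrow> nat ^ 'd \<Rightarrow> real"
  assumes V: "finite V" and m: "\<And>v. v \<in> V \<Longrightarrow> (\<lambda>\<omega>. m \<omega> v) \<in> borel_measurable P"
  shows "(\<lambda>\<omega>. empirical_measure V (m \<omega>)) \<in> P \<rightarrow>\<^sub>M borel_of weak_topology"
proof -
  obtain idx :: "nat ^ 'd \<Rightarrow> nat" where idx: "inj_on idx V" using finite_imp_inj_to_nat_seg[OF V] by blast
  define c where "c \<omega> i = (if i \<in> idx ` V then m \<omega> (the_inv_into V idx i) else 0)" for \<omega> and i :: nat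
  have c_meas: "c \<in> borel_measurable P"
  proof (rule measurable_coordinatewise_then_product)
    fix i show "(\<lambda>\<omega>. c \<omega> i) \<in> borel_measurable P"
      unfolding c_def using the_inv_into_into[OF idx _ order_refl] m by (cases "i \<in> idx ` V") auto
  qed
  then have "c \<in> P \<rightarrow>\<^sub>M borel_of euclidean" using measurable_cong_sets[OF refl borel_of_euclidean] by blast
  then have "(\<lambda>\<omega>. empirical_measure V (\<lambda>v. c \<omega> (idx v))) \<in> P \<rightarrow>\<^sub>M borel_of weak_topology"
    by (rule measurable_compose[OF _ continuous_map_measurable_borel_of[OF continuous_map_empirical_measure[OF V]]])
  moreover have "empirical_measure V (\<lambda>v. c \<omega> (idx v)) = empirical_measure V (m \<omega>)" for \<omega>
    by (rule empirical_measure_cong) (simp add: c_def the_inv_into_f_f[OF idx])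
  ultimately show ?thesis by simp
qed

lemma tendsto_weak_continuous_empirical:
  fixes V :: "(nat ^ 'd) set" and g :: "(real ^ 'd) measure \<Rightarrow> real"
  assumes V: "finite V" and g: "continuous_map weak_topology euclideanreal g"
    and m: "\<And>v. v \<in> V \<Longrightarrow> (\<lambda>n. m n v) \<longlonglongrightarrow> m' v"
  shows "(\<lambda>n. g (empirical_measure V (m n))) \<longlonglongrightarrow> g (empirical_measure V m')"
proof -
  obtain idx :: "nat ^ 'd \<Rightarrow> nat" where idx: "inj_on idx V" using finite_imp_inj_to_nat_seg[OF V] by blast
  define c where "c m i = (if i \<in> idx ` V then m (the_inv_into V idx i) else 0 :: real)" for m :: "nat ^ 'd \<Rightarrow> real" and i :: nat
  have eq: "empirical_measure V (\<lambda>v. c m (idx v)) = empirical_measure V m" for m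
    by (rule empirical_measure_cong) (simp add: c_def the_inv_into_f_f[OF idx])
  have "limitin (product_topology (\<lambda>_. euclideanreal) UNIV) (\<lambda>n. c (m n)) (c m') sequentially"
    unfolding limitin_componentwise
  proof (intro conjI ballI)
    fix i :: nat
    show "limitin euclideanreal (\<lambda>n. c (m n) i) (c m' i) sequentially"
      unfolding c_def limitin_canonical_iff using the_inv_into_into[OF idx _ order_refl] m by (cases "i \<in> idx ` V") auto
  qed auto
  then have "limitin euclidean (\<lambda>n. c (m n)) (c m') sequentially"
    by (simp add: euclidean_product_topology)
  then have lim: "(\<lambda>n. c (m n)) \<longlonglongrightarrow> c m'" by simp
  have "continuous_map euclidean euclideanreal (g \<circ> (\<lambda>c. empirical_measure V (\<lambda>v. c (idx v))))"
    by (rule continuous_map_compose[OF continuous_map_empirical_measure[OF V, of idx] g])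
  then have "continuous_on UNIV (\<lambda>c. g (empirical_measure V (\<lambda>v. c (idx v))))"
    by (simp add: o_def)
  from continuous_on_tendsto_compose[OF this lim] show ?thesis by (simp add: eq)
qed

section \<open>Rescaling\<close>

lemma scale_measurable: "(\<lambda>x::'a::{real_normed_vector}. x /\<^sub>R a) \<in> borel_measurable borel"
  by (intro borel_measurable_continuous_onI continuous_intros)

lemma integral_rescaled:
  fixes f :: "'a::{real_normed_vector} \<Rightarrow> real"
  assumes "sets \<mu> = sets borel" "f \<in> borel_measurable borel"
  shows "(\<integral>x. f x \<partial>rescaled a \<mu>) = (\<integral>x. f (x /\<^sub>R a) \<partial>\<mu>)"
  unfolding rescaled_def
  by (rule integral_distr) (use scale_measurable[of a] measurable_cong_sets[OF assms(1) refl] assms(2) in blast)+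

lemma continuous_map_rescaled: "continuous_map weak_topology weak_topology (rescaled a :: 'a::real_normed_vector measure \<Rightarrow> 'a measure)"
proof (rule continuous_map_into_weak_topology)
  fix \<mu> :: "'a measure" assume "\<mu> \<in> topspace weak_topology"
  then have s: "sets \<mu> = sets borel" and f: "finite_measure \<mu>"
    by (auto simp: topspace_weak_topology finite_borel_measures_def)
  have "(\<lambda>x. x /\<^sub>R a) \<in> measurable \<mu> borel"
    using scale_measurable[of a] measurable_cong_sets[OF s refl] by blast
  then show "rescaled a \<mu> \<in> finite_borel_measures"
    using finite_measure.finite_measure_distr[OF f] by (auto simp: finite_borel_measures_def rescaled_def)
next
  fix f :: "'a \<Rightarrow> real" assume f: "continuous_on UNIV f" "bounded (range f)"
  have "continuous_on UNIV (\<lambda>x. f (x /\<^sub>R a))"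
    by (rule continuous_on_compose2[OF f(1)]) (auto intro!: continuous_intros)
  moreover have "bounded (range (\<lambda>x. f (x /\<^sub>R a)))"
    by (rule bounded_subset[OF f(2)]) auto
  ultimately have "continuous_map weak_topology euclideanreal (\<lambda>\<mu>. \<integral>x. f (x /\<^sub>R a) \<partial>\<mu>)"
    by (rule continuous_map_from_weak_topology)
  then show "continuous_map weak_topology euclideanreal (\<lambda>\<mu>. \<integral>x. f x \<partial>rescaled a \<mu>)"
    by (rule continuous_map_eq)
       (use f(1) in \<open>auto simp: topspace_weak_topology finite_borel_measures_def integral_rescaled borel_measurable_continuous_onI\<close>)
qed

section \<open>Convergence in distribution to a constant\<close>

text \<open>
  The probability of missing a neighbourhood of the limit tends to zero. For the sets that generate the
  topology this is the hypothesis, and it passes to finite intersections and to arbitrary unions. A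
  bounded continuous functional is close to its value at the limit on such a neighbourhood.
\<close>

lemma weak_convergence_to_constant:
  fixes \<xi> :: "nat \<Rightarrow> 'u \<Rightarrow> 'a::topological_space measure"
  assumes rand: "\<forall>\<^sub>F n in sequentially. random_measure (Q n) (\<xi> n)"
    and U: "random_measure R U" "AE \<omega> in R. U \<omega> = lim_meas" and lim_meas: "lim_meas \<in> finite_borel_measures"
    and conv: "\<And>(f :: 'a \<Rightarrow> real) e. continuous_on UNIV f \<Longrightarrow> bounded (range f) \<Longrightarrow> 0 < e \<Longrightarrow>
      (\<lambda>n. measure (Q n) {\<omega> \<in> space (Q n). e \<le> \<bar>(\<integral>x. f x \<partial>\<xi> n \<omega>) - (\<integral>x. f x \<partial>lim_meas)\<bar>}) \<longlonglongrightarrow> 0"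
  shows "converges_in_distribution weak_topology Q \<xi> R U sequentially"
proof -
  have meas: "{\<omega> \<in> space (Q n). \<xi> n \<omega> \<in> W} \<in> sets (Q n)"
    if "random_measure (Q n) (\<xi> n)" "openin weak_topology W" for n W
  proof -
    have "\<xi> n -` W \<inter> space (Q n) \<in> sets (Q n)"
      using that openin_sets_borel_of by (auto simp: random_element_def intro: measurable_sets)
    moreover have "\<xi> n -` W \<inter> space (Q n) = {\<omega> \<in> space (Q n). \<xi> n \<omega> \<in> W}" by auto
    ultimately show ?thesis by simp
  qed
  have nhds: "(\<lambda>n. measure (Q n) {\<omega> \<in> space (Q n). \<xi> n \<omega> \<notin> W}) \<longlonglongrightarrow> 0"
    if W: "openin weak_topology W" and "lim_meas \<in> W" for W
  proof -
    define S where "S = {{\<mu> \<in> finite_borel_measures. (\<integral>x. f x \<partial>\<mu>) \<in> U} | (f :: 'a \<Rightarrow> real) U.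
        continuous_on UNIV f \<and> bounded (range f) \<and> open U}"
    have gen: "openin weak_topology A" if "generate_topology_on S A" for A
      using that unfolding weak_topology_def S_def[symmetric] by (simp add: openin_topology_generated_by_iff)
    have "generate_topology_on S W"
      using W unfolding weak_topology_def S_def[symmetric] by (simp add: openin_topology_generated_by_iff)
    then show ?thesis using \<open>lim_meas \<in> W\<close>
    proof induction
      case Empty
      then show ?case by simp
    next
      case (Int A B)
      have "(\<lambda>n. measure (Q n) {\<omega> \<in> space (Q n). \<xi> n \<omega> \<notin> A} + measure (Q n) {\<omega> \<in> space (Q n). \<xi> n \<omega> \<notin> B}) \<longlonglongrightarrow> 0 + 0"
        using Int by (intro tendsto_add) auto
      then have "(\<lambda>n. measure (Q n) {\<omega> \<in> space (Q n). \<xi> n \<omega> \<notin> A} + measure (Q n) {\<omega> \<in> space (Q n). \<xi> n \<omega> \<notin> B}) \<longlonglongrightarrow> 0"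
        by simp
      then show ?case
      proof (rule Lim_null_comparison[rotated])
        show "\<forall>\<^sub>F n in sequentially. norm (measure (Q n) {\<omega> \<in> space (Q n). \<xi> n \<omega> \<notin> A \<inter> B})
           \<le> measure (Q n) {\<omega> \<in> space (Q n). \<xi> n \<omega> \<notin> A} + measure (Q n) {\<omega> \<in> space (Q n). \<xi> n \<omega> \<notin> B}"
          using rand
        proof eventually_elim
          case (elim n)
          have "{\<omega> \<in> space (Q n). \<xi> n \<omega> \<notin> C} \<in> sets (Q n)" if "openin weak_topology C" for C
          proof -
            have "{\<omega> \<in> space (Q n). \<xi> n \<omega> \<notin> C} = space (Q n) - {\<omega> \<in> space (Q n). \<xi> n \<omega> \<in> C}" by auto
            then show ?thesis using meas[OF elim that] by auto
          qed
          moreover have "{\<omega> \<in> space (Q n). \<xi> n \<omega> \<notin> A \<inter> B}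
             = {\<omega> \<in> space (Q n). \<xi> n \<omega> \<notin> A} \<union> {\<omega> \<in> space (Q n). \<xi> n \<omega> \<notin> B}" by auto
          ultimately show ?case
            using Int.hyps gen by (simp add: measure_Un_le)
        qed
      qed
    next
      case (UN K)
      then obtain k where k: "k \<in> K" "lim_meas \<in> k" by auto
      have "(\<lambda>n. measure (Q n) {\<omega> \<in> space (Q n). \<xi> n \<omega> \<notin> k}) \<longlonglongrightarrow> 0" by (rule UN.IH[OF k])
      then show ?case
      proof (rule Lim_null_comparison[rotated])
        show "\<forall>\<^sub>F n in sequentially. norm (measure (Q n) {\<omega> \<in> space (Q n). \<xi> n \<omega> \<notin> \<Union>K})
           \<le> measure (Q n) {\<omega> \<in> space (Q n). \<xi> n \<omega> \<notin> k}"
          using rand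
        proof eventually_elim
          case (elim n)
          interpret prob_space "Q n" using elim by (simp add: random_element_def)
          have "{\<omega> \<in> space (Q n). \<xi> n \<omega> \<notin> k} = space (Q n) - {\<omega> \<in> space (Q n). \<xi> n \<omega> \<in> k}" by auto
          then have "{\<omega> \<in> space (Q n). \<xi> n \<omega> \<notin> k} \<in> sets (Q n)"
            using meas[OF elim gen[OF UN.hyps[OF k(1)]]] by auto
          then show ?case using k(1) by (auto intro!: finite_measure_mono)
        qed
      qed
    next
      case (Basis s)
      then obtain f :: "'a \<Rightarrow> real" and U where s: "s = {\<mu> \<in> finite_borel_measures. (\<integral>x. f x \<partial>\<mu>) \<in> U}"
        and f: "continuous_on UNIV f" "bounded (range f)" and U: "open U" by (auto simp: S_def)
      obtain e where e: "0 < e" "ball (\<integral>x. f x \<partial>lim_meas) e \<subseteq> U"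
        using Basis.prems U unfolding s by (auto simp: open_contains_ball)
      show ?case
      proof (rule Lim_null_comparison[OF _ conv[OF f e(1)]])
        show "\<forall>\<^sub>F n in sequentially. norm (measure (Q n) {\<omega> \<in> space (Q n). \<xi> n \<omega> \<notin> s})
           \<le> measure (Q n) {\<omega> \<in> space (Q n). e \<le> \<bar>(\<integral>x. f x \<partial>\<xi> n \<omega>) - (\<integral>x. f x \<partial>lim_meas)\<bar>}"
          using rand
        proof eventually_elim
          case (elim n)
          interpret prob_space "Q n" using elim by (simp add: random_element_def)
          have [measurable]: "(\<lambda>\<omega>. \<integral>x. f x \<partial>\<xi> n \<omega>) \<in> borel_measurable (Q n)"
            using elim by (intro continuous_map_borel_measurable[OF continuous_map_from_weak_topology[OF f]])
              (simp add: random_element_def)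
          have "\<xi> n \<omega> \<in> finite_borel_measures" if "\<omega> \<in> space (Q n)" for \<omega>
            using elim that measurable_space[of "\<xi> n" "Q n" "borel_of weak_topology" \<omega>]
            by (simp add: random_element_def space_borel_of topspace_weak_topology)
          then have "{\<omega> \<in> space (Q n). \<xi> n \<omega> \<notin> s} \<subseteq> {\<omega> \<in> space (Q n). e \<le> \<bar>(\<integral>x. f x \<partial>\<xi> n \<omega>) - (\<integral>x. f x \<partial>lim_meas)\<bar>}"
            using e(2) by (force simp: s dist_real_def subset_eq abs_minus_commute)
          then show ?case by (auto intro!: finite_measure_mono)
        qed
      qed
    qed
  qed
  show ?thesis
    unfolding converges_in_distribution_def
  proof (intro conjI allI impI rand U(1))
    fix g :: "'a measure \<Rightarrow> real"
    assume g: "continuous_map weak_topology euclideanreal g \<and> bounded (g ` topspace weak_topology)"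
    then obtain C where C: "\<And>\<mu>. \<mu> \<in> finite_borel_measures \<Longrightarrow> \<bar>g \<mu>\<bar> \<le> C"
      by (auto simp: bounded_iff topspace_weak_topology)
    have gU: "(\<integral>\<omega>. g (U \<omega>) \<partial>R) = g lim_meas"
    proof -
      interpret prob_space R using U(1) by (simp add: random_element_def)
      have "(\<integral>\<omega>. g (U \<omega>) \<partial>R) = (\<integral>\<omega>. g lim_meas \<partial>R)"
      proof (rule integral_cong_AE)
        show "(\<lambda>\<omega>. g (U \<omega>)) \<in> borel_measurable R"
          using g U(1) by (auto simp: random_element_def intro: continuous_map_borel_measurable)
        show "AE \<omega> in R. g (U \<omega>) = g lim_meas" using U(2) by eventually_elim simp
      qed simp
      then show ?thesis by (simp add: prob_space)
    qed
    show "(\<lambda>n. \<integral>\<omega>. g (\<xi> n \<omega>) \<partial>Q n) \<longlonglongrightarrow> (\<integral>\<omega>. g (U \<omega>) \<partial>R)"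
      unfolding gU
    proof (rule tendstoI)
      fix e :: real assume e: "0 < e"
      define W where "W = {\<mu> \<in> topspace weak_topology. g \<mu> \<in> ball (g lim_meas) (e / 2)}"
      have "openin weak_topology W"
        using g unfolding W_def continuous_map_def by (simp del: mem_ball)
      moreover have "lim_meas \<in> W" using lim_meas e by (simp add: W_def topspace_weak_topology)
      ultimately have "(\<lambda>n. measure (Q n) {\<omega> \<in> space (Q n). \<xi> n \<omega> \<notin> W}) \<longlonglongrightarrow> 0" by (rule nhds)
      then have "(\<lambda>n. 2 * C * measure (Q n) {\<omega> \<in> space (Q n). \<xi> n \<omega> \<notin> W}) \<longlonglongrightarrow> 2 * C * 0"
        by (rule tendsto_mult_left)
      then have "\<forall>\<^sub>F n in sequentially. 2 * C * measure (Q n) {\<omega> \<in> space (Q n). \<xi> n \<omega> \<notin> W} < e / 2"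
        using e by (intro order_tendstoD(2)) auto
      then show "\<forall>\<^sub>F n in sequentially. dist (\<integral>\<omega>. g (\<xi> n \<omega>) \<partial>Q n) (g lim_meas) < e"
        using rand
      proof eventually_elim
        case (elim n)
        interpret prob_space "Q n" using elim by (simp add: random_element_def)
        let ?B = "{\<omega> \<in> space (Q n). \<xi> n \<omega> \<notin> W}"
        have "?B = space (Q n) - {\<omega> \<in> space (Q n). \<xi> n \<omega> \<in> W}" by auto
        then have B: "?B \<in> sets (Q n)" using meas[OF elim(2) \<open>openin weak_topology W\<close>] by auto
        have fin: "\<xi> n \<omega> \<in> finite_borel_measures" if "\<omega> \<in> space (Q n)" for \<omega>
          using elim that measurable_space[of "\<xi> n" "Q n" "borel_of weak_topology" \<omega>]
          by (simp add: random_element_def space_borel_of topspace_weak_topology)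
        have gm: "(\<lambda>\<omega>. g (\<xi> n \<omega>)) \<in> borel_measurable (Q n)"
          using g elim by (auto simp: random_element_def intro: continuous_map_borel_measurable)
        have gi: "integrable (Q n) (\<lambda>\<omega>. g (\<xi> n \<omega>))"
          by (rule integrable_const_bound[OF _ gm, of C]) (use fin C in auto)
        have "\<bar>expectation (\<lambda>\<omega>. g (\<xi> n \<omega>)) - g lim_meas\<bar> = \<bar>expectation (\<lambda>\<omega>. g (\<xi> n \<omega>) - g lim_meas)\<bar>"
          using gi by (simp add: prob_space)
        also have "\<dots> \<le> expectation (\<lambda>\<omega>. \<bar>g (\<xi> n \<omega>) - g lim_meas\<bar>)" by (rule integral_abs_bound)
        also have "\<dots> \<le> expectation (\<lambda>\<omega>. e / 2 + 2 * C * indicator ?B \<omega>)"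
        proof (rule integral_mono)
          show "integrable (Q n) (\<lambda>\<omega>. \<bar>g (\<xi> n \<omega>) - g lim_meas\<bar>)" using gi by auto
          show "integrable (Q n) (\<lambda>\<omega>. e / 2 + 2 * C * indicator ?B \<omega>)"
            using B by (auto simp: emeasure_eq_measure)
          fix \<omega> assume \<omega>: "\<omega> \<in> space (Q n)"
          show "\<bar>g (\<xi> n \<omega>) - g lim_meas\<bar> \<le> e / 2 + 2 * C * indicator ?B \<omega>"
          proof (cases "\<xi> n \<omega> \<in> W")
            case True
            then show ?thesis by (auto simp: W_def dist_real_def abs_minus_commute indicator_def)
          next
            case False
            then have "indicator ?B \<omega> = (1::real)" using \<omega> by simp
            moreover have "\<bar>g (\<xi> n \<omega>) - g lim_meas\<bar> \<le> C + C" using C[OF fin[OF \<omega>]] C[OF lim_meas] by linarith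
            ultimately show ?thesis using e by simp
          qed
        qed
        also have "\<dots> = e / 2 + 2 * C * measure (Q n) ?B"
          using B by (subst Bochner_Integration.integral_add) (auto simp: emeasure_eq_measure prob_space)
        finally show ?case using elim(1) by (simp add: dist_real_def)
      qed
    qed
  qed
qed

section \<open>The discrete torus as a regular graph\<close>

definition cycle_succ :: "nat \<Rightarrow> nat \<Rightarrow> nat" where
  "cycle_succ n a = (if a = n then 1 else a + 1)"

definition cycle_pred :: "nat \<Rightarrow> nat \<Rightarrow> nat" where
  "cycle_pred n a = (if a = 1 then n else a - 1)"

lemma mod_eq_succ_iff:
  assumes "2 \<le> n" "a \<in> {1..n}" "b \<in> {1..n}"
  shows "b mod n = (a + 1) mod n \<longleftrightarrow> b = cycle_succ n a"
proof (cases "a = n")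
  case True
  have "(n + 1) mod n = 1" using assms(1) by (metis Suc_eq_plus1 Suc_times_mod_eq mult.right_neutral numeral_2_eq_2 Suc_le_eq)
  then show ?thesis using True assms by (cases "b = n") (auto simp: cycle_succ_def)
next
  case False
  then have a: "a < n" using assms by auto
  show ?thesis
  proof (cases "a + 1 = n")
    case True
    then show ?thesis using assms a by (cases "b = n") (auto simp: cycle_succ_def)
  next
    case False
    then show ?thesis using assms a by (cases "b = n") (auto simp: cycle_succ_def)
  qed
qed

lemma cycle_adj_iff:
  assumes "2 \<le> n" "a \<in> {1..n}"
  shows "cycle_adj n a b \<longleftrightarrow> b = cycle_succ n a \<or> b = cycle_pred n a"
proof -
  have "cycle_succ n a \<in> {1..n}" "cycle_pred n a \<in> {1..n}" "cycle_succ n a \<noteq> a" "cycle_pred n a \<noteq> a"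
    using assms by (auto simp: cycle_succ_def cycle_pred_def)
  moreover have "a = cycle_succ n b \<longleftrightarrow> b = cycle_pred n a" if "b \<in> {1..n}"
    using assms that by (auto simp: cycle_succ_def cycle_pred_def)
  ultimately show ?thesis
    using mod_eq_succ_iff[OF assms] mod_eq_succ_iff[OF assms(1) _ assms(2)]
    unfolding cycle_adj_def using assms(2) by metis
qed

lemma cycle_adj_sym: "cycle_adj n a b \<longleftrightarrow> cycle_adj n b a"
  by (auto simp: cycle_adj_def)

definition vec_upd :: "'a ^ 'd \<Rightarrow> 'd \<Rightarrow> 'a \<Rightarrow> 'a ^ 'd" where
  "vec_upd v i x = (\<chi> j. if j = i then x else v $ j)"

lemma vec_upd_nth [simp]: "vec_upd v i x $ j = (if j = i then x else v $ j)"
  by (simp add: vec_upd_def)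

lemma vec_upd_eq_iff: "u = vec_upd v i x \<longleftrightarrow> u $ i = x \<and> (\<forall>j. j \<noteq> i \<longrightarrow> u $ j = v $ j)"
  by (auto simp: vec_eq_iff)

lemma torus_verts_bij:
  "bij_betw (\<lambda>v::nat ^ 'd. \<lambda>i. v $ i) (torus_verts n) (UNIV \<rightarrow>\<^sub>E {1..n})"
proof (rule bij_betwI[where g="\<lambda>f. \<chi> i. f i"])
  show "(\<lambda>v::nat ^ 'd. \<lambda>i. v $ i) \<in> torus_verts n \<rightarrow> (UNIV \<rightarrow>\<^sub>E {1..n})"
    by (auto simp: torus_verts_def)
  show "(\<lambda>f. \<chi> i. f i) \<in> (UNIV \<rightarrow>\<^sub>E {1..n}) \<rightarrow> (torus_verts n :: (nat ^ 'd) set)"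
    by (auto simp: torus_verts_def PiE_def Pi_def)
qed (auto simp: vec_eq_iff)

lemma finite_torus_verts: "finite (torus_verts n)"
  using torus_verts_bij[of n] by (rule bij_betw_finite[THEN iffD2]) (intro finite_PiE, auto)

lemma card_torus_verts: "card (torus_verts n :: (nat ^ 'd) set) = n ^ CARD('d)"
  using bij_betw_same_card[OF torus_verts_bij[of n, where 'd='d]] by (simp add: card_PiE)

text \<open>
  For \<open>n = 2\<close> the two neighbours along a coordinate coincide.
\<close>

definition torus_degree :: "'d itself \<Rightarrow> nat \<Rightarrow> nat" where
  "torus_degree _ n = (if n = 2 then 1 else 2) * CARD('d)"

definition torus_step :: "nat \<Rightarrow> nat ^ 'd \<Rightarrow> 'd \<times> bool \<Rightarrow> nat ^ 'd" where
  "torus_step n v = (\<lambda>(i, b). vec_upd v i (if b then cycle_succ n (v $ i) else cycle_pred n (v $ i)))"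

lemma torus_verts_upd: "v \<in> torus_verts n \<Longrightarrow> a \<in> {1..n} \<Longrightarrow> vec_upd v i a \<in> torus_verts n"
  by (auto simp: torus_verts_def)

lemma torus_adj_iff:
  fixes v :: "nat ^ 'd"
  assumes n: "2 \<le> n" and v: "v \<in> torus_verts n"
  shows "torus_adj n v u \<longleftrightarrow> (\<exists>i b. u = torus_step n v (i, b))"
proof -
  have vi: "v $ i \<in> {1..n}" for i using v by (simp add: torus_verts_def)
  have "torus_adj n v u \<longleftrightarrow> u \<in> torus_verts n \<and>
      (\<exists>i. (u $ i = cycle_succ n (v $ i) \<or> u $ i = cycle_pred n (v $ i)) \<and> (\<forall>j. j \<noteq> i \<longrightarrow> u $ j = v $ j))"
    using v by (simp add: torus_adj_def cycle_adj_iff[OF n vi] eq_commute[of "v $ _" "u $ _"])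
  also have "\<dots> \<longleftrightarrow> u \<in> torus_verts n \<and> (\<exists>i b. u = torus_step n v (i, b))"
    unfolding torus_step_def prod.case vec_upd_eq_iff by (metis (full_types))
  also have "\<dots> \<longleftrightarrow> (\<exists>i b. u = torus_step n v (i, b))"
  proof -
    have "torus_step n v (i, b) \<in> torus_verts n" for i b
      using n vi[of i] unfolding torus_step_def prod.case
      by (intro torus_verts_upd[OF v]) (auto simp: cycle_succ_def cycle_pred_def)
    then show ?thesis by auto
  qed
  finally show ?thesis .
qed

lemma inj_torus_step:
  fixes v :: "nat ^ 'd"
  assumes n: "3 \<le> n" and v: "v \<in> torus_verts n"
  shows "inj (torus_step n v)"
proof (rule injI)
  have vi: "v $ i \<in> {1..n}" for i using v by (simp add: torus_verts_def)
  have ne: "cycle_succ n (v $ i) \<noteq> v $ i" "cycle_pred n (v $ i) \<noteq> v $ i" "cycle_succ n (v $ i) \<noteq> cycle_pred n (v $ i)" for i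
    using n vi[of i] by (auto simp: cycle_succ_def cycle_pred_def)
  fix p q assume eq: "torus_step n v p = torus_step n v q"
  obtain i b j c where pq: "p = (i, b)" "q = (j, c)" by (metis surj_pair)
  have "torus_step n v p $ i = torus_step n v q $ i" using eq by simp
  then have "i = j" using ne[of i] by (auto simp: pq torus_step_def split: if_splits)
  with \<open>torus_step n v p $ i = torus_step n v q $ i\<close> have "b = c"
    using ne(3)[of i] by (auto simp: pq torus_step_def split: if_splits)
  then show "p = q" using \<open>i = j\<close> pq by simp
qed

lemma torus_nbrs:
  fixes v :: "nat ^ 'd"
  assumes "2 \<le> n" "v \<in> torus_verts n"
  shows "{u. torus_adj n v u} = range (torus_step n v)"
  using torus_adj_iff[OF assms] by (auto simp: image_iff)

lemma torus_vertex_degree: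
  fixes v :: "nat ^ 'd"
  assumes n: "2 \<le> n" and v: "v \<in> torus_verts n"
  shows "vertex_degree (torus_adj n) v = torus_degree TYPE('d) n"
proof (cases "n = 2")
  case False
  then have "inj (torus_step n v)" using n v by (intro inj_torus_step) auto
  then have "card (range (torus_step n v)) = CARD('d \<times> bool)" by (rule card_image)
  then show ?thesis using False by (simp add: vertex_degree_def torus_nbrs[OF n v] torus_degree_def mult.commute)
next
  case True
  have vi: "v $ i \<in> {1..2}" for i using v True by (simp add: torus_verts_def)
  let ?g = "\<lambda>i. torus_step n v (i, True)"
  have "cycle_succ n (v $ i) = cycle_pred n (v $ i)" for i
    using vi[of i] True by (auto simp: cycle_succ_def cycle_pred_def)
  then have "torus_step n v (i, b) = ?g i" for i b by (simp add: torus_step_def)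
  then have "range (torus_step n v) = range ?g" by (force simp: image_iff)
  moreover have "inj ?g"
  proof (rule injI)
    fix i j assume "?g i = ?g j"
    then have "?g i $ i = ?g j $ i" by simp
    moreover have "cycle_succ n (v $ i) \<noteq> v $ i" using vi[of i] True by (auto simp: cycle_succ_def)
    ultimately show "i = j" by (auto simp: torus_step_def split: if_splits)
  qed
  ultimately have "card {u. torus_adj n v u} = CARD('d)"
    unfolding torus_nbrs[OF n v] by (simp add: card_image)
  then show ?thesis
    using True by (simp add: vertex_degree_def torus_degree_def)
qed

lemma relpowp_sym:
  assumes "\<And>x y. E x y \<Longrightarrow> E y x"
  shows "(E ^^ k) x y \<Longrightarrow> (E ^^ k) y x"
proof (induction k arbitrary: x)
  case (Suc k)
  then obtain z where "E x z" "(E ^^ k) z y" by (metis relpowp_Suc_D2)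
  then show ?case using Suc.IH[of z] assms[of x z] by (intro relpowp_Suc_I[of k E y z x]) auto
qed auto

lemma torus_adj_sym: "torus_adj n u v \<Longrightarrow> torus_adj n v u"
  unfolding torus_adj_def using cycle_adj_sym by metis

lemma torus_move_up:
  fixes v :: "nat ^ 'd"
  assumes n: "2 \<le> n" and v: "v \<in> torus_verts n" and b: "v $ i \<le> b" "b \<le> n"
  shows "(torus_adj n ^^ (b - v $ i)) v (vec_upd v i b)"
  using b
proof (induction b rule: dec_induct)
  case base
  have "vec_upd v i (v $ i) = v" by (simp add: vec_eq_iff)
  then show ?case by simp
next
  case (step b)
  have v1: "1 \<le> v $ i" using v by (auto simp: torus_verts_def)
  have "1 \<le> b" using step v1 by simp
  then have "torus_adj n (vec_upd v i b) (vec_upd v i (Suc b))"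
    using v step by (auto simp: torus_adj_def cycle_adj_def torus_verts_def intro!: exI[of _ i])
  moreover have "(torus_adj n ^^ (b - v $ i)) v (vec_upd v i b)" using step by simp
  moreover have "Suc b - v $ i = Suc (b - v $ i)" using step by simp
  ultimately show ?case by (auto intro: relpowp_Suc_I)
qed

lemma torus_move:
  fixes v :: "nat ^ 'd"
  assumes n: "2 \<le> n" and v: "v \<in> torus_verts n" and b: "b \<in> {1..n}"
  shows "\<exists>k\<le>n. (torus_adj n ^^ k) v (vec_upd v i b)"
proof (cases "v $ i \<le> b")
  case True
  then show ?thesis using torus_move_up[OF n v True] b by (intro exI[of _ "b - v $ i"]) auto
next
  case False
  have vi: "v $ i \<le> n" using v by (auto simp: torus_verts_def)
  let ?w = "vec_upd v i b"
  have "(torus_adj n ^^ (v $ i - ?w $ i)) ?w (vec_upd ?w i (v $ i))"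
    using False vi by (intro torus_move_up[OF n torus_verts_upd[OF v b]]) auto
  moreover have "vec_upd ?w i (v $ i) = v" by (simp add: vec_eq_iff)
  ultimately have "(torus_adj n ^^ (v $ i - b)) v ?w"
    using relpowp_sym[of "torus_adj n", OF torus_adj_sym] by simp
  then show ?thesis using vi by (intro exI[of _ "v $ i - b"]) auto
qed

text \<open>
  The coordinates are adjusted one after the other, with at most \<open>n\<close> steps for each.
\<close>

lemma torus_reachable:
  fixes u v :: "nat ^ 'd"
  assumes n: "2 \<le> n" and u: "u \<in> torus_verts n" and v: "v \<in> torus_verts n"
  shows "\<exists>k\<le>CARD('d) * n. (torus_adj n ^^ k) u v"
proof -
  have "\<exists>k\<le>card S * n. (torus_adj n ^^ k) u (\<chi> j. if j \<in> S then v $ j else u $ j)" for S :: "'d set"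
    using finite[of S]
  proof (induction S rule: finite_induct)
    case empty
    have "(\<chi> j. if j \<in> {} then v $ j else u $ j) = u" by (simp add: vec_eq_iff)
    then show ?case by (intro exI[of _ 0]) simp
  next
    case (insert i S)
    let ?w = "\<chi> j. if j \<in> S then v $ j else u $ j"
    obtain k where k: "k \<le> card S * n" "(torus_adj n ^^ k) u ?w" using insert by auto
    have "?w \<in> torus_verts n" "v $ i \<in> {1..n}" using u v by (auto simp: torus_verts_def)
    then obtain l where l: "l \<le> n" "(torus_adj n ^^ l) ?w (vec_upd ?w i (v $ i))" using torus_move[OF n] by blast
    have "(torus_adj n ^^ (k + l)) u (vec_upd ?w i (v $ i))"
      unfolding relpowp_add using k(2) l(2) by (rule relcomppI)
    moreover have "vec_upd ?w i (v $ i) = (\<chi> j. if j \<in> insert i S then v $ j else u $ j)"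
      by (auto simp: vec_eq_iff)
    ultimately show ?case using k(1) l(1) insert.hyps by (intro exI[of _ "k + l"]) auto
  qed
  from this[of UNIV] show ?thesis by (simp add: vec_lambda_eta)
qed

lemma regular_graph_torus:
  assumes n: "2 \<le> n"
  shows "regular_graph (torus_verts n :: (nat ^ 'd) set) (torus_adj n) (torus_degree TYPE('d) n) (CARD('d) * n)"
proof
  show "torus_verts n \<noteq> ({} :: (nat ^ 'd) set)"
    using n by (auto simp: torus_verts_def intro!: exI[of _ "\<chi> i. 1"])
  show "\<not> torus_adj n v v" for v :: "nat ^ 'd" by (auto simp: torus_adj_def cycle_adj_def)
  show "torus_adj n u v \<Longrightarrow> u \<in> torus_verts n" for u v :: "nat ^ 'd" by (simp add: torus_adj_def)
qed (use torus_adj_sym n in \<open>auto simp: finite_torus_verts torus_vertex_degree torus_degree_def intro: torus_reachable\<close>)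

section \<open>Characters of the torus\<close>

text \<open>
  Real characters with an arbitrary phase: sines are included and products are sums of two characters.
\<close>

definition character :: "('d \<Rightarrow> int) \<Rightarrow> real \<Rightarrow> real ^ 'd \<Rightarrow> real" where
  "character k \<theta> x = cos (2 * pi * (\<Sum>i\<in>UNIV. of_int (k i) * x $ i) + \<theta>)"

abbreviation torus_character :: "nat \<Rightarrow> ('d \<Rightarrow> int) \<Rightarrow> real \<Rightarrow> nat ^ 'd \<Rightarrow> real" where
  "torus_character n k \<theta> v \<equiv> character k \<theta> (torus_point v /\<^sub>R real n)"

text \<open>
  Stepping across the seam changes a coordinate by a further multiple of \<open>n\<close>, which changes the argument
  of the cosine by a multiple of \<open>2 \<pi>\<close>.
\<close>

lemma character_step:
  fixes v :: "nat ^ 'd" and k :: "'d \<Rightarrow> int" and \<theta> :: real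
  assumes n: "2 \<le> n" and v: "v \<in> torus_verts n"
  defines "\<alpha> \<equiv> 2 * pi * (\<Sum>i\<in>UNIV. of_int (k i) * (torus_point v /\<^sub>R real n) $ i) + \<theta>"
  shows "torus_character n k \<theta> (torus_step n v (i, b)) = cos (\<alpha> + (if b then 1 else -1) * (2 * pi * of_int (k i) / real n))"
proof -
  have vi: "v $ i \<in> {1..n}" using v by (simp add: torus_verts_def)
  obtain z :: int where z: "real (torus_step n v (i, b) $ i) = real (v $ i) + (if b then 1 else -1) + of_int z * real n"
  proof (cases b)
    case True
    then show ?thesis
      using that[of "if v $ i = n then -1 else 0"] by (auto simp: torus_step_def cycle_succ_def)
  next
    case False
    then show ?thesis
      using that[of "if v $ i = 1 then 1 else 0"] vi by (auto simp: torus_step_def cycle_pred_def of_nat_diff)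
  qed
  have "(\<Sum>j\<in>UNIV. of_int (k j) * (torus_point (torus_step n v (i, b)) /\<^sub>R real n) $ j)
     = (\<Sum>j\<in>UNIV. of_int (k j) * (torus_point v /\<^sub>R real n) $ j
         + (if j = i then of_int (k i) * ((if b then 1 else -1) / real n + of_int z) else 0))"
  proof (rule sum.cong[OF refl])
    fix j
    show "of_int (k j) * (torus_point (torus_step n v (i, b)) /\<^sub>R real n) $ j
       = of_int (k j) * (torus_point v /\<^sub>R real n) $ j
         + (if j = i then of_int (k i) * ((if b then 1 else -1) / real n + of_int z) else 0)"
    proof (cases "j = i")
      case True
      have "(torus_point (torus_step n v (i, b)) /\<^sub>R real n) $ i
          = (torus_point v /\<^sub>R real n) $ i + ((if b then 1 else -1) / real n + of_int z)"
        using z n by (simp add: torus_point_def field_simps)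
      then show ?thesis using True by (simp add: distrib_left)
    next
      case False
      then show ?thesis by (simp add: torus_point_def torus_step_def)
    qed
  qed
  also have "\<dots> = (\<Sum>j\<in>UNIV. of_int (k j) * (torus_point v /\<^sub>R real n) $ j)
       + of_int (k i) * ((if b then 1 else -1) / real n + of_int z)"
    by (simp add: sum.distrib)
  finally have "2 * pi * (\<Sum>j\<in>UNIV. of_int (k j) * (torus_point (torus_step n v (i, b)) /\<^sub>R real n) $ j) + \<theta>
     = (\<alpha> + (if b then 1 else -1) * (2 * pi * of_int (k i) / real n)) + 2 * pi * of_int (k i * z)"
    by (simp add: \<alpha>_def algebra_simps)
  then have "torus_character n k \<theta> (torus_step n v (i, b))
     = cos ((\<alpha> + (if b then 1 else -1) * (2 * pi * of_int (k i) / real n)) + 2 * pi * of_int (k i * z))"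
    unfolding character_def by (rule arg_cong)
  also have "\<dots> = cos (\<alpha> + (if b then 1 else -1) * (2 * pi * of_int (k i) / real n))"
    by (simp only: cos_add sin_int_2pin cos_int_2pin) simp
  finally show ?thesis .
qed

lemma character_difference:
  fixes v :: "nat ^ 'd"
  assumes n: "2 \<le> n" and adj: "torus_adj n v u"
  shows "\<bar>torus_character n k \<theta> v - torus_character n k \<theta> u\<bar> \<le> 2 * pi * (\<Sum>i\<in>UNIV. \<bar>of_int (k i)\<bar>) / real n"
proof -
  have v: "v \<in> torus_verts n" using adj by (simp add: torus_adj_def)
  obtain i b where u: "u = torus_step n v (i, b)" using adj torus_adj_iff[OF n v] by blast
  have lip: "\<bar>cos x - cos y\<bar> \<le> \<bar>x - y\<bar>" for x y :: real
  proof -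
    have "\<bar>cos x - cos y\<bar> = 2 * (\<bar>sin ((x + y) / 2)\<bar> * \<bar>sin ((y - x) / 2)\<bar>)"
      by (simp add: cos_diff_cos abs_mult)
    also have "\<dots> \<le> 2 * (1 * \<bar>(y - x) / 2\<bar>)"
      by (intro mult_left_mono mult_mono abs_sin_x_le_abs_x) auto
    finally show ?thesis by simp
  qed
  have "\<bar>torus_character n k \<theta> v - torus_character n k \<theta> u\<bar> \<le> \<bar>2 * pi * of_int (k i) / real n\<bar>"
    unfolding u character_step[OF n v] by (subst character_def, rule order_trans[OF lip]) (simp add: abs_mult)
  also have "\<dots> = 2 * pi * \<bar>of_int (k i)\<bar> / real n" by (simp add: abs_mult)
  also have "\<dots> \<le> 2 * pi * (\<Sum>i\<in>UNIV. \<bar>of_int (k i)\<bar>) / real n"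
    by (intro divide_right_mono mult_left_mono member_le_sum) auto
  finally show ?thesis .
qed

text \<open>
  The difference between 1 and the eigenvalue of a character, see \<open>character_eigenfunction\<close>.
\<close>

definition character_gap :: "nat \<Rightarrow> ('d::finite \<Rightarrow> int) \<Rightarrow> real" where
  "character_gap n k = (\<Sum>i\<in>UNIV. 1 - cos (2 * pi * of_int (k i) / real n)) / CARD('d)"

lemma character_eigenfunction:
  fixes v :: "nat ^ 'd"
  assumes n: "3 \<le> n" and v: "v \<in> torus_verts n"
  shows "regular_graph.avg (torus_adj n) (torus_degree TYPE('d) n) (torus_character n k \<theta>) v
    = (1 - character_gap n k) * torus_character n k \<theta> v"
proof -
  have n2: "2 \<le> n" using n by simp
  interpret regular_graph "torus_verts n :: (nat ^ 'd) set" "torus_adj n" "torus_degree TYPE('d) n" "CARD('d) * n"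
    by (rule regular_graph_torus[OF n2])
  define \<alpha> where "\<alpha> = 2 * pi * (\<Sum>i\<in>UNIV. of_int (k i) * (torus_point v /\<^sub>R real n) $ i) + \<theta>"
  have fv: "torus_character n k \<theta> v = cos \<alpha>" by (simp add: character_def \<alpha>_def)
  have "(\<Sum>u | torus_adj n v u. torus_character n k \<theta> u)
      = (\<Sum>p\<in>UNIV. torus_character n k \<theta> (torus_step n v p))"
    unfolding torus_nbrs[OF n2 v] by (rule sum.reindex_cong[OF inj_torus_step[OF n v]]) auto
  also have "\<dots> = (\<Sum>i\<in>UNIV. \<Sum>b\<in>UNIV. torus_character n k \<theta> (torus_step n v (i, b)))"
    by (simp add: sum.cartesian_product)
  also have "\<dots> = (\<Sum>i\<in>UNIV. 2 * cos \<alpha> * cos (2 * pi * of_int (k i) / real n))"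
  proof (intro sum.cong refl)
    fix i
    have "torus_character n k \<theta> (torus_step n v (i, b))
        = cos (\<alpha> + (if b then 1 else -1) * (2 * pi * of_int (k i) / real n))" for b
      unfolding \<alpha>_def by (rule character_step[OF n2 v])
    then show "(\<Sum>b\<in>UNIV. torus_character n k \<theta> (torus_step n v (i, b)))
        = 2 * cos \<alpha> * cos (2 * pi * of_int (k i) / real n)"
      by (simp add: UNIV_bool cos_add cos_diff)
  qed
  finally have "avg (torus_character n k \<theta>) v
      = (\<Sum>i\<in>UNIV. cos (2 * pi * of_int (k i) / real n)) / CARD('d) * cos \<alpha>"
    unfolding avg_def using n by (simp add: torus_degree_def sum_distrib_left[symmetric] field_simps)
  then show ?thesis
    unfolding fv character_gap_def by (simp add: sum_subtractf field_simps)
qed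

lemma character_gap_upper:
  "character_gap n (k :: 'd::finite \<Rightarrow> int) \<le> 2 * pi\<^sup>2 * (\<Sum>i\<in>UNIV. (of_int (k i))\<^sup>2) / (real n)\<^sup>2"
proof -
  have "1 - cos x \<le> x\<^sup>2 / 2" for x :: real
    using abs_sin_x_le_abs_x[of "x / 2"] cos_double_sin[of "x / 2"] power_mono[OF abs_sin_x_le_abs_x[of "x / 2"], of 2]
    by (simp add: power_divide)
  then have "(\<Sum>i\<in>UNIV. 1 - cos (2 * pi * of_int (k i) / real n)) \<le> (\<Sum>i\<in>UNIV. (2 * pi * of_int (k i) / real n)\<^sup>2 / 2)"
    by (intro sum_mono)
  also have "\<dots> = 2 * pi\<^sup>2 * (\<Sum>i\<in>UNIV. (of_int (k i))\<^sup>2) / (real n)\<^sup>2"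
    by (simp add: power_mult_distrib power_divide sum_distrib_left sum_divide_distrib mult.assoc)
  finally have *: "(\<Sum>i\<in>UNIV. 1 - cos (2 * pi * of_int (k i) / real n)) \<le> 2 * pi\<^sup>2 * (\<Sum>i\<in>UNIV. (of_int (k i))\<^sup>2) / (real n)\<^sup>2" .
  have "character_gap n k \<le> (\<Sum>i\<in>UNIV. 1 - cos (2 * pi * of_int (k i) / real n)) / 1"
    unfolding character_gap_def by (rule divide_left_mono) (auto intro!: sum_nonneg simp: Suc_le_eq)
  then show ?thesis using * by simp
qed

lemma character_gap_pos:
  fixes k :: "'d::finite \<Rightarrow> int"
  assumes i: "k i \<noteq> 0" "\<bar>k i\<bar> < int n"
  shows "0 < character_gap n k"
proof -
  have "cos (2 * pi * of_int (k i) / real n) \<noteq> 1"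
  proof
    assume "cos (2 * pi * of_int (k i) / real n) = 1"
    then obtain m :: int where "2 * pi * of_int (k i) / real n = of_int m * 2 * pi"
      unfolding cos_one_2pi_int by blast
    then have "of_int (k i) = of_int m * real n" using i by (simp add: field_simps)
    then have "k i = m * int n" by (metis of_int_eq_iff of_int_mult of_int_of_nat_eq)
    moreover from this i(1) have "\<bar>m\<bar> \<ge> 1" by auto
    ultimately show False using i(2) by (simp add: abs_mult mult_le_cancel_right1) (metis abs_ge_zero mult_le_cancel_right1 not_less of_nat_0_le_iff)
  qed
  then have "0 < 1 - cos (2 * pi * of_int (k i) / real n)"
    using cos_le_one[of "2 * pi * of_int (k i) / real n"] by linarith
  then have "0 < (\<Sum>i\<in>UNIV. 1 - cos (2 * pi * of_int (k i) / real n))"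
    by (intro sum_pos2[of _ i]) auto
  then show ?thesis unfolding character_gap_def by (intro divide_pos_pos) auto
qed

section \<open>Trigonometric polynomials\<close>

inductive trig_poly :: "(real ^ 'd \<Rightarrow> real) \<Rightarrow> bool" where
  trig_character: "trig_poly (character k \<theta>)"
| trig_add: "trig_poly f \<Longrightarrow> trig_poly g \<Longrightarrow> trig_poly (\<lambda>x. f x + g x)"
| trig_scale: "trig_poly f \<Longrightarrow> trig_poly (\<lambda>x. c * f x)"

lemma trig_const: "trig_poly (\<lambda>x :: real ^ 'd. c)"
  using trig_scale[OF trig_character[of "\<lambda>_::'d. 0" 0], of c] by (simp add: character_def)

lemma character_mult:
  "character k \<theta> x * character l \<phi> x
    = (1 / 2) * character (\<lambda>i. k i - l i) (\<theta> - \<phi>) x + (1 / 2) * character (\<lambda>i. k i + l i) (\<theta> + \<phi>) x"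
proof -
  have "cos a * cos b = (1 / 2) * cos (a - b) + (1 / 2) * cos (a + b)" for a b :: real
    by (simp add: cos_add cos_diff field_simps)
  then show ?thesis
    unfolding character_def
    by (simp only:) (simp add: algebra_simps sum.distrib sum_subtractf)
qed

lemma trig_mult:
  assumes "trig_poly f" "trig_poly g"
  shows "trig_poly (\<lambda>x. f x * g x)"
  using assms(1)
proof induction
  case (trig_character k \<theta>)
  show ?case using assms(2)
  proof induction
    case (trig_character l \<phi>)
    show ?case unfolding character_mult by (intro trig_poly.intros)
  next
    case (trig_add g h)
    then show ?case by (simp add: distrib_left trig_poly.trig_add)
  next
    case (trig_scale g c)
    then have "trig_poly (\<lambda>x. c * (character k \<theta> x * g x))" by (intro trig_poly.trig_scale)
    then show ?case by (simp add: mult.left_commute)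
  qed
next
  case (trig_add f h)
  then show ?case by (simp add: distrib_right trig_poly.trig_add)
next
  case (trig_scale f c)
  then have "trig_poly (\<lambda>x. c * (f x * g x))" by (intro trig_poly.trig_scale)
  then show ?case by (simp add: mult.assoc)
qed

lemma trig_sum: "finite I \<Longrightarrow> (\<And>i. i \<in> I \<Longrightarrow> trig_poly (f i)) \<Longrightarrow> trig_poly (\<lambda>x. \<Sum>i\<in>I. f i x)"
  by (induction I rule: finite_induct) (auto intro: trig_const trig_add)

text \<open>
  The quotient map from the cube to the torus, realised as a product of unit circles.
\<close>

definition wrap :: "real ^ 'd \<Rightarrow> complex ^ 'd" where
  "wrap x = (\<chi> i. cis (2 * pi * x $ i))"

lemma continuous_on_wrap: "continuous_on S wrap"
  unfolding wrap_def by (intro continuous_intros)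

lemma trig_wrap_component:
  assumes "b \<in> (Basis :: (complex ^ 'd) set)"
  shows "trig_poly (\<lambda>x. wrap x \<bullet> b)"
proof -
  obtain i u where b: "b = axis i u" "u \<in> Basis" using assms by (auto simp: Basis_vec_def)
  have sum: "(\<Sum>j\<in>UNIV. of_int (if j = i then 1 else 0) * x $ j) = x $ i" for x :: "real ^ 'd"
    by (simp add: if_distrib if_distribR cong: if_cong)
  have "u = 1 \<or> u = \<i>" using b(2) by (simp add: Basis_complex_def)
  then show ?thesis
  proof
    assume "u = 1"
    then have "(\<lambda>x. wrap x \<bullet> b) = character (\<lambda>j. if j = i then 1 else 0) 0"
      unfolding b(1) inner_axis character_def sum by (simp add: fun_eq_iff wrap_def)
    then show ?thesis by (simp add: trig_character)
  next
    assume "u = \<i>"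
    then have "(\<lambda>x. wrap x \<bullet> b) = character (\<lambda>j. if j = i then 1 else 0) (- (pi / 2))"
      unfolding b(1) inner_axis character_def sum by (simp add: fun_eq_iff wrap_def cos_diff)
    then show ?thesis by (simp add: trig_character)
  qed
qed

lemma trig_real_polynomial:
  fixes g :: "complex ^ 'd \<Rightarrow> real"
  assumes "real_polynomial_function g"
  shows "trig_poly (\<lambda>x. g (wrap x))"
  using assms
proof induction
  case (linear f)
  then interpret bounded_linear f .
  have "f (wrap x) = (\<Sum>b\<in>Basis. f b * (wrap x \<bullet> b))" for x
  proof -
    have "f (wrap x) = f (\<Sum>b\<in>Basis. (wrap x \<bullet> b) *\<^sub>R b)" by (simp add: euclidean_representation)
    also have "\<dots> = (\<Sum>b\<in>Basis. f b * (wrap x \<bullet> b))"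
      by (simp add: sum scaleR mult.commute)
    finally show ?thesis .
  qed
  then show ?case by (simp add: trig_sum trig_scale trig_wrap_component)
qed (auto intro: trig_const trig_add trig_mult)

lemma cis_eq_on_unit_interval:
  fixes a b :: real
  assumes "cis (2 * pi * a) = cis (2 * pi * b)" "0 \<le> a" "a \<le> 1" "0 \<le> b" "b \<le> 1" "a \<noteq> b"
  shows "a \<in> {0, 1} \<and> b \<in> {0, 1}"
proof -
  have "cis (2 * pi * a - 2 * pi * b) = 1"
    using assms(1) by (simp add: cis_divide[symmetric])
  then have "cos (2 * pi * a - 2 * pi * b) = 1" by (simp add: complex_eq_iff)
  then obtain m :: int where "2 * pi * a - 2 * pi * b = of_int m * 2 * pi"
    unfolding cos_one_2pi_int by blast
  then have "2 * pi * (a - b) = 2 * pi * of_int m" by (simp add: algebra_simps)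
  then have m: "a - b = of_int m" by simp
  then have "m \<noteq> 0" "\<bar>real_of_int m\<bar> \<le> 1" using assms by auto
  then have "m = 1 \<or> m = -1" by linarith
  then show ?thesis using m assms by auto
qed

lemma sum_Basis_nth [simp]: "(\<Sum>b\<in>(Basis :: (real ^ 'd) set). b $ i) = 1"
proof -
  have i: "axis i 1 \<in> (Basis :: (real ^ 'd) set)" by (simp add: axis_in_Basis_iff)
  have "b $ i = (if b = axis i 1 then 1 else 0)" if "b \<in> (Basis :: (real ^ 'd) set)" for b
    using inner_Basis[OF that i] by (simp add: inner_axis)
  then have "(\<Sum>b\<in>(Basis :: (real ^ 'd) set). b $ i)
      = (\<Sum>b\<in>(Basis :: (real ^ 'd) set). if b = axis i 1 then 1 else 0)"
    by (rule sum.cong[OF refl])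
  also have "\<dots> = 1" using i by (subst sum.delta) auto
  finally show ?thesis .
qed

definition unit_cube :: "(real ^ 'd) set" where
  "unit_cube = {x. \<forall>i. 0 \<le> x $ i \<and> x $ i \<le> 1}"

lemma unit_cube_cbox: "unit_cube = cbox 0 One"
  by (auto simp: unit_cube_def mem_box_cart)

text \<open>
  A continuous function on the cube that vanishes on the boundary factors through the product of circles,
  because \<open>wrap\<close> identifies boundary points only. The factor is continuous because the cube is compact, and
  polynomials on the product of circles, which are dense, pull back to trigonometric polynomials.
\<close>

lemma trig_poly_uniform_approx:
  fixes f :: "real ^ 'd \<Rightarrow> real"
  assumes f: "continuous_on unit_cube f" and bdry: "\<And>x i. x \<in> unit_cube \<Longrightarrow> x $ i \<in> {0, 1} \<Longrightarrow> f x = 0"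
    and e: "0 < e"
  obtains p where "trig_poly p" "\<And>x. x \<in> unit_cube \<Longrightarrow> \<bar>f x - p x\<bar> < e"
proof -
  have compact: "compact (unit_cube :: (real ^ 'd) set)" unfolding unit_cube_cbox by (rule compact_cbox)
  have well_defined: "f x = f y" if "x \<in> unit_cube" "y \<in> unit_cube" "wrap x = wrap y" for x y
  proof (cases "x = y")
    case False
    then obtain i where i: "x $ i \<noteq> y $ i" by (auto simp: vec_eq_iff)
    have "cis (2 * pi * x $ i) = cis (2 * pi * y $ i)" using that(3) by (simp add: wrap_def vec_eq_iff)
    then have "x $ i \<in> {0, 1} \<and> y $ i \<in> {0, 1}"
      using that(1,2) i by (intro cis_eq_on_unit_interval) (auto simp: unit_cube_def)
    then show ?thesis using bdry that(1,2) by metis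
  qed simp
  define g where "g z = f (SOME x. x \<in> unit_cube \<and> wrap x = z)" for z
  have g: "g (wrap x) = f x" if "x \<in> unit_cube" for x
  proof -
    have "(SOME y. y \<in> unit_cube \<and> wrap y = wrap x) \<in> unit_cube \<and> wrap (SOME y. y \<in> unit_cube \<and> wrap y = wrap x) = wrap x"
      by (rule someI[of _ x]) (use that in simp)
    then show ?thesis unfolding g_def using well_defined that by blast
  qed
  let ?K = "wrap ` unit_cube :: (complex ^ 'd) set"
  have K: "compact ?K" by (rule compact_continuous_image[OF continuous_on_wrap compact])
  have "continuous_on ?K g"
  proof (subst continuous_on_closed_vimage[OF compact_imp_closed[OF K]], intro allI impI)
    fix B :: "real set" assume B: "closed B"
    have "closed (f -` B \<inter> unit_cube)"
      using f B continuous_on_closed_vimage[OF compact_imp_closed[OF compact], of f] by blast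
    then have "compact (unit_cube \<inter> (f -` B \<inter> unit_cube))" by (rule compact_Int_closed[OF compact])
    then have "compact (wrap ` (unit_cube \<inter> (f -` B \<inter> unit_cube)))"
      by (rule compact_continuous_image[OF continuous_on_wrap])
    moreover have "wrap ` (unit_cube \<inter> (f -` B \<inter> unit_cube)) = g -` B \<inter> ?K"
      using g by auto
    ultimately show "closed (g -` B \<inter> ?K)" using compact_imp_closed by metis
  qed
  then obtain q where q: "real_polynomial_function q" "\<And>z. z \<in> ?K \<Longrightarrow> \<bar>g z - q z\<bar> < e"
    using Stone_Weierstrass_real_polynomial_function[OF K _ e] by metis
  show thesis
  proof (rule that)
    show "trig_poly (\<lambda>x. q (wrap x))" by (rule trig_real_polynomial[OF q(1)])
    show "\<bar>f x - q (wrap x)\<bar> < e" if "x \<in> unit_cube" for x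
      using q(2)[of "wrap x"] g[OF that] that by auto
  qed
qed

section \<open>Riemann sums\<close>

abbreviation uniform_cube :: "(real ^ 'd) measure" where
  "uniform_cube \<equiv> uniform_measure lborel (cbox 0 One)"

lemma emeasure_unit_cbox: "emeasure lborel (cbox 0 One :: (real ^ 'd) set) = 1"
  by (simp add: emeasure_lborel_cbox_eq)

lemma prob_space_uniform_cube: "prob_space (uniform_cube :: (real ^ 'd) measure)"
  by (rule prob_space_uniform_measure) (simp_all add: emeasure_unit_cbox)

definition cell :: "nat \<Rightarrow> nat ^ 'd \<Rightarrow> (real ^ 'd) set" where
  "cell n v = {x. \<forall>i. (real (v $ i) - 1) / real n < x $ i \<and> x $ i \<le> real (v $ i) / real n}"

lemma cell_borel [measurable]: "cell n v \<in> sets borel"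
proof -
  have "cell n v = (\<Inter>i. {x. (real (v $ i) - 1) / real n < x $ i} \<inter> {x. x $ i \<le> real (v $ i) / real n})"
    by (auto simp: cell_def)
  also have "\<dots> \<in> sets borel"
    by (intro sets.countable_INT'' sets.Int) (auto intro!: borel_open borel_closed open_Collect_less closed_Collect_le continuous_intros)
  finally show ?thesis .
qed

lemma prob_cell:
  fixes v :: "nat ^ 'd"
  assumes n: "1 \<le> n" and v: "v \<in> torus_verts n"
  shows "measure uniform_cube (cell n v) = 1 / real n ^ CARD('d)"
proof -
  let ?a = "\<chi> i. (real (v $ i) - 1) / real n" and ?b = "\<chi> i. real (v $ i) / real n"
  have le: "?a $ i \<le> ?b $ i" for i using n by (simp add: field_simps)
  have le': "\<forall>b\<in>Basis. ?a \<bullet> b \<le> ?b \<bullet> b"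
    using le by (auto simp: Basis_vec_def inner_axis)
  have v1: "1 \<le> v $ i" "v $ i \<le> n" for i using v by (auto simp: torus_verts_def)
  have vol: "(\<Prod>b\<in>Basis. (?b - ?a) \<bullet> b) = (1 / real n) ^ CARD('d)"
  proof -
    have "(\<Prod>b\<in>Basis. (?b - ?a) \<bullet> b) = (\<Prod>b\<in>(Basis :: (real ^ 'd) set). 1 / real n)"
      using n by (intro prod.cong refl) (auto simp: Basis_vec_def inner_axis field_simps)
    then show ?thesis by simp
  qed
  have cube: "cell n v \<subseteq> cbox 0 One"
  proof
    fix x assume x: "x \<in> cell n v"
    have "0 \<le> x $ i \<and> x $ i \<le> 1" for i
    proof -
      have "0 \<le> (real (v $ i) - 1) / real n" "real (v $ i) / real n \<le> 1" using v1[of i] n by auto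
      then show ?thesis using x unfolding cell_def by (smt (verit, best) mem_Collect_eq)
    qed
    then show "x \<in> cbox 0 One" by (simp add: mem_box_cart)
  qed
  have "emeasure lborel (cell n v) = ennreal ((1 / real n) ^ CARD('d))"
  proof (rule antisym)
    have "emeasure lborel (cell n v) \<le> emeasure lborel (cbox ?a ?b)"
      by (intro emeasure_mono) (auto simp: cell_def mem_box_cart less_imp_le)
    then show "emeasure lborel (cell n v) \<le> ennreal ((1 / real n) ^ CARD('d))"
      using le' by (simp add: emeasure_lborel_cbox_eq vol)
    have "emeasure lborel (box ?a ?b) \<le> emeasure lborel (cell n v)"
      by (intro emeasure_mono) (auto simp: cell_def mem_box_cart less_imp_le)
    then show "ennreal ((1 / real n) ^ CARD('d)) \<le> emeasure lborel (cell n v)"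
      using le' by (simp add: emeasure_lborel_box_eq vol)
  qed
  note vol_cell = this
  have "emeasure uniform_cube (cell n v)
      = emeasure lborel (cbox 0 One \<inter> cell n v) / emeasure lborel (cbox 0 One :: (real ^ 'd) set)"
    by (rule emeasure_uniform_measure) auto
  also have "cbox 0 One \<inter> cell n v = cell n v" using cube by auto
  also have "emeasure lborel (cell n v) / emeasure lborel (cbox 0 One :: (real ^ 'd) set)
      = ennreal ((1 / real n) ^ CARD('d)) / ennreal 1"
    unfolding vol_cell emeasure_unit_cbox ennreal_1 ..
  also have "\<dots> = ennreal ((1 / real n) ^ CARD('d))"
    using divide_ennreal[of "(1 / real n) ^ CARD('d)" 1] by simp
  finally have "emeasure uniform_cube (cell n v) = ennreal ((1 / real n) ^ CARD('d))" .
  then show ?thesis by (simp add: measure_def power_one_over)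
qed

lemma AE_uniform_cube_interior: "AE x in (uniform_cube :: (real ^ 'd) measure). \<forall>i. 0 < x $ i \<and> x $ i < 1"
proof -
  interpret prob_space "uniform_cube :: (real ^ 'd) measure" by (rule prob_space_uniform_cube)
  have "emeasure uniform_cube (box 0 One :: (real ^ 'd) set) = 1"
    by (subst emeasure_uniform_measure) (auto simp: emeasure_unit_cbox Int_absorb1[OF box_subset_cbox] emeasure_lborel_box_eq)
  then have "AE x in uniform_cube. x \<in> (box 0 One :: (real ^ 'd) set)"
    by (intro AE_prob_1) (simp add: measure_def)
  then show ?thesis by eventually_elim (simp add: mem_box_cart)
qed

text \<open>
  The sum is the integral of a step function, constant on the cells, which converges to \<open>f\<close> pointwise in
  the interior of the cube.
\<close>

lemma riemann_sum_tendsto: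
  fixes f :: "real ^ 'd \<Rightarrow> real"
  assumes f: "continuous_on UNIV f" and C: "\<And>x. \<bar>f x\<bar> \<le> C"
  shows "(\<lambda>n. (\<Sum>v\<in>torus_verts n. f (torus_point v /\<^sub>R real n)) / real n ^ CARD('d)) \<longlonglongrightarrow> (\<integral>x. f x \<partial>uniform_cube)"
proof -
  interpret prob_space "uniform_cube :: (real ^ 'd) measure" by (rule prob_space_uniform_cube)
  define g where "g n x = (\<Sum>v\<in>torus_verts n. indicator (cell n v) x * f (torus_point v /\<^sub>R real n))" for n and x :: "real ^ 'd"
  define c where "c n x = (\<chi> i. nat \<lceil>real n * x $ i\<rceil>)" for n and x :: "real ^ 'd"
  have c: "g n x = f (torus_point (c n x) /\<^sub>R real n) \<and> (\<forall>i. \<bar>(torus_point (c n x) /\<^sub>R real n) $ i - x $ i\<bar> \<le> 1 / real n)"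
    if x: "\<forall>i. 0 < x $ i \<and> x $ i < 1" and n: "1 \<le> n" for n x
  proof -
    have ci: "real (c n x $ i) = of_int \<lceil>real n * x $ i\<rceil>" for i
    proof -
      have "0 < real n * x $ i" using x n by simp
      then show ?thesis by (simp add: c_def)
    qed
    have bounds: "real (c n x $ i) - 1 < real n * x $ i" "real n * x $ i \<le> real (c n x $ i)" for i
      unfolding ci by linarith+
    have verts: "c n x \<in> torus_verts n"
    proof -
      have "1 \<le> c n x $ i \<and> c n x $ i \<le> n" for i
      proof -
        have "0 < real n * x $ i" "real n * x $ i < real n" using x n by auto
        then have "0 < real (c n x $ i)" "real (c n x $ i) < real n + 1" using bounds[of i] by linarith+
        then show ?thesis by linarith
      qed
      then show ?thesis by (simp add: torus_verts_def)
    qed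
    have mem: "x \<in> cell n v \<longleftrightarrow> v = c n x" for v
    proof
      assume "x \<in> cell n v"
      then have "real (v $ i) - 1 < real n * x $ i \<and> real n * x $ i \<le> real (v $ i)" for i
        using n unfolding cell_def by (auto simp: field_simps)
      then have "real (v $ i) < real (c n x $ i) + 1 \<and> real (c n x $ i) < real (v $ i) + 1" for i
        using bounds[of i] by (smt (verit, best))
      then have "v $ i = c n x $ i" for i
        by (metis One_nat_def add.right_neutral add_Suc_right less_Suc_eq_le of_nat_1 of_nat_add of_nat_less_iff order_antisym)
      then show "v = c n x" by (simp add: vec_eq_iff)
    next
      assume "v = c n x"
      then show "x \<in> cell n v" using bounds n by (auto simp: cell_def field_simps)
    qed
    have "g n x = (\<Sum>v\<in>torus_verts n. if v = c n x then f (torus_point (c n x) /\<^sub>R real n) else 0)"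
      unfolding g_def by (intro sum.cong refl) (simp add: indicator_def mem)
    moreover have "\<bar>(torus_point (c n x) /\<^sub>R real n) $ i - x $ i\<bar> \<le> 1 / real n" for i
    proof -
      have "(torus_point (c n x) /\<^sub>R real n) $ i - x $ i = (real (c n x $ i) - real n * x $ i) / real n"
        using n by (simp add: torus_point_def field_simps)
      moreover have "\<bar>real (c n x $ i) - real n * x $ i\<bar> \<le> 1" using bounds[of i] by linarith
      ultimately show ?thesis by (simp add: abs_divide divide_right_mono)
    qed
    ultimately show ?thesis using verts by (simp add: finite_torus_verts)
  qed
  have f_meas: "f \<in> borel_measurable borel" using f by (rule borel_measurable_continuous_onI)
  have sets_eq: "sets uniform_cube = sets (borel :: (real ^ 'd) measure)" by simp
  have g_meas: "g n \<in> borel_measurable uniform_cube" for n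
    unfolding measurable_cong_sets[OF sets_eq refl] g_def by measurable
  have lim: "(\<lambda>n. \<integral>x. g n x \<partial>uniform_cube) \<longlonglongrightarrow> (\<integral>x. f x \<partial>uniform_cube)"
  proof (rule integral_dominated_convergence[where w="\<lambda>_. C"])
    show "f \<in> borel_measurable uniform_cube"
      unfolding measurable_cong_sets[OF sets_eq refl] by (rule f_meas)
    show "AE x in uniform_cube. (\<lambda>n. g n x) \<longlonglongrightarrow> f x"
      using AE_uniform_cube_interior
    proof eventually_elim
      case (elim x)
      have "(\<lambda>n. torus_point (c n x) /\<^sub>R real n) \<longlonglongrightarrow> x"
      proof (rule vec_tendstoI)
        fix i
        have "(\<lambda>n. (torus_point (c n x) /\<^sub>R real n) $ i - x $ i) \<longlonglongrightarrow> 0"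
        proof (rule Lim_null_comparison)
          show "\<forall>\<^sub>F n in sequentially. norm ((torus_point (c n x) /\<^sub>R real n) $ i - x $ i) \<le> 1 / real n"
            using eventually_ge_at_top[of 1] by eventually_elim (use c[OF elim] in auto)
          show "(\<lambda>n. 1 / real n) \<longlonglongrightarrow> 0" by (rule lim_1_over_n)
        qed
        then show "(\<lambda>n. (torus_point (c n x) /\<^sub>R real n) $ i) \<longlonglongrightarrow> x $ i" by (simp add: LIM_zero_iff)
      qed
      then have "(\<lambda>n. f (torus_point (c n x) /\<^sub>R real n)) \<longlonglongrightarrow> f x"
        using continuous_on_tendsto_compose[OF f] by auto
      moreover have "\<forall>\<^sub>F n in sequentially. f (torus_point (c n x) /\<^sub>R real n) = g n x"
        using eventually_ge_at_top[of 1] by eventually_elim (use c[OF elim] in auto)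
      ultimately show ?case by (rule Lim_transform_eventually)
    qed
    show "AE x in uniform_cube. norm (g n x) \<le> C" for n
      using AE_uniform_cube_interior
    proof eventually_elim
      case (elim x)
      show ?case
      proof (cases "1 \<le> n")
        case True then show ?thesis using c[OF elim, of n] C by simp
      next
        case False
        then have "torus_verts n = ({} :: (nat ^ 'd) set)" by (auto simp: torus_verts_def)
        then show ?thesis using order_trans[OF abs_ge_zero C] by (simp add: g_def)
      qed
    qed
  qed (simp_all add: g_meas)
  have mean: "(\<integral>x. g n x \<partial>uniform_cube) = (\<Sum>v\<in>torus_verts n. f (torus_point v /\<^sub>R real n)) / real n ^ CARD('d)"
    if n: "1 \<le> n" for n
  proof -
    have "(\<integral>x. g n x \<partial>uniform_cube) = (\<Sum>v\<in>torus_verts n. measure uniform_cube (cell n v) * f (torus_point v /\<^sub>R real n))"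
      unfolding g_def
      by (subst Bochner_Integration.integral_sum) (auto intro!: integrable_mult_left simp: emeasure_eq_measure)
    also have "\<dots> = (\<Sum>v\<in>torus_verts n. f (torus_point v /\<^sub>R real n) / real n ^ CARD('d))"
      by (intro sum.cong refl, subst prob_cell[OF n]) auto
    finally show ?thesis by (simp add: sum_divide_distrib)
  qed
  have "\<forall>\<^sub>F n in sequentially. (\<integral>x. g n x \<partial>uniform_cube)
      = (\<Sum>v\<in>torus_verts n. f (torus_point v /\<^sub>R real n)) / real n ^ CARD('d)"
    using eventually_ge_at_top[of 1] by eventually_elim (rule mean)
  with lim show ?thesis by (rule Lim_transform_eventually)
qed

lemma torus_point_in_unit_cube:
  "v \<in> torus_verts n \<Longrightarrow> torus_point v /\<^sub>R real n \<in> unit_cube"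
  by (auto simp: unit_cube_def torus_point_def torus_verts_def field_simps divide_le_eq_1)

text \<open>
  Continuous, zero on the boundary of the cube, and increasing to 1 in the interior as \<open>m\<close> grows.
\<close>

definition cutoff :: "nat \<Rightarrow> real ^ 'd \<Rightarrow> real" where
  "cutoff m x = (\<Prod>i\<in>UNIV. min 1 (max 0 (real m * (x $ i * (1 - x $ i)))))"

lemma cutoff_bounds: "0 \<le> cutoff m x" "cutoff m x \<le> 1"
  unfolding cutoff_def by (auto intro!: prod_nonneg prod_le_1)

lemma cutoff_boundary: "x $ i \<in> {0, 1} \<Longrightarrow> cutoff m x = 0"
  unfolding cutoff_def by (rule prod_zero, simp, rule bexI[of _ i]) auto

lemma continuous_on_cutoff: "continuous_on S (cutoff m)"
  unfolding cutoff_def by (intro continuous_intros)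

lemma cutoff_tendsto:
  assumes "\<forall>i. 0 < x $ i \<and> x $ i < 1"
  shows "(\<lambda>m. cutoff m x) \<longlonglongrightarrow> 1"
proof -
  have "(\<lambda>m. min 1 (max 0 (real m * (x $ i * (1 - x $ i))))) \<longlonglongrightarrow> 1" for i
  proof (rule tendsto_eventually)
    have "0 < x $ i * (1 - x $ i)" using assms by simp
    then obtain k :: nat where k: "1 < real k * (x $ i * (1 - x $ i))" using reals_Archimedean3 by blast
    show "\<forall>\<^sub>F m in sequentially. min 1 (max 0 (real m * (x $ i * (1 - x $ i)))) = 1"
      using eventually_ge_at_top[of k]
    proof eventually_elim
      case (elim m)
      then have "real k * (x $ i * (1 - x $ i)) \<le> real m * (x $ i * (1 - x $ i))"
        using \<open>0 < x $ i * (1 - x $ i)\<close> by (intro mult_right_mono) auto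
      then show ?case using k by simp
    qed
  qed
  then have "(\<lambda>m. cutoff m x) \<longlonglongrightarrow> (\<Prod>i\<in>(UNIV :: 'a set). 1)"
    unfolding cutoff_def by (intro tendsto_prod)
  then show ?thesis by simp
qed

text \<open>
  The function need not be periodic, so approximation is in mean only: a cutoff near the boundary of the
  cube changes it on a set of small volume.
\<close>

lemma trig_poly_mean_approx:
  fixes f :: "real ^ 'd \<Rightarrow> real"
  assumes f: "continuous_on UNIV f" and C: "\<And>x. \<bar>f x\<bar> \<le> C" and e: "0 < e"
  obtains p where "trig_poly p"
    "\<forall>\<^sub>F n in sequentially. (\<Sum>v\<in>torus_verts n. \<bar>f (torus_point v /\<^sub>R real n) - p (torus_point v /\<^sub>R real n)\<bar>) / real n ^ CARD('d) < e"
proof -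
  interpret prob_space "uniform_cube :: (real ^ 'd) measure" by (rule prob_space_uniform_cube)
  have C0: "0 \<le> C" using order_trans[OF abs_ge_zero C] .
  have sets_eq: "sets uniform_cube = sets (borel :: (real ^ 'd) measure)" by simp
  have h_cont: "continuous_on UNIV (\<lambda>x :: real ^ 'd. C * (1 - cutoff m x))" for m
    by (intro continuous_intros continuous_on_cutoff)
  have h_bound: "\<bar>C * (1 - cutoff m x)\<bar> \<le> C" for m and x :: "real ^ 'd"
    using cutoff_bounds[of m x] C0 by (simp add: abs_mult mult_left_le)
  have "(\<lambda>m. \<integral>x. C * (1 - cutoff m x) \<partial>(uniform_cube :: (real ^ 'd) measure)) \<longlonglongrightarrow> (\<integral>x. C * (1 - 1) \<partial>(uniform_cube :: (real ^ 'd) measure))"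
  proof (rule integral_dominated_convergence[where w="\<lambda>_. C"])
    show "(\<lambda>x. C * (1 - cutoff m x)) \<in> borel_measurable (uniform_cube :: (real ^ 'd) measure)" for m
      unfolding measurable_cong_sets[OF sets_eq refl] by (rule borel_measurable_continuous_onI[OF h_cont])
    show "AE x in (uniform_cube :: (real ^ 'd) measure). (\<lambda>m. C * (1 - cutoff m x)) \<longlonglongrightarrow> C * (1 - 1)"
      using AE_uniform_cube_interior by eventually_elim (intro tendsto_intros cutoff_tendsto)
    show "AE x in (uniform_cube :: (real ^ 'd) measure). norm (C * (1 - cutoff m x)) \<le> C" for m
      using h_bound by simp
  qed auto
  then have "\<forall>\<^sub>F m in sequentially. (\<integral>x. C * (1 - cutoff m x) \<partial>(uniform_cube :: (real ^ 'd) measure)) < e / 2"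
    using e by (intro order_tendstoD(2)) auto
  then obtain m where m: "(\<integral>x. C * (1 - cutoff m x) \<partial>(uniform_cube :: (real ^ 'd) measure)) < e / 2"
    by (auto simp: eventually_sequentially)
  obtain p where p: "trig_poly p" "\<And>x. x \<in> unit_cube \<Longrightarrow> \<bar>f x * cutoff m x - p x\<bar> < e / 4"
  proof (rule trig_poly_uniform_approx[of "\<lambda>x. f x * cutoff m x" "e / 4"])
    show "continuous_on unit_cube (\<lambda>x. f x * cutoff m x)"
      using continuous_on_subset[OF f] by (intro continuous_intros continuous_on_cutoff) auto
  qed (use e cutoff_boundary in auto)
  have "\<forall>\<^sub>F n in sequentially. (\<Sum>v\<in>(torus_verts n :: (nat ^ 'd) set). C * (1 - cutoff m (torus_point v /\<^sub>R real n))) / real n ^ CARD('d) < e / 2"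
    using riemann_sum_tendsto[OF h_cont[of m] h_bound[of m]] m by (rule order_tendstoD(2))
  then have "\<forall>\<^sub>F n in sequentially. (\<Sum>v\<in>torus_verts n. \<bar>f (torus_point v /\<^sub>R real n) - p (torus_point v /\<^sub>R real n)\<bar>) / real n ^ CARD('d) < e"
    using eventually_ge_at_top[of 1]
  proof eventually_elim
    case (elim n)
    have "(\<Sum>v\<in>torus_verts n. \<bar>f (torus_point v /\<^sub>R real n) - p (torus_point v /\<^sub>R real n)\<bar>)
       \<le> (\<Sum>v\<in>(torus_verts n :: (nat ^ 'd) set). C * (1 - cutoff m (torus_point v /\<^sub>R real n)) + e / 4)"
    proof (rule sum_mono)
      fix v :: "nat ^ 'd" assume v: "v \<in> torus_verts n"
      let ?x = "torus_point v /\<^sub>R real n"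
      have "\<bar>f ?x - f ?x * cutoff m ?x\<bar> = \<bar>f ?x\<bar> * (1 - cutoff m ?x)"
      proof -
        have "f ?x - f ?x * cutoff m ?x = f ?x * (1 - cutoff m ?x)" by (simp add: right_diff_distrib)
        then show ?thesis using cutoff_bounds(2)[of m ?x] by (simp add: abs_mult)
      qed
      also have "\<dots> \<le> C * (1 - cutoff m ?x)"
        using cutoff_bounds[of m ?x] C by (intro mult_right_mono) auto
      finally show "\<bar>f ?x - p ?x\<bar> \<le> C * (1 - cutoff m ?x) + e / 4"
        using p(2)[OF torus_point_in_unit_cube[OF v]] by linarith
    qed
    then have "(\<Sum>v\<in>torus_verts n. \<bar>f (torus_point v /\<^sub>R real n) - p (torus_point v /\<^sub>R real n)\<bar>) / real n ^ CARD('d)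
       \<le> (\<Sum>v\<in>(torus_verts n :: (nat ^ 'd) set). C * (1 - cutoff m (torus_point v /\<^sub>R real n)) + e / 4) / real n ^ CARD('d)"
      by (rule divide_right_mono) simp
    also have "\<dots> = (\<Sum>v\<in>(torus_verts n :: (nat ^ 'd) set). C * (1 - cutoff m (torus_point v /\<^sub>R real n))) / real n ^ CARD('d) + e / 4"
      using elim(2) by (simp add: sum.distrib add_divide_distrib card_torus_verts)
    finally show ?case using elim(1) e by simp
  qed
  with p(1) show thesis by (rule that)
qed

lemma sets_empirical_measure: "sets (empirical_measure V m) = sets borel"
  by (simp add: empirical_measure_def)

section \<open>The earthworm at a fixed time\<close>

text \<open>
  Decomposition according to the number of jumps, which is independent of the positions.
\<close>

lemma expectation_earthworm:
  fixes h :: "('v \<Rightarrow> real) \<Rightarrow> real"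
  assumes walk: "random_walk P V E X \<tau>" and reg: "regular_walk V E D L P X"
    and t: "0 < t" and h: "\<And>m. \<bar>h m\<bar> \<le> C"
  shows "(\<integral>\<omega>. h (earthworm_mass E m0 X \<tau> t \<omega>) \<partial>P)
    = poisson_mean t (\<lambda>k. \<integral>\<omega>. h (mass_after E m0 (\<lambda>i. X i \<omega>) k) \<partial>P)"
proof -
  interpret W: random_walk P V E X \<tau> by (rule walk)
  interpret R: regular_walk V E D L P X by (rule reg)
  let ?J = "\<lambda>k. {\<omega> \<in> space P. jump_count \<tau> t \<omega> = k}"
  let ?Z = "\<lambda>\<omega>. h (earthworm_mass E m0 X \<tau> t \<omega>)"
  have ad: "adapted k (\<lambda>x. h (mass_after E m0 x k))" for k
    by (rule adapted_comp[OF adapted_mass_after])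
  have Z_meas: "?Z \<in> borel_measurable P"
    unfolding earthworm_mass_def
    by (rule measurable_compose_countable[OF R.adapted_measurable[OF ad] W.jump_count_measurable])
  have Z_int: "integrable P ?Z"
    by (rule W.integrable_const_bound[OF _ Z_meas, of C]) (use h in auto)
  have J: "?J k \<in> sets P" for k by measurable
  have UN_J: "(\<Union>k. ?J k) = space P" by auto
  have "(\<integral>\<omega>. ?Z \<omega> \<partial>P) = (\<integral>\<omega>\<in>(\<Union>k. ?J k). ?Z \<omega> \<partial>P)"
    unfolding UN_J set_lebesgue_integral_def by (intro Bochner_Integration.integral_cong) auto
  also have "\<dots> = (\<Sum>k. \<integral>\<omega>\<in>?J k. ?Z \<omega> \<partial>P)"
  proof (rule lebesgue_integral_countable_add)
    show "set_integrable P (\<Union>k. ?J k) ?Z"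
      unfolding UN_J set_integrable_def
      by (rule iffD1[OF Bochner_Integration.integrable_cong[OF refl] Z_int]) auto
  qed (use J in auto)
  also have "\<dots> = (\<Sum>k. pmf (poisson_pmf t) k * (\<integral>\<omega>. h (mass_after E m0 (\<lambda>i. X i \<omega>) k) \<partial>P))"
  proof (rule suminf_cong)
    fix k
    have "(\<integral>\<omega>\<in>?J k. ?Z \<omega> \<partial>P) = (\<integral>\<omega>. indicator (?J k) \<omega> * h (mass_after E m0 (\<lambda>i. X i \<omega>) k) \<partial>P)"
      unfolding set_lebesgue_integral_def
      by (intro Bochner_Integration.integral_cong refl) (auto simp: indicator_def earthworm_mass_def)
    also have "\<dots> = (\<Sum>p\<in>R.paths k. measure P (?J k \<inter> R.follows k p) * h (mass_after E m0 p k))"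
      by (rule R.adapted_expectation_on[OF ad J])
    also have "\<dots> = (\<Sum>p\<in>R.paths k. measure P (?J k) * (measure P (R.follows k p) * h (mass_after E m0 p k)))"
      unfolding R.follows_def W.prob_path_jump_count mult.assoc ..
    also have "\<dots> = measure P (?J k) * (\<integral>\<omega>. h (mass_after E m0 (\<lambda>i. X i \<omega>) k) \<partial>P)"
      unfolding R.adapted_expectation[OF ad] sum_distrib_left ..
    finally show "(\<integral>\<omega>\<in>?J k. ?Z \<omega> \<partial>P) = pmf (poisson_pmf t) k * (\<integral>\<omega>. h (mass_after E m0 (\<lambda>i. X i \<omega>) k) \<partial>P)"
      unfolding W.prob_jump_count[OF t] .
  qed
  also have "\<dots> = poisson_mean t (\<lambda>k. \<integral>\<omega>. h (mass_after E m0 (\<lambda>i. X i \<omega>) k) \<partial>P)"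
  proof -
    have "\<bar>\<integral>\<omega>. h (mass_after E m0 (\<lambda>i. X i \<omega>) k) \<partial>P\<bar> \<le> C" for k
    proof (rule order_trans[OF integral_abs_bound])
      show "(\<integral>\<omega>. \<bar>h (mass_after E m0 (\<lambda>i. X i \<omega>) k)\<bar> \<partial>P) \<le> C"
        using h by (intro W.integral_le_const integrable_abs R.adapted_integrable[OF ad]) auto
    qed
    then show ?thesis
      unfolding poisson_mean_def
      by (intro pmf_nat_expectation(1)[symmetric] integrable_pmf_bounded)
  qed
  finally show ?thesis .
qed

lemma earthworm_measurable:
  assumes walk: "random_walk P V E X \<tau>" and reg: "regular_walk V E D L P X"
  shows "(\<lambda>\<omega>. earthworm_mass E m0 X \<tau> t \<omega> v) \<in> borel_measurable P"
proof -
  interpret W: random_walk P V E X \<tau> by (rule walk)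
  interpret R: regular_walk V E D L P X by (rule reg)
  show ?thesis
    unfolding earthworm_mass_def
    by (rule measurable_compose_countable[OF R.adapted_measurable[OF adapted_comp[OF adapted_mass_after, of _ "\<lambda>m. m v"]]
          W.jump_count_measurable])
qed

lemma regular_walk_torus:
  fixes X :: "nat \<Rightarrow> 'w \<Rightarrow> nat ^ 'd"
  assumes n: "2 \<le> n" and walk: "random_walk P (torus_verts n) (torus_adj n) X \<tau>"
  shows "regular_walk (torus_verts n) (torus_adj n) (torus_degree TYPE('d) n) (CARD('d) * n) P X"
proof -
  interpret W: random_walk P "torus_verts n" "torus_adj n" X \<tau> by (rule walk)
  interpret regular_graph "torus_verts n :: (nat ^ 'd) set" "torus_adj n" "torus_degree TYPE('d) n" "CARD('d) * n"
    by (rule regular_graph_torus[OF n])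
  show ?thesis by unfold_locales (rule W.position, rule W.uniform_step)
qed

abbreviation uniform_mass :: "nat \<Rightarrow> nat ^ 'd \<Rightarrow> real" where
  "uniform_mass n \<equiv> \<lambda>v. 1 / real n ^ CARD('d)"

lemma mass_dist_uniform:
  assumes n: "2 \<le> n"
  shows "regular_graph.mass_dist (torus_verts n) (uniform_mass n :: nat ^ 'd \<Rightarrow> real)"
proof -
  interpret regular_graph "torus_verts n :: (nat ^ 'd) set" "torus_adj n" "torus_degree TYPE('d) n" "CARD('d) * n"
    by (rule regular_graph_torus[OF n])
  show ?thesis using n by (simp add: mass_dist_def card_torus_verts)
qed

section \<open>Convergence as time tends to infinity\<close>

lemma earthworm_converges:
  fixes P :: "'w measure" and X :: "nat \<Rightarrow> 'w \<Rightarrow> nat ^ 'd"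
  assumes n: "2 \<le> n" and walk: "random_walk P (torus_verts n) (torus_adj n) X \<tau>"
    and M: "\<And>t \<omega>. t \<ge> 0 \<Longrightarrow> \<omega> \<in> space P \<Longrightarrow>
      M t \<omega> = empirical_measure (torus_verts n) (earthworm_mass (torus_adj n) (uniform_mass n) X \<tau> t \<omega>)"
  shows "\<exists>(Q :: (real ^ 'd) measure measure) Minf.
    converges_in_distribution weak_topology (\<lambda>t. P) M Q Minf at_top"
proof -
  let ?V = "torus_verts n :: (nat ^ 'd) set" and ?E = "torus_adj n :: nat ^ 'd \<Rightarrow> nat ^ 'd \<Rightarrow> bool"
  note reg = regular_walk_torus[OF n walk]
  interpret G: regular_graph ?V ?E "torus_degree TYPE('d) n" "CARD('d) * n"
    by (rule regular_graph_torus[OF n])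
  interpret Y: regular_walk ?V ?E "torus_degree TYPE('d) n" "CARD('d) * n" G.choice_space G.stationary_walk
    by (rule G.regular_walk_stationary)
  interpret W: random_walk P ?V ?E X \<tau> by (rule walk)
  define \<xi> where "\<xi> \<omega> = empirical_measure ?V (Y.limit_mass (uniform_mass n) \<omega>)" for \<omega>
  have \<xi>_meas: "\<xi> \<in> G.choice_space \<rightarrow>\<^sub>M borel_of weak_topology"
    unfolding \<xi>_def by (rule measurable_empirical_measure[OF finite_torus_verts Y.limit_mass_measurable])
  define Q where "Q = distr G.choice_space (borel_of weak_topology) \<xi>"
  have M_meas: "M t \<in> P \<rightarrow>\<^sub>M borel_of weak_topology" if "0 \<le> t" for t
  proof -
    have "(\<lambda>\<omega>. empirical_measure ?V (earthworm_mass ?E (uniform_mass n) X \<tau> t \<omega>)) \<in> P \<rightarrow>\<^sub>M borel_of weak_topology"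
      by (rule measurable_empirical_measure[OF finite_torus_verts earthworm_measurable[OF walk reg]])
    then show ?thesis using M[OF that] by (simp cong: measurable_cong)
  qed
  have "converges_in_distribution weak_topology (\<lambda>t. P) M Q (\<lambda>\<mu>. \<mu>) at_top"
    unfolding converges_in_distribution_def
  proof (intro conjI allI impI)
    show "\<forall>\<^sub>F t in at_top. random_measure P (M t)"
      using eventually_ge_at_top[of 0]
      by eventually_elim (simp add: random_element_def M_meas W.prob_space_axioms)
    show "random_measure Q (\<lambda>\<mu>. \<mu>)"
      unfolding random_element_def Q_def
      using G.prob_space_choice_space \<xi>_meas by (auto intro!: prob_space.prob_space_distr measurable_ident_sets)
    fix g :: "(real ^ 'd) measure \<Rightarrow> real"
    assume g: "continuous_map weak_topology euclideanreal g \<and> bounded (g ` topspace weak_topology)"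
    then obtain C where C: "\<And>\<mu>. \<mu> \<in> finite_borel_measures \<Longrightarrow> \<bar>g \<mu>\<bar> \<le> C"
      by (auto simp: bounded_iff topspace_weak_topology)
    define h where "h m = g (empirical_measure ?V m)" for m
    have hC: "\<bar>h m\<bar> \<le> C" for m
      unfolding h_def by (intro C empirical_measure_finite_borel finite_torus_verts)
    have limQ: "(\<integral>\<mu>. g \<mu> \<partial>Q) = (\<integral>\<omega>. h (Y.limit_mass (uniform_mass n) \<omega>) \<partial>G.choice_space)"
      unfolding Q_def h_def \<xi>_def[symmetric]
      using g by (intro integral_distr \<xi>_meas continuous_map_borel_measurable[OF _ measurable_ident_sets[OF refl]]) auto
    have "((\<lambda>t. poisson_mean t (\<lambda>k. \<integral>\<omega>. h (mass_after ?E (uniform_mass n) (\<lambda>i. X i \<omega>) k) \<partial>P))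
        \<longlongrightarrow> (\<integral>\<omega>. h (Y.limit_mass (uniform_mass n) \<omega>) \<partial>G.choice_space)) at_top"
    proof (rule G.masses_converge[OF reg G.regular_walk_stationary G.stationary_walk_start mass_dist_uniform[OF n] _ hC])
      show "(\<lambda>\<omega>. h (Y.limit_mass (uniform_mass n) \<omega>)) \<in> borel_measurable G.choice_space"
        unfolding h_def \<xi>_def[symmetric] using g by (intro continuous_map_borel_measurable[OF _ \<xi>_meas]) auto
      show "(\<lambda>k. h (m k)) \<longlonglongrightarrow> h m'" if "\<And>v. v \<in> ?V \<Longrightarrow> (\<lambda>k. m k v) \<longlonglongrightarrow> m' v" for m m'
        unfolding h_def using g that by (intro tendsto_weak_continuous_empirical finite_torus_verts) auto
    qed
    then show "((\<lambda>t. \<integral>\<omega>. g (M t \<omega>) \<partial>P) \<longlongrightarrow> (\<integral>\<mu>. g \<mu> \<partial>Q)) at_top"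
      unfolding limQ
    proof (rule Lim_transform_eventually)
      show "\<forall>\<^sub>F t in at_top. poisson_mean t (\<lambda>k. \<integral>\<omega>. h (mass_after ?E (uniform_mass n) (\<lambda>i. X i \<omega>) k) \<partial>P) = (\<integral>\<omega>. g (M t \<omega>) \<partial>P)"
        using eventually_gt_at_top[of 0]
      proof eventually_elim
        case (elim t)
        have "(\<integral>\<omega>. g (M t \<omega>) \<partial>P) = (\<integral>\<omega>. h (earthworm_mass ?E (uniform_mass n) X \<tau> t \<omega>) \<partial>P)"
          using M elim by (intro Bochner_Integration.integral_cong refl) (simp add: h_def)
        then show ?case using expectation_earthworm[of P ?V ?E X \<tau> "torus_degree TYPE('d) n" "CARD('d) * n" t h C, OF walk reg elim hC] by simp
      qed
    qed
  qed
  then show ?thesis by blast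
qed

section \<open>Mean deviation of the masses from uniformity\<close>

locale torus_walks =
  fixes P :: "nat \<Rightarrow> 'w measure" and X :: "nat \<Rightarrow> nat \<Rightarrow> 'w \<Rightarrow> nat ^ 'd"
  assumes walks: "\<And>n. 2 \<le> n \<Longrightarrow>
    regular_walk (torus_verts n) (torus_adj n) (torus_degree TYPE('d) n) (CARD('d) * n) (P n) (X n)"
begin

abbreviation torus_mean :: "nat \<Rightarrow> ((nat ^ 'd \<Rightarrow> real) \<Rightarrow> nat ^ 'd \<Rightarrow> real) \<Rightarrow> real \<Rightarrow> real" where
  "torus_mean n \<equiv> regular_walk.time_mean (torus_adj n) (P n) (X n) (uniform_mass n)"

text \<open>
  The \<open>L\<^sup>1\<close> size, at time \<open>t\<close>, of the integral of \<open>\<phi>\<close> against the masses.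
\<close>

definition deviation :: "nat \<Rightarrow> (nat ^ 'd \<Rightarrow> real) \<Rightarrow> real \<Rightarrow> real" where
  "deviation n \<phi> = torus_mean n (\<lambda>m b. \<bar>\<Sum>v\<in>torus_verts n. \<phi> v * m v\<bar>)"

definition space_mean :: "nat \<Rightarrow> (real ^ 'd \<Rightarrow> real) \<Rightarrow> real" where
  "space_mean n f = (\<Sum>v\<in>torus_verts n. f (torus_point v /\<^sub>R real n)) / real n ^ CARD('d)"

context
  fixes n :: nat
  assumes n: "2 \<le> n"
begin

interpretation W: regular_walk "torus_verts n" "torus_adj n" "torus_degree TYPE('d) n" "CARD('d) * n" "P n" "X n"
  by (rule walks[OF n])

lemma md: "W.mass_dist (uniform_mass n)"
  by (rule mass_dist_uniform[OF n])

lemma N_eq: "W.N = real n ^ CARD('d)"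
  by (simp add: card_torus_verts)

lemma N_ge_2: "2 \<le> W.N"
proof -
  have "real 2 ^ 1 \<le> real n ^ CARD('d)"
    using n by (intro order_trans[OF power_mono power_increasing]) (auto simp: Suc_le_eq)
  then show ?thesis by (simp add: N_eq)
qed

lemma state_bounded_abs:
  assumes "W.state_bounded \<Psi>"
  shows "W.state_bounded (\<lambda>m b. \<bar>\<Psi> m b\<bar>)"
  using assms by (simp add: W.state_bounded_def[OF md])

lemma bounded_integral: "W.state_bounded (\<lambda>m b. \<Sum>v\<in>torus_verts n. \<phi> v * m v)"
  by (rule W.state_bounded_integral[OF md])

lemma deviation_add: "deviation n (\<lambda>v. \<phi> v + \<psi> v) t \<le> deviation n \<phi> t + deviation n \<psi> t"
proof -
  have "deviation n (\<lambda>v. \<phi> v + \<psi> v) t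
      \<le> W.time_mean (uniform_mass n) (\<lambda>m b. \<bar>\<Sum>v\<in>torus_verts n. \<phi> v * m v\<bar> + \<bar>\<Sum>v\<in>torus_verts n. \<psi> v * m v\<bar>) t"
    unfolding deviation_def distrib_right sum.distrib
    by (rule W.time_mean_mono[OF md])
       (intro state_bounded_abs W.state_bounded_add[OF md] bounded_integral abs_triangle_ineq)+
  also have "\<dots> = deviation n \<phi> t + deviation n \<psi> t"
    unfolding deviation_def by (intro W.time_mean_add[OF md] state_bounded_abs bounded_integral)
  finally show ?thesis .
qed

lemma deviation_scale: "deviation n (\<lambda>v. c * \<phi> v) t = \<bar>c\<bar> * deviation n \<phi> t"
  unfolding deviation_def
  by (simp add: mult.assoc sum_distrib_left[symmetric] abs_mult W.time_mean_scale[OF md])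

lemma deviation_const: "deviation n (\<lambda>v. c) t \<le> \<bar>c\<bar>"
proof -
  have "deviation n (\<lambda>v. c) t \<le> W.time_mean (uniform_mass n) (\<lambda>m b. \<bar>c\<bar>) t"
    unfolding deviation_def
  proof (rule W.time_mean_mono[OF md])
    show "W.state_bounded (\<lambda>m b. \<bar>\<Sum>v\<in>torus_verts n. c * m v\<bar>)"
      by (intro state_bounded_abs bounded_integral)
    show "W.state_bounded (\<lambda>m b. \<bar>c\<bar>)" by (rule W.state_bounded_const[OF md])
  qed (simp add: sum_distrib_left[symmetric] W.mass_dist_def)
  then show ?thesis by (simp add: W.time_mean_const[OF md])
qed

text \<open>
  The mean masses are asymptotically uniform.
\<close>

lemma deviation_le_space_mean:
  assumes e: "0 < e"
  shows "\<forall>\<^sub>F t in at_top. deviation n (\<lambda>v. f (torus_point v /\<^sub>R real n)) t \<le> space_mean n (\<lambda>x. \<bar>f x\<bar>) + e"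
proof -
  let ?\<phi> = "\<lambda>v. f (torus_point v /\<^sub>R real n)"
  have "(W.time_mean (uniform_mass n) (\<lambda>m b. \<Sum>v\<in>torus_verts n. \<bar>?\<phi> v\<bar> * m v) \<longlongrightarrow> (\<Sum>v\<in>torus_verts n. \<bar>?\<phi> v\<bar>) / W.N) at_top"
    by (rule W.time_mean_integral[OF md N_ge_2])
  then have "\<forall>\<^sub>F t in at_top. W.time_mean (uniform_mass n) (\<lambda>m b. \<Sum>v\<in>torus_verts n. \<bar>?\<phi> v\<bar> * m v) t
      < space_mean n (\<lambda>x. \<bar>f x\<bar>) + e"
    unfolding N_eq by (rule order_tendstoD(2)) (use e in \<open>simp add: space_mean_def\<close>)
  then show ?thesis
  proof eventually_elim
    case (elim t)
    have "deviation n ?\<phi> t \<le> W.time_mean (uniform_mass n) (\<lambda>m b. \<Sum>v\<in>torus_verts n. \<bar>?\<phi> v\<bar> * m v) t"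
      unfolding deviation_def
    proof (rule W.time_mean_mono[OF md])
      fix m :: "nat ^ 'd \<Rightarrow> real" assume "W.mass_dist m"
      then show "\<bar>\<Sum>v\<in>torus_verts n. ?\<phi> v * m v\<bar> \<le> (\<Sum>v\<in>torus_verts n. \<bar>?\<phi> v\<bar> * m v)"
        by (intro order_trans[OF sum_abs] sum_mono) (auto simp: abs_mult W.mass_dist_def)
    qed (intro state_bounded_abs bounded_integral)+
    then show ?case using elim by linarith
  qed
qed

text \<open>
  The weighted form \<open>\<bar>s\<bar> \<le> \<delta> / 2 + s\<^sup>2 / (2 \<delta>)\<close> keeps the bound linear in the second moment.
\<close>

lemma deviation_le_square:
  assumes \<delta>: "0 < \<delta>"
  shows "deviation n \<phi> t \<le> \<delta> / 2 + torus_mean n (\<lambda>m b. (\<Sum>v\<in>torus_verts n. \<phi> v * m v)\<^sup>2) t / (2 * \<delta>)"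
proof -
  have b: "W.state_bounded (\<lambda>m b. (\<Sum>v\<in>torus_verts n. \<phi> v * m v)\<^sup>2)"
    unfolding power2_eq_square by (intro W.state_bounded_mult[OF md] bounded_integral)
  have "deviation n \<phi> t \<le> W.time_mean (uniform_mass n) (\<lambda>m b. \<delta> / 2 + (1 / (2 * \<delta>)) * (\<Sum>v\<in>torus_verts n. \<phi> v * m v)\<^sup>2) t"
    unfolding deviation_def
  proof (rule W.time_mean_mono[OF md])
    fix m :: "nat ^ 'd \<Rightarrow> real"
    let ?s = "\<Sum>v\<in>torus_verts n. \<phi> v * m v"
    have "0 \<le> (\<bar>?s\<bar> - \<delta>)\<^sup>2" by simp
    then have "2 * \<delta> * \<bar>?s\<bar> \<le> \<delta>\<^sup>2 + ?s\<^sup>2" by (simp add: power2_diff algebra_simps)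
    then have "\<bar>?s\<bar> \<le> (\<delta>\<^sup>2 + ?s\<^sup>2) / (2 * \<delta>)"
      using \<delta> by (simp add: pos_le_divide_eq mult.commute)
    also have "\<dots> = \<delta> / 2 + (1 / (2 * \<delta>)) * ?s\<^sup>2"
      using \<delta> by (simp add: add_divide_distrib power2_eq_square)
    finally show "\<bar>?s\<bar> \<le> \<delta> / 2 + (1 / (2 * \<delta>)) * ?s\<^sup>2" .
  qed (intro state_bounded_abs bounded_integral W.state_bounded_add[OF md] W.state_bounded_mult[OF md] W.state_bounded_const[OF md] b)+
  also have "\<dots> = \<delta> / 2 + (1 / (2 * \<delta>)) * torus_mean n (\<lambda>m b. (\<Sum>v\<in>torus_verts n. \<phi> v * m v)\<^sup>2) t"
    unfolding W.time_mean_add[OF md W.state_bounded_const[OF md] W.state_bounded_mult[OF md W.state_bounded_const[OF md] b]]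
      W.time_mean_const[OF md] W.time_mean_scale[OF md] ..
  finally show ?thesis by simp
qed

lemma character_second_moment:
  assumes n3: "3 \<le> n" and gap: "0 < character_gap n k" and e: "0 < e"
  defines "\<eta> \<equiv> 2 * pi * (\<Sum>i\<in>UNIV. \<bar>of_int (k i)\<bar>) / real n"
    and "A \<equiv> 2 * real (CARD('d) * n) * real (torus_degree TYPE('d) n)"
    and "lam \<equiv> character_gap n k"
  shows "\<forall>\<^sub>F t in at_top. torus_mean n (\<lambda>m b. (\<Sum>v\<in>torus_verts n. torus_character n k \<theta> v * m v)\<^sup>2) t
    \<le> 2 * ((\<eta> + A * lam) + lam / 2 + lam * (A + (1 + \<eta> + A * lam))) + e"
proof (rule W.time_mean_square_eigenfunction[OF md N_ge_2])
  show "W.avg (torus_character n k \<theta>) v = (1 - lam) * torus_character n k \<theta> v" if "v \<in> torus_verts n" for v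
    unfolding lam_def by (rule character_eigenfunction[OF n3 that])
  show "\<bar>torus_character n k \<theta> v\<bar> \<le> 1" for v
    by (simp add: character_def)
  show "\<bar>torus_character n k \<theta> u - torus_character n k \<theta> v\<bar> \<le> \<eta>" if "torus_adj n u v" for u v
    unfolding \<eta>_def by (rule character_difference[OF n that])
  show "\<bar>W.green u v\<bar> \<le> A" if "u \<in> torus_verts n" "v \<in> torus_verts n" for u v
    unfolding A_def by (rule W.abs_green_le[OF that])
qed (use gap e in \<open>auto simp: lam_def\<close>)

text \<open>
  The sum over the torus is invariant under \<open>avg\<close>, which multiplies the character by a number less than 1.
\<close>

lemma character_space_mean:
  assumes n3: "3 \<le> n" and gap: "0 < character_gap n k"
  shows "space_mean n (character k \<theta>) = 0"
proof -
  have "(\<Sum>v\<in>torus_verts n. torus_character n k \<theta> v) = (\<Sum>v\<in>torus_verts n. W.avg (torus_character n k \<theta>) v)"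
    by (rule W.sum_avg[symmetric])
  also have "\<dots> = (\<Sum>v\<in>torus_verts n. (1 - character_gap n k) * torus_character n k \<theta> v)"
    by (intro sum.cong refl character_eigenfunction[OF n3])
  also have "\<dots> = (1 - character_gap n k) * (\<Sum>v\<in>torus_verts n. torus_character n k \<theta> v)"
    by (simp add: sum_distrib_left)
  finally have "(\<Sum>v\<in>torus_verts n. torus_character n k \<theta> v) = 0"
    using gap by (simp add: algebra_simps)
  then show ?thesis by (simp add: space_mean_def)
qed

end

definition equidistributes :: "(real ^ 'd \<Rightarrow> real) \<Rightarrow> bool" where
  "equidistributes f \<longleftrightarrow> (\<forall>e>0. \<forall>\<^sub>F n in sequentially. \<forall>\<^sub>F t in at_top.
     deviation n (\<lambda>v. f (torus_point v /\<^sub>R real n) - space_mean n f) t \<le> e)"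

text \<open>
  In the notation below \<open>\<eta> = a / n\<close>, \<open>A = c n\<close> and the gap is at most \<open>b / n\<^sup>2\<close>, so the bound on the second
  moment tends to zero.
\<close>

lemma equidistributes_character: "equidistributes (character k \<theta>)"
  unfolding equidistributes_def
proof (intro allI impI)
  fix e :: real assume e: "0 < e"
  show "\<forall>\<^sub>F n in sequentially. \<forall>\<^sub>F t in at_top.
     deviation n (\<lambda>v. torus_character n k \<theta> v - space_mean n (character k \<theta>)) t \<le> e"
  proof (cases "\<forall>i. k i = 0")
    case True
    show ?thesis
      using eventually_ge_at_top[of 2]
    proof eventually_elim
      case (elim n)
      have zero: "torus_character n k \<theta> v - space_mean n (character k \<theta>) = 0" for v
        using True elim by (simp add: character_def space_mean_def card_torus_verts)
      have "deviation n (\<lambda>v. 0) t \<le> e" for t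
        using deviation_const[OF elim, of 0 t] e by simp
      then show ?case unfolding zero by (rule always_eventually[OF allI])
    qed
  next
    case False
    then obtain i where i: "k i \<noteq> 0" by blast
    define a where "a = 2 * pi * (\<Sum>i\<in>UNIV. \<bar>of_int (k i)\<bar> :: real)"
    define b where "b = 2 * pi\<^sup>2 * (\<Sum>i\<in>UNIV. (of_int (k i))\<^sup>2 :: real)"
    define c where "c = 4 * real CARD('d) * real CARD('d)"
    have abc: "0 \<le> a" "0 \<le> b" "0 \<le> c" unfolding a_def b_def c_def by (auto intro!: mult_nonneg_nonneg sum_nonneg)
    have "(\<lambda>n. 2 * ((a / real n + (c * real n) * (b / (real n)\<^sup>2)) + b / (real n)\<^sup>2 / 2
         + b / (real n)\<^sup>2 * ((c * real n) + (1 + a / real n + (c * real n) * (b / (real n)\<^sup>2))))) \<longlonglongrightarrow> 0"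
      by real_asymp
    then have "\<forall>\<^sub>F n in sequentially. 2 * ((a / real n + (c * real n) * (b / (real n)\<^sup>2)) + b / (real n)\<^sup>2 / 2
         + b / (real n)\<^sup>2 * ((c * real n) + (1 + a / real n + (c * real n) * (b / (real n)\<^sup>2)))) < e\<^sup>2 / 2"
      using e by (intro order_tendstoD(2)) auto
    then show ?thesis
      using eventually_ge_at_top[of "max 3 (nat \<bar>k i\<bar> + 1)"]
    proof eventually_elim
      case (elim n)
      then have n3: "3 \<le> n" and n2: "2 \<le> n" and ki: "\<bar>k i\<bar> < int n" by auto
      have gap: "0 < character_gap n k" by (rule character_gap_pos[of k i n, OF i ki])
      let ?\<eta> = "2 * pi * (\<Sum>i\<in>UNIV. \<bar>of_int (k i)\<bar>) / real n"
      let ?A = "2 * real (CARD('d) * n) * real (torus_degree TYPE('d) n)"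
      let ?l = "character_gap n k"
      have A: "?A = c * real n" using n3 by (simp add: c_def torus_degree_def)
      have \<eta>: "?\<eta> = a / real n" by (simp add: a_def)
      have l: "?l \<le> b / (real n)\<^sup>2" unfolding b_def by (rule character_gap_upper)
      have "2 * ((?\<eta> + ?A * ?l) + ?l / 2 + ?l * (?A + (1 + ?\<eta> + ?A * ?l)))
        \<le> 2 * ((a / real n + (c * real n) * (b / (real n)\<^sup>2)) + b / (real n)\<^sup>2 / 2
         + b / (real n)\<^sup>2 * ((c * real n) + (1 + a / real n + (c * real n) * (b / (real n)\<^sup>2))))"
        unfolding A \<eta> using l abc gap
        by (intro mult_left_mono add_mono mult_mono divide_right_mono order_refl)
           (auto intro!: add_nonneg_nonneg mult_nonneg_nonneg divide_nonneg_nonneg)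
      then have small: "2 * ((?\<eta> + ?A * ?l) + ?l / 2 + ?l * (?A + (1 + ?\<eta> + ?A * ?l))) + e\<^sup>2 / 2 \<le> e\<^sup>2"
        using elim(1) by linarith
      have "0 < e\<^sup>2 / 2" using e by simp
      from character_second_moment[OF n2 n3 gap this, of \<theta>]
      show ?case
      proof eventually_elim
        case (elim t)
        have "deviation n (torus_character n k \<theta>) t \<le> e / 2 + torus_mean n (\<lambda>m b. (\<Sum>v\<in>torus_verts n. torus_character n k \<theta> v * m v)\<^sup>2) t / (2 * e)"
          by (rule deviation_le_square[OF n2 e])
        also have "\<dots> \<le> e / 2 + e\<^sup>2 / (2 * e)"
          using elim small e by (intro add_left_mono divide_right_mono) auto
        also have "\<dots> = e" using e by (simp add: power2_eq_square)
        finally show ?case by (simp add: character_space_mean[OF n2 n3 gap])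
      qed
    qed
  qed
qed

lemma equidistributes_trig_poly: "trig_poly f \<Longrightarrow> equidistributes f"
proof (induction rule: trig_poly.induct)
  case (trig_character k \<theta>)
  show ?case by (rule equidistributes_character)
next
  case (trig_add f g)
  show ?case unfolding equidistributes_def
  proof (intro allI impI)
    fix e :: real assume "0 < e"
    then have "0 < e / 2" by simp
    then have "\<forall>\<^sub>F n in sequentially. \<forall>\<^sub>F t in at_top. deviation n (\<lambda>v. f (torus_point v /\<^sub>R real n) - space_mean n f) t \<le> e / 2"
      "\<forall>\<^sub>F n in sequentially. \<forall>\<^sub>F t in at_top. deviation n (\<lambda>v. g (torus_point v /\<^sub>R real n) - space_mean n g) t \<le> e / 2"
      using trig_add.IH unfolding equidistributes_def by blast+
    then show "\<forall>\<^sub>F n in sequentially. \<forall>\<^sub>F t in at_top.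
        deviation n (\<lambda>v. (f (torus_point v /\<^sub>R real n) + g (torus_point v /\<^sub>R real n)) - space_mean n (\<lambda>x. f x + g x)) t \<le> e"
      using eventually_ge_at_top[of 2]
    proof eventually_elim
      case (elim n)
      have eq: "(\<lambda>v. (f (torus_point v /\<^sub>R real n) + g (torus_point v /\<^sub>R real n)) - space_mean n (\<lambda>x. f x + g x))
        = (\<lambda>v. (f (torus_point v /\<^sub>R real n) - space_mean n f) + (g (torus_point v /\<^sub>R real n) - space_mean n g))"
        by (simp add: fun_eq_iff space_mean_def sum.distrib add_divide_distrib)
      show ?case
        using elim(1,2)
      proof eventually_elim
        case (elim t)
        then show ?case
          unfolding eq
          using deviation_add[OF \<open>2 \<le> n\<close>, of "\<lambda>v. f (torus_point v /\<^sub>R real n) - space_mean n f"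
              "\<lambda>v. g (torus_point v /\<^sub>R real n) - space_mean n g" t] by linarith
      qed
    qed
  qed
next
  case (trig_scale f c)
  show ?case unfolding equidistributes_def
  proof (intro allI impI)
    fix e :: real assume e: "0 < e"
    then have "0 < e / (\<bar>c\<bar> + 1)" by (simp add: add_nonneg_pos)
    then have "\<forall>\<^sub>F n in sequentially. \<forall>\<^sub>F t in at_top. deviation n (\<lambda>v. f (torus_point v /\<^sub>R real n) - space_mean n f) t \<le> e / (\<bar>c\<bar> + 1)"
      using trig_scale.IH unfolding equidistributes_def by blast
    then show "\<forall>\<^sub>F n in sequentially. \<forall>\<^sub>F t in at_top.
        deviation n (\<lambda>v. c * f (torus_point v /\<^sub>R real n) - space_mean n (\<lambda>x. c * f x)) t \<le> e"
      using eventually_ge_at_top[of 2]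
    proof eventually_elim
      case (elim n)
      have eq: "(\<lambda>v. c * f (torus_point v /\<^sub>R real n) - space_mean n (\<lambda>x. c * f x))
        = (\<lambda>v. c * (f (torus_point v /\<^sub>R real n) - space_mean n f))"
        by (simp add: space_mean_def sum_distrib_left[symmetric] right_diff_distrib)
      show ?case
        using elim(1)
      proof eventually_elim
        case (elim t)
        have "\<bar>c\<bar> * deviation n (\<lambda>v. f (torus_point v /\<^sub>R real n) - space_mean n f) t \<le> \<bar>c\<bar> * (e / (\<bar>c\<bar> + 1))"
          using elim by (rule mult_left_mono) simp
        also have "\<dots> \<le> e" using e by (simp add: field_simps add_nonneg_pos)
        finally show ?case unfolding eq deviation_scale[OF \<open>2 \<le> n\<close>] .
      qed
    qed
  qed
qed

text \<open>
  Three errors: the approximation by a trigonometric polynomial, the equidistribution of this polynomial,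
  and the replacement of means over the torus by integrals.
\<close>

lemma deviation_from_integral:
  fixes f :: "real ^ 'd \<Rightarrow> real"
  assumes f: "continuous_on UNIV f" and C: "\<And>x. \<bar>f x\<bar> \<le> C" and e: "0 < e"
  shows "\<forall>\<^sub>F n in sequentially. \<forall>\<^sub>F t in at_top.
    deviation n (\<lambda>v. f (torus_point v /\<^sub>R real n) - (\<integral>x. f x \<partial>uniform_cube)) t \<le> e"
proof -
  let ?I = "\<integral>x. f x \<partial>uniform_cube"
  have e5: "0 < e / 5" using e by simp
  obtain p where p: "trig_poly p"
    "\<forall>\<^sub>F n in sequentially. (\<Sum>v\<in>torus_verts n. \<bar>f (torus_point v /\<^sub>R real n) - p (torus_point v /\<^sub>R real n)\<bar>) / real n ^ CARD('d) < e / 5"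
    using trig_poly_mean_approx[OF f C e5] by blast
  have "(\<lambda>n. space_mean n f) \<longlonglongrightarrow> ?I"
    unfolding space_mean_def by (rule riemann_sum_tendsto[OF f C])
  then have I: "\<forall>\<^sub>F n in sequentially. dist (space_mean n f) ?I < e / 5"
    using e5 by (rule tendstoD)
  have eq: "\<forall>\<^sub>F n in sequentially. \<forall>\<^sub>F t in at_top.
     deviation n (\<lambda>v. p (torus_point v /\<^sub>R real n) - space_mean n p) t \<le> e / 5"
    using equidistributes_trig_poly[OF p(1)] e5 unfolding equidistributes_def by blast
  show ?thesis
    using p(2) I eq eventually_ge_at_top[of 2]
  proof eventually_elim
    case (elim n)
    have n: "2 \<le> n" by (rule elim(4))
    have L1: "space_mean n (\<lambda>x. \<bar>f x - p x\<bar>) < e / 5" using elim(1) by (simp add: space_mean_def)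
    have diff: "\<bar>space_mean n f - space_mean n p\<bar> \<le> space_mean n (\<lambda>x. \<bar>f x - p x\<bar>)"
      unfolding space_mean_def diff_divide_distrib[symmetric] sum_subtractf[symmetric]
      by (simp add: abs_divide divide_right_mono sum_abs)
    have close: "\<bar>space_mean n p - ?I\<bar> \<le> 2 * (e / 5)"
      using diff L1 elim(2) unfolding dist_real_def by linarith
    show ?case
      using elim(3) deviation_le_space_mean[OF n e5, of "\<lambda>x. f x - p x"]
    proof eventually_elim
      case (elim t)
      let ?a = "\<lambda>v. f (torus_point v /\<^sub>R real n) - p (torus_point v /\<^sub>R real n)"
      let ?b = "\<lambda>v. p (torus_point v /\<^sub>R real n) - space_mean n p"
      let ?c = "\<lambda>v :: nat ^ 'd. space_mean n p - ?I"
      have "deviation n (\<lambda>v. f (torus_point v /\<^sub>R real n) - ?I) t = deviation n (\<lambda>v. ?a v + (?b v + ?c v)) t"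
        by simp
      also have "\<dots> \<le> deviation n ?a t + deviation n (\<lambda>v. ?b v + ?c v) t" by (rule deviation_add[OF n])
      also have "\<dots> \<le> deviation n ?a t + (deviation n ?b t + deviation n ?c t)"
        by (intro add_left_mono deviation_add[OF n])
      also have "\<dots> \<le> (e / 5 + e / 5) + (e / 5 + 2 * (e / 5))"
        using elim L1 deviation_const[OF n, of "space_mean n p - ?I" t] close by linarith
      finally show ?case by simp
    qed
  qed
qed

end

section \<open>The scaling limit\<close>

theorem theorem7p1:
  fixes P :: "nat \<Rightarrow> 'w measure"
    and X :: "nat \<Rightarrow> nat \<Rightarrow> 'w \<Rightarrow> nat ^ 'd"
    and \<tau> :: "nat \<Rightarrow> nat \<Rightarrow> 'w \<Rightarrow> real"
    and M :: "nat \<Rightarrow> real \<Rightarrow> 'w \<Rightarrow> (real ^ 'd) measure"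
  assumes walk: "\<And>n. n \<ge> 2 \<Longrightarrow> random_walk (P n) (torus_verts n) (torus_adj n) (X n) (\<tau> n)"
    and M: "\<And>n t \<omega>. n \<ge> 2 \<Longrightarrow> t \<ge> 0 \<Longrightarrow> \<omega> \<in> space (P n) \<Longrightarrow>
      M n t \<omega> = empirical_measure (torus_verts n)
        (earthworm_mass (torus_adj n) (\<lambda>v. 1 / real n ^ CARD('d)) (X n) (\<tau> n) t \<omega>)"
  shows "(\<forall>n\<ge>2. \<exists>(Q :: (real ^ 'd) measure measure) Minf.
            converges_in_distribution weak_topology (\<lambda>t. P n) (M n) Q Minf at_top) \<and>
         (\<forall>(Q :: nat \<Rightarrow> 'u measure) Minf (R :: 'r measure) U.
            (\<forall>n\<ge>2. converges_in_distribution weak_topology (\<lambda>t. P n) (M n) (Q n) (Minf n) at_top) \<and>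
            random_measure R U \<and>
            (AE \<omega> in R. U \<omega> = uniform_measure lborel (cbox 0 One)) \<longrightarrow>
            converges_in_distribution weak_topology
              Q (\<lambda>n \<omega>. rescaled (real n) (Minf n \<omega>)) R U sequentially)"
proof (intro conjI allI impI; (elim conjE)?)
  show "\<exists>(Q :: (real ^ 'd) measure measure) Minf.
      converges_in_distribution weak_topology (\<lambda>t. P n) (M n) Q Minf at_top" if "2 \<le> n" for n
    by (rule earthworm_converges[OF that walk[OF that] M[OF that]])
next
  fix Q :: "nat \<Rightarrow> 'u measure" and Minf :: "nat \<Rightarrow> 'u \<Rightarrow> (real ^ 'd) measure"
    and R :: "'r measure" and U :: "'r \<Rightarrow> (real ^ 'd) measure"
  assume conv: "\<forall>n\<ge>2. converges_in_distribution weak_topology (\<lambda>t. P n) (M n) (Q n) (Minf n) at_top"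
    and U: "random_measure R U" "AE \<omega> in R. U \<omega> = uniform_measure lborel (cbox 0 One)"
  interpret T: torus_walks P X
  proof (rule torus_walks.intro)
    show "regular_walk (torus_verts n) (torus_adj n) (torus_degree TYPE('d) n) (CARD('d) * n) (P n) (X n)"
      if "2 \<le> n" for n
      by (rule regular_walk_torus[OF that walk[OF that]])
  qed
  have rand: "random_measure (Q n) (Minf n)" if "2 \<le> n" for n
    using conv that by (simp add: converges_in_distribution_def)
  show "converges_in_distribution weak_topology Q (\<lambda>n \<omega>. rescaled (real n) (Minf n \<omega>)) R U sequentially"
  proof (rule weak_convergence_to_constant[OF _ U])
    show "\<forall>\<^sub>F n in sequentially. random_measure (Q n) (\<lambda>\<omega>. rescaled (real n) (Minf n \<omega>))"
      using eventually_ge_at_top[of 2]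
    proof eventually_elim
      case (elim n)
      then show ?case
        using rand[OF elim] measurable_compose[OF _ continuous_map_measurable_borel_of[OF continuous_map_rescaled]]
        unfolding random_element_def by blast
    qed
    show "uniform_cube \<in> finite_borel_measures"
      using prob_space.finite_measure[OF prob_space_uniform_cube] by (simp add: finite_borel_measures_def)
  next
    fix f :: "real ^ 'd \<Rightarrow> real" and e :: real
    assume f: "continuous_on UNIV f" "bounded (range f)" and e: "0 < e"
    obtain C where C: "\<And>x. \<bar>f x\<bar> \<le> C" using f(2) by (auto simp: bounded_iff)
    let ?I = "\<integral>x. f x \<partial>uniform_cube"
    have f_meas: "f \<in> borel_measurable borel" using f(1) by (rule borel_measurable_continuous_onI)
    \<comment> \<open>A bounded continuous functional that dominates the indicator of a deviation by \<open>e\<close>; its mean passes to the limit in \<open>t\<close>.\<close>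
    define \<Gamma> where "\<Gamma> n \<mu> = min 1 (\<bar>(\<integral>x. f x \<partial>rescaled (real n) \<mu>) - ?I\<bar> / e)" for n and \<mu> :: "(real ^ 'd) measure"
    have \<Gamma>_cont: "continuous_map weak_topology euclideanreal (\<Gamma> n)" for n
    proof -
      have "continuous_map weak_topology euclideanreal (\<lambda>\<mu>. \<integral>x. f x \<partial>rescaled (real n) \<mu>)"
        using continuous_map_compose[OF continuous_map_rescaled continuous_map_from_weak_topology[OF f]]
        by (simp add: o_def)
      moreover have "continuous_map euclideanreal euclideanreal (\<lambda>z. min 1 (\<bar>z - ?I\<bar> / e))"
        using e by (auto intro!: continuous_intros)
      ultimately have "continuous_map weak_topology euclideanreal
          ((\<lambda>z. min 1 (\<bar>z - ?I\<bar> / e)) \<circ> (\<lambda>\<mu>. \<integral>x. f x \<partial>rescaled (real n) \<mu>))"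
        by (rule continuous_map_compose)
      then show ?thesis by (simp add: o_def \<Gamma>_def[abs_def])
    qed
    have \<Gamma>_bounds: "0 \<le> \<Gamma> n \<mu>" "\<Gamma> n \<mu> \<le> 1" for n \<mu>
      using e by (auto simp: \<Gamma>_def)
    have \<Gamma>_bounded: "bounded (\<Gamma> n ` topspace weak_topology)" for n
      using \<Gamma>_bounds by (auto simp: bounded_iff intro!: exI[of _ 1])
    have small: "\<forall>\<^sub>F n in sequentially. (\<integral>\<omega>. \<Gamma> n (Minf n \<omega>) \<partial>Q n) \<le> \<epsilon>" if \<epsilon>: "0 < \<epsilon>" for \<epsilon>
    proof -
      have "0 < \<epsilon> * e" using \<epsilon> e by simp
      from T.deviation_from_integral[OF f(1) C this]
      show ?thesis
        using eventually_ge_at_top[of 2]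
      proof eventually_elim
        case (elim n)
        then have n: "2 \<le> n" by simp
        interpret W: regular_walk "torus_verts n" "torus_adj n" "torus_degree TYPE('d) n" "CARD('d) * n" "P n" "X n"
          by (rule regular_walk_torus[OF n walk[OF n]])
        note md = mass_dist_uniform[OF n, where 'd='d]
        define h where "h m = \<Gamma> n (empirical_measure (torus_verts n) m)" for m :: "nat ^ 'd \<Rightarrow> real"
        have h1: "\<bar>h m\<bar> \<le> 1" for m using \<Gamma>_bounds by (simp add: h_def)
        have lim: "((\<lambda>t. \<integral>\<omega>. \<Gamma> n (M n t \<omega>) \<partial>P n) \<longlongrightarrow> (\<integral>\<omega>. \<Gamma> n (Minf n \<omega>) \<partial>Q n)) at_top"
          using conv n \<Gamma>_cont \<Gamma>_bounded unfolding converges_in_distribution_def by blast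
        have "\<forall>\<^sub>F t in at_top. (\<integral>\<omega>. \<Gamma> n (M n t \<omega>) \<partial>P n) \<le> \<epsilon>"
          using elim(1) eventually_gt_at_top[of 0]
        proof eventually_elim
          case (elim t)
          have "(\<integral>\<omega>. \<Gamma> n (M n t \<omega>) \<partial>P n)
              = (\<integral>\<omega>. h (earthworm_mass (torus_adj n) (uniform_mass n) (X n) (\<tau> n) t \<omega>) \<partial>P n)"
            using M[OF n] elim(2) by (intro Bochner_Integration.integral_cong refl) (simp add: h_def)
          also have "\<dots> = W.time_mean (uniform_mass n) (\<lambda>m b. h m) t"
            using expectation_earthworm[OF walk[OF n] W.regular_walk_axioms elim(2) h1]
            by (simp add: W.time_mean_def[OF md] W.state_mean_def[OF md, abs_def])
          also have "\<dots> \<le> W.time_mean (uniform_mass n)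
              (\<lambda>m b. (1 / e) * \<bar>\<Sum>v\<in>torus_verts n. (f (torus_point v /\<^sub>R real n) - ?I) * m v\<bar>) t"
          proof (rule W.time_mean_mono[OF md])
            show "W.state_bounded (\<lambda>m b. h m)" by (rule W.state_boundedI[OF md]) (rule h1)
            show "W.state_bounded (\<lambda>m b. (1 / e) * \<bar>\<Sum>v\<in>torus_verts n. (f (torus_point v /\<^sub>R real n) - ?I) * m v\<bar>)"
              by (intro W.state_bounded_mult[OF md] W.state_bounded_const[OF md] T.state_bounded_abs[OF n] T.bounded_integral[OF n])
            fix m :: "nat ^ 'd \<Rightarrow> real" assume m: "W.mass_dist m"
            have scaled_meas: "(\<lambda>x. f (x /\<^sub>R real n)) \<in> borel_measurable borel"
              by (rule measurable_compose[OF scale_measurable f_meas])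
            have "(\<integral>x. f x \<partial>rescaled (real n) (empirical_measure (torus_verts n) m))
                = (\<Sum>v\<in>torus_verts n. max 0 (m v) * f (torus_point v /\<^sub>R real n))"
              unfolding integral_rescaled[OF sets_empirical_measure f_meas]
              by (rule integral_empirical_measure[OF finite_torus_verts scaled_meas])
            also have "\<dots> = (\<Sum>v\<in>torus_verts n. f (torus_point v /\<^sub>R real n) * m v)"
              using m by (intro sum.cong refl) (simp add: W.mass_dist_def)
            finally have "(\<integral>x. f x \<partial>rescaled (real n) (empirical_measure (torus_verts n) m)) - ?I
                = (\<Sum>v\<in>torus_verts n. (f (torus_point v /\<^sub>R real n) - ?I) * m v)"
              using m by (simp add: left_diff_distrib sum_subtractf sum_distrib_left[symmetric] W.mass_dist_def)
            then show "h m \<le> (1 / e) * \<bar>\<Sum>v\<in>torus_verts n. (f (torus_point v /\<^sub>R real n) - ?I) * m v\<bar>"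
              unfolding h_def \<Gamma>_def by simp
          qed
          also have "\<dots> = (1 / e) * T.deviation n (\<lambda>v. f (torus_point v /\<^sub>R real n) - ?I) t"
            unfolding T.deviation_def W.time_mean_scale[OF md] ..
          also have "\<dots> \<le> (1 / e) * (\<epsilon> * e)"
            using elim(1) e by (intro mult_left_mono) auto
          also have "\<dots> = \<epsilon>" using e by simp
          finally show ?case .
        qed
        then show ?case by (rule tendsto_upperbound[OF lim]) simp
      qed
    qed
    show "(\<lambda>n. measure (Q n) {\<omega> \<in> space (Q n). e \<le> \<bar>(\<integral>x. f x \<partial>rescaled (real n) (Minf n \<omega>)) - ?I\<bar>}) \<longlonglongrightarrow> 0"
    proof (rule tendstoI)
      fix \<epsilon> :: real assume \<epsilon>: "0 < \<epsilon>"
      then have "0 < \<epsilon> / 2" by simp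
      from small[OF this] eventually_ge_at_top[of 2]
      show "\<forall>\<^sub>F n in sequentially. dist (measure (Q n) {\<omega> \<in> space (Q n). e \<le> \<bar>(\<integral>x. f x \<partial>rescaled (real n) (Minf n \<omega>)) - ?I\<bar>}) 0 < \<epsilon>"
      proof eventually_elim
        case (elim n)
        have r: "random_measure (Q n) (Minf n)" by (rule rand[OF elim(2)])
        interpret prob_space "Q n" using r by (simp add: random_element_def)
        let ?B = "{\<omega> \<in> space (Q n). e \<le> \<bar>(\<integral>x. f x \<partial>rescaled (real n) (Minf n \<omega>)) - ?I\<bar>}"
        have \<Gamma>_meas: "(\<lambda>\<omega>. \<Gamma> n (Minf n \<omega>)) \<in> borel_measurable (Q n)"
          using r by (intro continuous_map_borel_measurable[OF \<Gamma>_cont]) (simp add: random_element_def)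
        have B_eq: "?B = {\<omega> \<in> space (Q n). 1 \<le> \<Gamma> n (Minf n \<omega>)}"
          using e by (auto simp: \<Gamma>_def)
        have B: "?B \<in> sets (Q n)" unfolding B_eq using \<Gamma>_meas by measurable
        have "measure (Q n) ?B = expectation (indicator ?B)" using B by simp
        also have "\<dots> \<le> expectation (\<lambda>\<omega>. \<Gamma> n (Minf n \<omega>))"
        proof (rule integral_mono)
          show "integrable (Q n) (indicator ?B :: _ \<Rightarrow> real)" using B by (auto simp: emeasure_eq_measure)
          show "integrable (Q n) (\<lambda>\<omega>. \<Gamma> n (Minf n \<omega>))"
            by (rule integrable_const_bound[OF _ \<Gamma>_meas, of 1]) (use \<Gamma>_bounds in auto)
          show "indicator ?B \<omega> \<le> \<Gamma> n (Minf n \<omega>)" for \<omega>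
            unfolding B_eq using \<Gamma>_bounds by (auto simp: indicator_def)
        qed
        also have "\<dots> \<le> \<epsilon> / 2" by (rule elim(1))
        finally show ?case using \<epsilon> by simp
      qed
    qed
  qed
qed

end
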